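(* Suppose the following Assumption holds: there is a nonrandom constant $M>1$ such that $\lim_{n\to\infty}\mathbb P(\tau_n<M|\ell_n|)=1$. Then there is a constant $h>0$ such that for all $t\ge0$, \[ \lim_{n\to\infty}\mathbb P\Big(\frac{cn+A(B,F;\bar\gamma_n)}{h\,n^{\zeta}}\ge t\Big)=\exp\big(-t^{2\kappa+3}\big). \]
   Context: Let $c>0$, $q>0$, $\kappa>-1$. $F=(F(x))_{x\in\mathbb Z}$ and $B=(B(i))_{i\in\mathbb Z}$ are mutually independent families of i.i.d. random variables, $\mathbb P(B(i)=\pm1)=1/2$, and $F(x)$ has a density $\varrho$ that is even, continuous, strictly positive on $(-c,c)$, zero outside $(-c,c)$, with $\lim_{x\to c}\varrho(x)/|c-x|^{\kappa}=q$. A lazy walk of length $n$ is $\gamma:\{0,\dots,n\}\to\mathbb Z$ with $|\gamma(i+1)-\gamma(i)|\le1$; its action is $A(B,F;\gamma)=\sum_{i=1}^nB(i)F(\gamma(i))$. $\bar\gamma_n$ denotes a minimizer of $A(B,F;\cdot)$ among lazy walks of length $n$ with $\gamma(0)=0$ (free endpoint). The discrepancy is $d(x)=2c-|F(x+1)-F(x)|$; $\ell_n=\operatorname{argmin}_{x\in\operatorname{range}(\bar\gamma_n)}d(x)$ and $\tau_n=\min\{i:\bar\gamma_n(i)\in\{\ell_n,\ell_n+1\}\}$. Let $\zeta=\frac{2\kappa+2}{2\kappa+3}$. *)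

theory Defs
  imports "HOL-Probability.Probability"
begin

text \<open>Lazy walk of length n started at 0 (values beyond n are irrelevant).\<close>
definition lazy_walk :: "nat \<Rightarrow> (nat \<Rightarrow> int) \<Rightarrow> bool" where
  "lazy_walk n \<gamma> \<longleftrightarrow> \<gamma> 0 = 0 \<and> (\<forall>i<n. \<bar>\<gamma> (Suc i) - \<gamma> i\<bar> \<le> 1)"

definition action :: "(int \<Rightarrow> 'a \<Rightarrow> real) \<Rightarrow> (int \<Rightarrow> 'a \<Rightarrow> real) \<Rightarrow> nat \<Rightarrow> (nat \<Rightarrow> int) \<Rightarrow> 'a \<Rightarrow> real" where
  "action B F n \<gamma> w = (\<Sum>i=1..n. B (int i) w * F (\<gamma> i) w)"

definition discrepancy :: "real \<Rightarrow> (int \<Rightarrow> 'a \<Rightarrow> real) \<Rightarrow> int \<Rightarrow> 'a \<Rightarrow> real" where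
  "discrepancy c F x w = 2 * c - \<bar>F (x + 1) w - F x w\<bar>"

definition first_hit :: "(nat \<Rightarrow> int) \<Rightarrow> int \<Rightarrow> nat" where
  "first_hit \<gamma> l = (LEAST i. \<gamma> i \<in> {l, l + 1})"

end

theory Submission
  imports Defs
begin

text \<open>
  Write \<open>N = n powr \<zeta>\<close>. The quantity \<open>c * n + action\<close> is a sum of nonnegative step costs \<open>c + B i * F (\<gamma> i)\<close>.
  A good walk travels to a site \<open>x\<close> at distance of order \<open>N\<close> with \<open>F x\<close> and \<open>F (x + 1)\<close> close to opposite
  endpoints \<open>c\<close> and \<open>-c\<close>, and then oscillates between \<open>x\<close> and \<open>x + 1\<close>. Oscillating costs about
  \<open>n * d x / 2\<close>, as both signs of \<open>B\<close> have frequency one half. Travelling costs about \<open>a * \<bar>x\<bar>\<close>: for a fixed speed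
  the passage cost is subadditive and locally dependent, hence it obeys a law of large numbers, and the
  assumption on the hitting time bounds the speed away from \<open>0\<close>. So the minimal cost is
  \<open>min (a * \<bar>x\<bar> + n * d x / 2)\<close> over \<open>x\<close>, up to \<open>o(N)\<close>.

  That nothing better can be done follows by cutting time into blocks of a fixed length: a block that is
  cheap only meets sites with \<open>\<bar>F\<bar>\<close> close to \<open>c\<close>, and no three consecutive sites are like that, so in this
  block the walk sits on a single pair.

  Finally \<open>d x < s\<close> has probability asymptotic to a multiple of \<open>s powr (2 * \<kappa> + 2)\<close> and the \<open>d x\<close> are
  one-dependent, so the number of \<open>x\<close> with \<open>a * \<bar>x\<bar> + n * d x / 2 < t * N\<close> is asymptotically Poisson with
  mean proportional to \<open>t powr (2 * \<kappa> + 3)\<close>.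
\<close>

section \<open>Lazy walks and passage costs\<close>

text \<open>The exponent \<open>\<zeta>\<close> balances two costs: among \<open>N\<close> sites the
  least discrepancy is of order \<open>N powr (- 1 / (2 * \<kappa> + 2))\<close>, and staying there
  for time \<open>n\<close> costs order \<open>N\<close> exactly when
  \<open>N = n powr \<zeta>\<close>. The relevant discrepancies are thus of order
  \<open>N / n\<close>. The lower bound hinges on what counts as a cheap step. A threshold
  \<open>R * N / n\<close> serves both needs. A total cost \<open>t * N\<close> leaves room for at
  most \<open>t * n / R\<close> dearer steps, hence for few spoiled blocks once \<open>R\<close> is
  large compared with the block length. And one charge is that close to the edge with probability of
  order \<open>N powr (- 1 / 2)\<close>, so three in a row somewhere among order \<open>N\<close>
  sites have probability tending to \<open>0\<close>, whereas the expected number of two in a row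
  stays of order one. The travel constant is an infimum over rational speeds \<open>p / r\<close>.
  The hitting-time assumption confines the lower bound to finitely many pairs \<open>(p, r)\<close>
  at a given resolution, so a union bound needs only convergence in probability for each pair and no
  rates.\<close>

definition path_cost ::
  "(real \<Rightarrow> real \<Rightarrow> real) \<Rightarrow> (int \<Rightarrow> real) \<Rightarrow> (int \<Rightarrow> real) \<Rightarrow> (nat \<Rightarrow> int) \<Rightarrow> nat \<Rightarrow> real" where
  "path_cost \<phi> f b \<gamma> s = (\<Sum>i=1..s. \<phi> (b (int i)) (f (\<gamma> i)))"

text \<open>Values after time \<open>s\<close> are pinned to \<open>0\<close> so that the set is
  finite and a minimum over it exists.\<close>

definition walks_to :: "int \<Rightarrow> nat \<Rightarrow> (nat \<Rightarrow> int) set" where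
  "walks_to x s = {\<gamma>. lazy_walk s \<gamma> \<and> \<gamma> s = x \<and> (\<forall>i>s. \<gamma> i = 0)}"

text \<open>Point-to-point cost with prescribed duration; the walk may overshoot \<open>x\<close> on
  the way. The environment enters as two plain functions, so that shifts and reflections of it are
  mere substitutions.\<close>

definition passage ::
  "(real \<Rightarrow> real \<Rightarrow> real) \<Rightarrow> (int \<Rightarrow> real) \<Rightarrow> (int \<Rightarrow> real) \<Rightarrow> int \<Rightarrow> nat \<Rightarrow> real" where
  "passage \<phi> f b x s = Min ((\<lambda>\<gamma>. path_cost \<phi> f b \<gamma> s) ` walks_to x s)"

lemma lazy_walk_bound:
  assumes "lazy_walk n \<gamma>" "i \<le> n"
  shows "\<bar>\<gamma> i\<bar> \<le> int i"
  using assms(2)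
proof (induction i)
  case 0
  then show ?case using assms(1) by (simp add: lazy_walk_def)
next
  case (Suc i)
  then have "\<bar>\<gamma> (Suc i) - \<gamma> i\<bar> \<le> 1" using assms(1) by (simp add: lazy_walk_def)
  with Suc show ?case by simp
qed

lemma lazy_walk_truncate:
  "lazy_walk n \<gamma> \<Longrightarrow> lazy_walk n (\<lambda>i. if i \<le> n then \<gamma> i else d)"
  by (auto simp: lazy_walk_def)

lemma lazy_walk_mono: "lazy_walk n \<gamma> \<Longrightarrow> m \<le> n \<Longrightarrow> lazy_walk m \<gamma>"
  by (auto simp: lazy_walk_def)

lemma path_cost_cong:
  assumes "\<And>i. 1 \<le> i \<Longrightarrow> i \<le> s \<Longrightarrow> \<gamma> i = \<gamma>' i"
  shows "path_cost \<phi> f b \<gamma> s = path_cost \<phi> f b \<gamma>' s"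
  unfolding path_cost_def by (intro sum.cong) (auto simp: assms)

lemma finite_lazy_walks: "finite {\<gamma>. lazy_walk s \<gamma> \<and> (\<forall>i>s. \<gamma> i = 0)}"
proof (rule finite_subset)
  show "{\<gamma>. lazy_walk s \<gamma> \<and> (\<forall>i>s. \<gamma> i = 0)} \<subseteq>
      {\<gamma>. \<forall>i. (i \<in> {..s} \<longrightarrow> \<gamma> i \<in> {- int s..int s}) \<and> (i \<notin> {..s} \<longrightarrow> \<gamma> i = 0)}"
  proof (intro subsetI CollectI allI conjI impI)
    fix \<gamma> i assume *: "\<gamma> \<in> {\<gamma>. lazy_walk s \<gamma> \<and> (\<forall>i>s. \<gamma> i = 0)}"
    show "\<gamma> i \<in> {- int s..int s}" if "i \<in> {..s}"
      using * that lazy_walk_bound[of s \<gamma> i] by auto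
    show "\<gamma> i = 0" if "i \<notin> {..s}" using * that by auto
  qed
  show "finite {\<gamma> :: nat \<Rightarrow> int. \<forall>i. (i \<in> {..s} \<longrightarrow> \<gamma> i \<in> {- int s..int s}) \<and> (i \<notin> {..s} \<longrightarrow> \<gamma> i = 0)}"
    by (rule finite_set_of_finite_funs) auto
qed

lemma finite_walks_to: "finite (walks_to x s)"
  by (rule finite_subset[OF _ finite_lazy_walks[of s]]) (auto simp: walks_to_def)

lemma walks_to_nonempty:
  assumes "\<bar>x\<bar> \<le> int s"
  shows "walks_to x s \<noteq> {}"
proof -
  \<comment> \<open>Straight to \<open>x\<close> at full speed, then wait there until time
    \<open>s\<close>.\<close>
  have "(\<lambda>i. if i \<le> s then sgn x * min (int i) \<bar>x\<bar> else 0) \<in> walks_to x s"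
    using assms by (auto simp: walks_to_def lazy_walk_def min_def sgn_if)
  then show ?thesis by blast
qed

lemma passage_le_path_cost:
  assumes "lazy_walk s \<gamma>" "\<gamma> s = x"
  shows "passage \<phi> f b x s \<le> path_cost \<phi> f b \<gamma> s"
proof -
  let ?g = "\<lambda>i. if i \<le> s then \<gamma> i else 0"
  have "?g \<in> walks_to x s"
    using assms lazy_walk_truncate[OF assms(1)] by (simp add: walks_to_def)
  then have "passage \<phi> f b x s \<le> path_cost \<phi> f b ?g s"
    unfolding passage_def by (intro Min_le finite_imageI finite_walks_to) auto
  also have "\<dots> = path_cost \<phi> f b \<gamma> s" by (rule path_cost_cong) auto
  finally show ?thesis .
qed

lemma passage_attained:
  assumes "\<bar>x\<bar> \<le> int s"
  obtains \<gamma> where "lazy_walk s \<gamma>" "\<gamma> s = x" "passage \<phi> f b x s = path_cost \<phi> f b \<gamma> s"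
proof -
  have "passage \<phi> f b x s \<in> (\<lambda>\<gamma>. path_cost \<phi> f b \<gamma> s) ` walks_to x s"
    unfolding passage_def using walks_to_nonempty[OF assms]
    by (intro Min_in finite_imageI finite_walks_to) auto
  then show ?thesis using that by (auto simp: walks_to_def)
qed

lemma lazy_walk_append:
  assumes "lazy_walk s \<gamma>" "lazy_walk t \<delta>"
  shows "lazy_walk (s + t) (\<lambda>i. if i \<le> s then \<gamma> i else \<gamma> s + \<delta> (i - s))"
  unfolding lazy_walk_def
proof (intro conjI allI impI)
  fix i assume i: "i < s + t"
  consider "i < s" | "i = s" | j where "i = s + Suc j" "Suc j < t"
  proof -
    have "i = s + Suc (i - s - 1)" "Suc (i - s - 1) < t" if "s < i" using that i by auto
    then show ?thesis using that by (metis linorder_neqE_nat)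
  qed
  then show "\<bar>(if Suc i \<le> s then \<gamma> (Suc i) else \<gamma> s + \<delta> (Suc i - s))
      - (if i \<le> s then \<gamma> i else \<gamma> s + \<delta> (i - s))\<bar> \<le> 1"
  proof cases
    case 1
    then show ?thesis using assms(1) by (simp add: lazy_walk_def)
  next
    case 2
    then have "\<bar>\<delta> (Suc 0) - \<delta> 0\<bar> \<le> 1" "\<delta> 0 = 0"
      using assms(2) i by (auto simp: lazy_walk_def)
    then show ?thesis using 2 by simp
  next
    case 3
    then have "\<bar>\<delta> (Suc (Suc j)) - \<delta> (Suc j)\<bar> \<le> 1"
      using assms(2) by (auto simp: lazy_walk_def)
    then show ?thesis using 3 by simp
  qed
qed (use assms in \<open>auto simp: lazy_walk_def\<close>)

lemma path_cost_append:
  "path_cost \<phi> f b (\<lambda>i. if i \<le> s then \<gamma> i else \<gamma> s + \<delta> (i - s)) (s + t) =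
   path_cost \<phi> f b \<gamma> s + path_cost \<phi> (\<lambda>y. f (\<gamma> s + y)) (\<lambda>i. b (int s + i)) \<delta> t"
proof -
  have un: "{1..s+t} = {1..s} \<union> {s+1..s+t}" by auto
  have "path_cost \<phi> f b (\<lambda>i. if i \<le> s then \<gamma> i else \<gamma> s + \<delta> (i - s)) (s + t) =
     path_cost \<phi> f b \<gamma> s + (\<Sum>i=s+1..s+t. \<phi> (b (int i)) (f (\<gamma> s + \<delta> (i - s))))"
    unfolding path_cost_def un by (subst sum.union_disjoint) (auto intro!: arg_cong2[where f="(+)"] sum.cong)
  also have "(\<Sum>i=s+1..s+t. \<phi> (b (int i)) (f (\<gamma> s + \<delta> (i - s)))) =
     (\<Sum>i=1..t. \<phi> (b (int s + int i)) (f (\<gamma> s + \<delta> i)))"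
    by (rule sum.reindex_bij_witness[of _ "\<lambda>i. s + i" "\<lambda>i. i - s"]) auto
  finally show ?thesis by (simp add: path_cost_def)
qed

text \<open>Concatenate optimal walks: the second one starts at \<open>x\<close> at time
  \<open>s\<close>, so it sees the environment shifted by these amounts. This is the subadditivity
  that produces the limiting speeds.\<close>

lemma passage_subadditive:
  assumes "\<bar>x\<bar> \<le> int s" "\<bar>y\<bar> \<le> int t"
  shows "passage \<phi> f b (x + y) (s + t) \<le>
    passage \<phi> f b x s + passage \<phi> (\<lambda>z. f (x + z)) (\<lambda>i. b (int s + i)) y t"
proof -
  obtain \<gamma> where \<gamma>: "lazy_walk s \<gamma>" "\<gamma> s = x" "passage \<phi> f b x s = path_cost \<phi> f b \<gamma> s"
    using passage_attained[OF assms(1)] .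
  obtain \<delta> where \<delta>: "lazy_walk t \<delta>" "\<delta> t = y"
    "passage \<phi> (\<lambda>z. f (x + z)) (\<lambda>i. b (int s + i)) y t =
      path_cost \<phi> (\<lambda>z. f (x + z)) (\<lambda>i. b (int s + i)) \<delta> t"
    using passage_attained[OF assms(2)] .
  have "\<delta> 0 = 0" using \<delta>(1) by (simp add: lazy_walk_def)
  then have "passage \<phi> f b (x + y) (s + t) \<le>
      path_cost \<phi> f b (\<lambda>i. if i \<le> s then \<gamma> i else \<gamma> s + \<delta> (i - s)) (s + t)"
    using \<gamma> \<delta> by (intro passage_le_path_cost lazy_walk_append) auto
  then show ?thesis using path_cost_append[of \<phi> f b s \<gamma> \<delta> t] \<gamma> \<delta> by simp
qed

lemma path_cost_bounds:
  assumes "\<And>u v. 0 \<le> \<phi> u v" "\<And>u v. \<phi> u v \<le> C"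
  shows "0 \<le> path_cost \<phi> f b \<gamma> s" "path_cost \<phi> f b \<gamma> s \<le> C * real s"
proof -
  show "0 \<le> path_cost \<phi> f b \<gamma> s" unfolding path_cost_def by (intro sum_nonneg assms)
  have "path_cost \<phi> f b \<gamma> s \<le> (\<Sum>i=1..s. C)" unfolding path_cost_def by (intro sum_mono assms)
  then show "path_cost \<phi> f b \<gamma> s \<le> C * real s" by (simp add: mult.commute)
qed

lemma passage_bounds:
  assumes "\<And>u v. 0 \<le> \<phi> u v" "\<And>u v. \<phi> u v \<le> C" "\<bar>x\<bar> \<le> int s"
  shows "0 \<le> passage \<phi> f b x s" "passage \<phi> f b x s \<le> C * real s"
proof -
  obtain \<gamma> where "passage \<phi> f b x s = path_cost \<phi> f b \<gamma> s"
    using passage_attained[OF assms(3)] .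
  then show "0 \<le> passage \<phi> f b x s" "passage \<phi> f b x s \<le> C * real s"
    using path_cost_bounds[of \<phi> C f b \<gamma> s, OF assms(1,2)] by simp_all
qed

text \<open>Used to absorb rounding: moving the endpoint and prolonging the walk costs at most
  \<open>C\<close> for each extra step.\<close>

lemma passage_extend:
  assumes "\<And>u v. 0 \<le> \<phi> u v" "\<And>u v. \<phi> u v \<le> C" "\<bar>x\<bar> \<le> int s" "\<bar>x' - x\<bar> \<le> int t"
  shows "passage \<phi> f b x' (s + t) \<le> passage \<phi> f b x s + C * real t"
  using passage_subadditive[OF assms(3,4), of \<phi> f b]
    passage_bounds(2)[of \<phi> C "x' - x" t "\<lambda>z. f (x + z)" "\<lambda>i. b (int s + i)"] assms by simp

text \<open>Locality: a walk of \<open>s\<close> steps stays within distance \<open>s\<close> and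
  reads the times \<open>1..s\<close>. The finite-range dependence of block costs rests on
  this.\<close>

lemma passage_cong:
  assumes "\<And>y. \<bar>y\<bar> \<le> int s \<Longrightarrow> f y = f' y" "\<And>i. 1 \<le> i \<Longrightarrow> i \<le> int s \<Longrightarrow> b i = b' i"
  shows "passage \<phi> f b x s = passage \<phi> f' b' x s"
proof -
  have "path_cost \<phi> f b \<gamma> s = path_cost \<phi> f' b' \<gamma> s" if "\<gamma> \<in> walks_to x s" for \<gamma>
    unfolding path_cost_def
  proof (intro sum.cong refl arg_cong2[where f=\<phi>] assms)
    fix i assume "i \<in> {1..s}"
    then show "\<bar>\<gamma> i\<bar> \<le> int s" using that lazy_walk_bound[of s \<gamma> i] by (simp add: walks_to_def)
  qed auto
  then show ?thesis unfolding passage_def by (simp cong: image_cong)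
qed

lemma lazy_walk_intermediate:
  assumes "\<And>i. s \<le> i \<Longrightarrow> i < t \<Longrightarrow> \<bar>\<gamma> (Suc i) - \<gamma> i\<bar> \<le> (1::int)" "s \<le> t"
    "\<gamma> s \<le> z \<and> z \<le> \<gamma> t \<or> \<gamma> t \<le> z \<and> z \<le> \<gamma> s"
  obtains i where "s \<le> i" "i \<le> t" "\<gamma> i = z"
proof -
  have *: "\<exists>i\<le>t-s. g (s + i) = z'"
    if "\<And>i. s \<le> i \<Longrightarrow> i < t \<Longrightarrow> \<bar>g (Suc i) - g i\<bar> \<le> (1::int)" "g s \<le> z'" "z' \<le> g t" for g z'
    using nat0_intermed_int_val[of "t - s" "\<lambda>i. g (s + i)" z'] that assms(2) by auto
  have "\<exists>i\<le>t-s. \<gamma> (s + i) = z"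
    using assms(3)
  proof
    assume "\<gamma> s \<le> z \<and> z \<le> \<gamma> t"
    then show ?thesis using *[of \<gamma> z] assms(1) by auto
  next
    assume "\<gamma> t \<le> z \<and> z \<le> \<gamma> s"
    then have "\<exists>i\<le>t-s. - \<gamma> (s + i) = - z"
      using *[of "\<lambda>i. - \<gamma> i" "- z"] assms(1) by (auto simp: abs_minus_commute)
    then show ?thesis by simp
  qed
  then obtain i where "i \<le> t - s" "\<gamma> (s + i) = z" by blast
  then show ?thesis using that[of "s + i"] assms(2) by simp
qed


lemma path_cost_ge_sum_sites:
  assumes walk: "lazy_walk n \<gamma>" and i: "i \<le> n" "int m \<le> \<sigma> * \<gamma> i" and \<sigma>: "\<sigma> = 1 \<or> \<sigma> = -1"
    and nonneg: "\<And>u v. 0 \<le> \<phi> u v"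
    and lower: "\<And>j y. \<psi> (f y) \<le> \<phi> (b j) (f y)"
  shows "(\<Sum>j=1..m. \<psi> (f (\<sigma> * int j))) \<le> path_cost \<phi> f b \<gamma> n"
proof -
  have "\<exists>k. 1 \<le> k \<and> k \<le> n \<and> \<gamma> k = \<sigma> * int j" if j: "j \<in> {1..m}" for j
  proof -
    have 0: "\<gamma> 0 = 0" using walk by (simp add: lazy_walk_def)
    obtain k where k: "0 \<le> k" "k \<le> i" "\<gamma> k = \<sigma> * int j"
      by (rule lazy_walk_intermediate[of 0 i \<gamma> "\<sigma> * int j"])
        (use walk i \<sigma> j 0 in \<open>auto simp: lazy_walk_def\<close>)
    \<comment> \<open>Time \<open>0\<close> carries no cost, so the visit has to be a later one; the
      sites in question all differ from the starting point.\<close>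
    then have "k \<noteq> 0" using 0 j \<sigma> by (intro notI) auto
    then show ?thesis using k i by (intro exI[of _ k]) auto
  qed
  then obtain k where k: "\<And>j. j \<in> {1..m} \<Longrightarrow> 1 \<le> k j \<and> k j \<le> n \<and> \<gamma> (k j) = \<sigma> * int j"
    by metis
  have inj: "inj_on k {1..m}"
  proof (rule inj_onI)
    fix x y assume "x \<in> {1..m}" "y \<in> {1..m}" "k x = k y"
    then have "\<sigma> * int x = \<sigma> * int y" using k by metis
    then show "x = y" using \<sigma> by auto
  qed
  have "(\<Sum>j=1..m. \<psi> (f (\<sigma> * int j))) \<le> (\<Sum>j=1..m. \<phi> (b (int (k j))) (f (\<gamma> (k j))))"
    using k lower by (intro sum_mono) auto
  also have "\<dots> = (\<Sum>i\<in>k ` {1..m}. \<phi> (b (int i)) (f (\<gamma> i)))"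
    using inj by (simp add: sum.reindex)
  also have "\<dots> \<le> path_cost \<phi> f b \<gamma> n"
    unfolding path_cost_def using k nonneg by (intro sum_mono2) auto
  finally show ?thesis .
qed

section \<open>A weak law for finite-range dependence, and i.i.d. environments\<close>

text \<open>For each index at most \<open>2 * D + 1\<close> covariances survive, each at most
  \<open>4 * K\<^sup>2\<close>; Chebyshev's inequality does the rest.\<close>

lemma (in prob_space) finite_range_weak_law:
  fixes X :: "nat \<Rightarrow> 'a \<Rightarrow> real"
  assumes meas [measurable]: "\<And>j. X j \<in> borel_measurable M"
    and bound: "\<And>j. AE w in M. \<bar>X j w\<bar> \<le> K"
    and uncorr: "\<And>i j. i + D < j \<Longrightarrow>
      expectation (\<lambda>w. X i w * X j w) = expectation (X i) * expectation (X j)"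
  shows "variance (\<lambda>w. \<Sum>j<k. X j w) \<le> real k * (2 * real D + 1) * (4 * K\<^sup>2)"
    and "\<epsilon> > 0 \<Longrightarrow> k > 0 \<Longrightarrow>
      prob {w \<in> space M. \<epsilon> * real k \<le> \<bar>(\<Sum>j<k. X j w) - (\<Sum>j<k. expectation (X j))\<bar>}
      \<le> (2 * real D + 1) * (4 * K\<^sup>2) / (\<epsilon>\<^sup>2 * real k)"
proof -
  have K: "K \<ge> 0"
  proof -
    have "AE w in M. 0 \<le> K" using bound[of 0] by eventually_elim auto
    then show ?thesis by simp
  qed
  have int [simp]: "integrable M (X j)" for j
    by (rule integrable_const_bound[of _ K]) (use bound in auto)
  have mean: "\<bar>expectation (X j)\<bar> \<le> K" for j
  proof -
    have "norm (expectation (X j)) \<le> expectation (\<lambda>w. norm (X j w))" by (rule integral_norm_bound)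
    also have "\<dots> \<le> expectation (\<lambda>w. K)"
      by (rule integral_mono_AE) (use bound in auto)
    finally show ?thesis by (simp add: prob_space)
  qed
  define Z where "Z j w = X j w - expectation (X j)" for j w
  have Zm [measurable]: "Z j \<in> borel_measurable M" for j unfolding Z_def by measurable
  have Zb: "AE w in M. \<bar>Z j w\<bar> \<le> 2 * K" for j
    using bound[of j] by eventually_elim (use mean[of j] in \<open>auto simp: Z_def\<close>)
  have ZZb: "AE w in M. \<bar>Z i w * Z j w\<bar> \<le> 4 * K\<^sup>2" for i j
    using Zb[of i] Zb[of j]
  proof eventually_elim
    case (elim w)
    have "\<bar>Z i w\<bar> * \<bar>Z j w\<bar> \<le> (2*K) * (2*K)" using elim K by (intro mult_mono) auto
    then show ?case by (simp add: abs_mult power2_eq_square)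
  qed
  have ZZint [simp]: "integrable M (\<lambda>w. Z i w * Z j w)" for i j
    by (rule integrable_const_bound[of _ "4 * K\<^sup>2"]) (use ZZb in auto)
  have XXint [simp]: "integrable M (\<lambda>w. X i w * X j w)" for i j
  proof (rule integrable_const_bound[of _ "K * K"])
    show "AE w in M. norm (X i w * X j w) \<le> K * K"
      using bound[of i] bound[of j]
      by eventually_elim (use K in \<open>auto simp: abs_mult intro!: mult_mono\<close>)
  qed auto
  have far: "expectation (\<lambda>w. Z i w * Z j w) = 0" if "i + D < j" for i j
  proof -
    have "(\<lambda>w. Z i w * Z j w) = (\<lambda>w. X i w * X j w - expectation (X j) * X i w - expectation (X i) * X j w
       + expectation (X i) * expectation (X j))"
      by (auto simp: Z_def fun_eq_iff algebra_simps)
    then have "expectation (\<lambda>w. Z i w * Z j w) =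
       expectation (\<lambda>w. X i w * X j w) - expectation (X j) * expectation (X i)
         - expectation (X i) * expectation (X j) + expectation (X i) * expectation (X j)"
      by (simp add: prob_space)
    then show ?thesis using uncorr[OF that] by (simp add: mult.commute)
  qed
  have far': "expectation (\<lambda>w. Z i w * Z j w) = 0" if "j + D < i" for i j
    using far[OF that] by (simp add: mult.commute)
  \<comment> \<open>Truncated subtraction in \<open>i-D\<close> is harmless: there are no indices
    below \<open>0\<close>.\<close>
  have ex: "expectation (\<lambda>w. Z i w * Z j w) \<le> (if j \<in> {i-D..i+D} then 4 * K\<^sup>2 else 0)" for i j
  proof (cases "j \<in> {i-D..i+D}")
    case True
    have "expectation (\<lambda>w. Z i w * Z j w) \<le> expectation (\<lambda>w. 4 * K\<^sup>2)"
    proof (rule integral_mono_AE)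
      show "AE w in M. Z i w * Z j w \<le> 4 * K\<^sup>2" using ZZb[of i j] by eventually_elim auto
    qed auto
    then show ?thesis using True by (simp add: prob_space)
  next
    case False
    then have "i + D < j \<or> j + D < i" by auto
    then show ?thesis using False far far' by auto
  qed
  have Ef: "expectation (\<lambda>w. \<Sum>j<k. X j w) = (\<Sum>j<k. expectation (X j))" by simp
  have sq: "((\<Sum>j<k. X j w) - (\<Sum>j<k. expectation (X j)))\<^sup>2 = (\<Sum>i<k. \<Sum>j<k. Z i w * Z j w)" for w
    by (simp add: Z_def sum_subtractf[symmetric] power2_eq_square sum_product)
  have "variance (\<lambda>w. \<Sum>j<k. X j w) = (\<Sum>i<k. \<Sum>j<k. expectation (\<lambda>w. Z i w * Z j w))"
    unfolding Ef sq by simp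
  also have "\<dots> \<le> (\<Sum>i<k. \<Sum>j<k. if j \<in> {i-D..i+D} then 4 * K\<^sup>2 else 0)"
    by (intro sum_mono ex)
  also have "\<dots> \<le> (\<Sum>i<k. (2 * real D + 1) * (4 * K\<^sup>2))"
  proof (intro sum_mono)
    fix i
    have "(\<Sum>j<k. if j \<in> {i-D..i+D} then 4 * K\<^sup>2 else 0) = (\<Sum>j\<in>{..<k} \<inter> {i-D..i+D}. 4 * K\<^sup>2)"
      by (subst sum.inter_restrict) auto
    also have "\<dots> \<le> (\<Sum>j\<in>{i-D..i+D}. 4 * K\<^sup>2)" by (intro sum_mono2) auto
    also have "\<dots> = real (card {i-D..i+D}) * (4 * K\<^sup>2)" by simp
    also have "\<dots> \<le> (2 * real D + 1) * (4 * K\<^sup>2)" by (intro mult_right_mono) auto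
    finally show "(\<Sum>j<k. if j \<in> {i-D..i+D} then 4 * K\<^sup>2 else 0) \<le> (2 * real D + 1) * (4 * K\<^sup>2)" .
  qed
  also have "\<dots> = real k * (2 * real D + 1) * (4 * K\<^sup>2)" by simp
  finally show var: "variance (\<lambda>w. \<Sum>j<k. X j w) \<le> real k * (2 * real D + 1) * (4 * K\<^sup>2)" .
  assume \<epsilon>: "\<epsilon> > 0" and k: "k > 0"
  have "integrable M (\<lambda>w. (\<Sum>j<k. X j w)\<^sup>2)"
    by (simp add: power2_eq_square sum_product)
  then have "prob {w \<in> space M. \<epsilon> * real k \<le> \<bar>(\<Sum>j<k. X j w) - expectation (\<lambda>w. \<Sum>j<k. X j w)\<bar>}
      \<le> variance (\<lambda>w. \<Sum>j<k. X j w) / (\<epsilon> * real k)\<^sup>2"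
    using \<epsilon> k by (intro Chebyshev_inequality) auto
  also have "\<dots> \<le> (real k * (2 * real D + 1) * (4 * K\<^sup>2)) / (\<epsilon> * real k)\<^sup>2"
    by (intro divide_right_mono var) auto
  also have "\<dots> = (2 * real D + 1) * (4 * K\<^sup>2) / (\<epsilon>\<^sup>2 * real k)"
    using k \<epsilon> by (simp add: power2_eq_square field_simps)
  finally show "prob {w \<in> space M. \<epsilon> * real k \<le> \<bar>(\<Sum>j<k. X j w) - (\<Sum>j<k. expectation (X j))\<bar>}
      \<le> (2 * real D + 1) * (4 * K\<^sup>2) / (\<epsilon>\<^sup>2 * real k)" unfolding Ef .
qed

lemma (in prob_space) finite_range_weak_law_tendsto:
  fixes X :: "nat \<Rightarrow> 'a \<Rightarrow> real"
  assumes "\<And>j. X j \<in> borel_measurable M"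
    and "\<And>j. AE w in M. \<bar>X j w\<bar> \<le> K"
    and "\<And>i j. i + D < j \<Longrightarrow>
      expectation (\<lambda>w. X i w * X j w) = expectation (X i) * expectation (X j)"
    and "\<epsilon> > 0"
  shows "(\<lambda>k. prob {w \<in> space M. \<epsilon> * real k \<le> \<bar>(\<Sum>j<k. X j w) - (\<Sum>j<k. expectation (X j))\<bar>})
    \<longlonglongrightarrow> 0"
proof (rule tendsto_sandwich[OF _ _ tendsto_const])
  show "\<forall>\<^sub>F k in sequentially.
     prob {w \<in> space M. \<epsilon> * real k \<le> \<bar>(\<Sum>j<k. X j w) - (\<Sum>j<k. expectation (X j))\<bar>}
     \<le> (2 * real D + 1) * (4 * K\<^sup>2) / \<epsilon>\<^sup>2 * inverse (real k)"
    using eventually_gt_at_top[of 0]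
  proof eventually_elim
    case (elim k)
    from finite_range_weak_law(2)[of X K D \<epsilon> k] assms elim show ?case
      by (simp add: divide_inverse)
  qed
  show "(\<lambda>k. (2 * real D + 1) * (4 * K\<^sup>2) / \<epsilon>\<^sup>2 * inverse (real k)) \<longlonglongrightarrow> 0"
    using tendsto_mult_right_zero[OF lim_inverse_n] by blast
qed auto

section \<open>Measurability, relabelling and locality in a random environment\<close>

lemma measurable_passage:
  assumes [measurable]: "case_prod \<phi> \<in> borel_measurable (borel \<Otimes>\<^sub>M borel)"
    and [measurable]: "\<And>y. (\<lambda>w. f w y) \<in> borel_measurable M" "\<And>i. (\<lambda>w. b w i) \<in> borel_measurable M"
  shows "(\<lambda>w. passage \<phi> (f w) (b w) x s) \<in> borel_measurable M"
proof -
  have "(\<lambda>w. \<phi> (b w i) (f w y)) \<in> borel_measurable M" for i y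
  proof -
    have "(\<lambda>w. case_prod \<phi> (b w i, f w y)) \<in> borel_measurable M" by measurable
    then show ?thesis by simp
  qed
  then show ?thesis unfolding passage_def path_cost_def
    by (intro borel_measurable_Min finite_walks_to borel_measurable_sum)
qed

text \<open>One family over the disjoint sum of sites and times expresses at once the independence
  within \<open>F\<close>, within \<open>B\<close>, and between them.\<close>

locale iid_environment = prob_space P for P :: "'a measure" +
  fixes F B :: "int \<Rightarrow> 'a \<Rightarrow> real"
  assumes indep: "indep_vars (\<lambda>_. borel) (case_sum F B) (UNIV :: (int + int) set)"
    and F_same: "\<And>x. distr P borel (F x) = distr P borel (F 0)"
    and B_same: "\<And>i. distr P borel (B i) = distr P borel (B 0)"
begin

lemma env_measurable: "case_sum F B k \<in> borel_measurable P"
  using indep by (simp add: indep_vars_def)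

lemma F_measurable [measurable]: "F x \<in> borel_measurable P"
  using env_measurable[of "Inl x"] by simp

lemma B_measurable [measurable]: "B i \<in> borel_measurable P"
  using env_measurable[of "Inr i"] by simp

text \<open>Both laws are the same product measure, since a relabelling by \<open>map_sum\<close>
  sends sites to sites and times to times. Translations and the reflection of space are the
  instances needed.\<close>

lemma distr_reindex:
  assumes "inj \<pi>" "inj \<tau>"
  shows "distr P (PiM UNIV (\<lambda>_. borel)) (\<lambda>w k. case_sum F B (map_sum \<pi> \<tau> k) w) =
    distr P (PiM UNIV (\<lambda>_. borel)) (\<lambda>w k. case_sum F B k w)"
proof -
  have "inj (map_sum \<pi> \<tau>)" using assms by (simp add: sum.inj_map)
  have "indep_vars (\<lambda>k. borel) (\<lambda>k. case_sum F B (map_sum \<pi> \<tau> k)) UNIV"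
  proof -
    \<comment> \<open>Grouping the independent family into disjoint singletons turns an injective
      relabelling into an instance of grouping.\<close>
    have "indep_vars (\<lambda>k. PiM {map_sum \<pi> \<tau> k} (\<lambda>_. borel))
        (\<lambda>k w. restrict (\<lambda>i. case_sum F B i w) {map_sum \<pi> \<tau> k}) UNIV"
      using \<open>inj (map_sum \<pi> \<tau>)\<close>
      by (intro indep_vars_restrict[OF indep]) (auto simp: disjoint_family_on_def inj_def)
    from indep_vars_compose2[OF this, where Y="\<lambda>k \<omega>. \<omega> (map_sum \<pi> \<tau> k)" and N="\<lambda>_. borel"]
    show ?thesis by simp
  qed
  moreover have "distr P borel (case_sum F B (map_sum \<pi> \<tau> k)) = distr P borel (case_sum F B k)" for k
    by (cases k) (simp_all add: F_same[of "\<pi> _"] F_same[symmetric] B_same[of "\<tau> _"] B_same[symmetric])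
  ultimately show ?thesis
    using indep indep_vars_iff_distr_eq_PiM[of UNIV "\<lambda>k. case_sum F B (map_sum \<pi> \<tau> k)" "\<lambda>_. borel"]
      indep_vars_iff_distr_eq_PiM[of UNIV "case_sum F B" "\<lambda>_. borel"] env_measurable
    by (simp add: restrict_UNIV)
qed


lemma integral_reindex:
  fixes \<Phi> :: "_ \<Rightarrow> real"
  assumes "inj \<pi>" "inj \<tau>" and [measurable]: "\<Phi> \<in> borel_measurable (PiM UNIV (\<lambda>_. borel))"
  shows "expectation (\<lambda>w. \<Phi> (\<lambda>k. case_sum F B (map_sum \<pi> \<tau> k) w)) =
    expectation (\<lambda>w. \<Phi> (\<lambda>k. case_sum F B k w))"
proof -
  have m: "(\<lambda>w k. case_sum F B (g k) w) \<in> measurable P (PiM UNIV (\<lambda>_. borel))" for g :: "int + int \<Rightarrow> int + int"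
    using measurable_PiM_single'[of UNIV "\<lambda>k w. case_sum F B (g k) w" P "\<lambda>_. borel"] env_measurable by simp
  have "expectation (\<lambda>w. \<Phi> (\<lambda>k. case_sum F B (map_sum \<pi> \<tau> k) w)) =
     integral\<^sup>L (distr P (PiM UNIV (\<lambda>_. borel)) (\<lambda>w k. case_sum F B (map_sum \<pi> \<tau> k) w)) \<Phi>"
    by (rule integral_distr[symmetric, OF m]) simp
  also have "\<dots> = integral\<^sup>L (distr P (PiM UNIV (\<lambda>_. borel)) (\<lambda>w k. case_sum F B k w)) \<Phi>"
    using distr_reindex[OF assms(1,2)] by simp
  also have "\<dots> = expectation (\<lambda>w. \<Phi> (\<lambda>k. case_sum F B k w))"
    by (rule integral_distr[OF m[of "\<lambda>k. k"]]) simp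
  finally show ?thesis .
qed

text \<open>The functionals are defined on full configurations, and \<open>local\<close> says which
  coordinates they read, so that passage costs fit without being restricted to a window.\<close>

lemma indep_local_functions:
  fixes \<Phi> \<Psi> :: "(int + int \<Rightarrow> real) \<Rightarrow> real"
  assumes "J \<inter> J' = {}"
    and [measurable]: "\<Phi> \<in> borel_measurable (PiM UNIV (\<lambda>_. borel))" "\<Psi> \<in> borel_measurable (PiM UNIV (\<lambda>_. borel))"
    and local: "\<And>\<omega> \<omega>'. (\<And>k. k \<in> J \<Longrightarrow> \<omega> k = \<omega>' k) \<Longrightarrow> \<Phi> \<omega> = \<Phi> \<omega>'"
      "\<And>\<omega> \<omega>'. (\<And>k. k \<in> J' \<Longrightarrow> \<omega> k = \<omega>' k) \<Longrightarrow> \<Psi> \<omega> = \<Psi> \<omega>'"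
  shows "indep_var borel (\<lambda>w. \<Phi> (\<lambda>k. case_sum F B k w)) borel (\<lambda>w. \<Psi> (\<lambda>k. case_sum F B k w))"
proof -
  \<comment> \<open>Pads a configuration on \<open>J\<close> by zeros; by locality the functional
    does not see the padding.\<close>
  define z where "z J \<omega> k = (if k \<in> J then \<omega> k else (0::real))" for J :: "(int + int) set" and \<omega> k
  have zm [measurable]: "z J \<in> measurable (PiM J (\<lambda>_. borel)) (PiM UNIV (\<lambda>_. borel))" for J
  proof (rule measurable_PiM_single')
    fix k :: "int + int"
    show "(\<lambda>\<omega>. z J \<omega> k) \<in> borel_measurable (PiM J (\<lambda>_. borel))"
      unfolding z_def by (cases "k \<in> J") auto
  qed auto
  have "indep_var borel ((\<Phi> \<circ> z J) \<circ> (\<lambda>w. restrict (\<lambda>k. case_sum F B k w) J))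
      borel ((\<Psi> \<circ> z J') \<circ> (\<lambda>w. restrict (\<lambda>k. case_sum F B k w) J'))"
    by (rule indep_var_compose[OF indep_var_restrict[OF indep assms(1)]])
      (auto intro!: measurable_comp[OF zm])
  moreover have "\<Phi> (z J (restrict \<omega> J)) = \<Phi> \<omega>" for \<omega> by (rule local(1)) (simp add: z_def)
  moreover have "\<Psi> (z J' (restrict \<omega> J')) = \<Psi> \<omega>" for \<omega> by (rule local(2)) (simp add: z_def)
  ultimately show ?thesis by (simp add: comp_def)
qed

end

section \<open>Subadditive limits of passage costs\<close>

locale passage_environment = iid_environment P F B for P :: "'a measure" and F B +
  fixes \<phi> :: "real \<Rightarrow> real \<Rightarrow> real" and C :: real
  assumes \<phi>_measurable: "case_prod \<phi> \<in> borel_measurable (borel \<Otimes>\<^sub>M borel)"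
    and \<phi>_nonneg: "\<And>u v. 0 \<le> \<phi> u v"
    and \<phi>_le: "\<And>u v. \<phi> u v \<le> C"
begin

abbreviation T :: "int \<Rightarrow> nat \<Rightarrow> 'a \<Rightarrow> real" where
  "T x s w \<equiv> passage \<phi> (\<lambda>y. F y w) (\<lambda>i. B i w) x s"

abbreviation T_from :: "int \<Rightarrow> int \<Rightarrow> int \<Rightarrow> nat \<Rightarrow> 'a \<Rightarrow> real" where
  "T_from u v x s w \<equiv> passage \<phi> (\<lambda>y. F (u + y) w) (\<lambda>i. B (v + i) w) x s"

lemma C_nonneg: "0 \<le> C" using \<phi>_nonneg[of 0 0] \<phi>_le[of 0 0] by linarith

lemma passage_functional_measurable [measurable]:
  "(\<lambda>\<omega>. passage \<phi> (\<lambda>y. \<omega> (Inl (g y))) (\<lambda>i. \<omega> (Inr (h i))) x s)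
    \<in> borel_measurable (PiM UNIV (\<lambda>_. borel :: real measure))"
  by (rule measurable_passage[OF \<phi>_measurable]) auto

lemma T_reindexed_measurable [measurable]:
  "(\<lambda>w. passage \<phi> (\<lambda>y. F (g y) w) (\<lambda>i. B (h i) w) x s) \<in> borel_measurable P"
  by (rule measurable_passage[OF \<phi>_measurable]) auto

lemma T_measurable [measurable]: "T x s \<in> borel_measurable P"
  using T_reindexed_measurable[of "\<lambda>y. y" "\<lambda>y. y"] .

lemma integral_T_from: "expectation (T_from u v x s) = expectation (T x s)"
  using integral_reindex[of "(+) u" "(+) v"
      "\<lambda>\<omega>. passage \<phi> (\<lambda>y. \<omega> (Inl y)) (\<lambda>i. \<omega> (Inr i)) x s"]
    passage_functional_measurable[of "\<lambda>y. y" "\<lambda>y. y"]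
  by simp

text \<open>Reflecting space preserves the law, which reduces targets on the negative half-line to
  positive ones.\<close>

lemma prob_T_reflected:
  assumes [measurable]: "A \<in> sets borel"
  shows "prob {w \<in> space P. passage \<phi> (\<lambda>y. F (- y) w) (\<lambda>i. B i w) x s \<in> A} =
    prob {w \<in> space P. T x s w \<in> A}"
proof -
  have m [measurable]: "(\<lambda>\<omega>. passage \<phi> (\<lambda>y. \<omega> (Inl y)) (\<lambda>i. \<omega> (Inr i)) x s)
    \<in> borel_measurable (PiM UNIV (\<lambda>_. borel :: real measure))"
    using passage_functional_measurable[of "\<lambda>y. y" "\<lambda>y. y"] by simp
  have "expectation (\<lambda>w. indicator A (passage \<phi> (\<lambda>y. F (- y) w) (\<lambda>i. B i w) x s) :: real) =
      expectation (\<lambda>w. indicator A (T x s w))"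
    using integral_reindex[of uminus "\<lambda>i. i"
        "\<lambda>\<omega>. indicator A (passage \<phi> (\<lambda>y. \<omega> (Inl y)) (\<lambda>i. \<omega> (Inr i)) x s)"]
    by (simp add: inj_on_def)
  moreover have ind: "expectation (\<lambda>w. indicat_real A (Y w)) = prob {w \<in> space P. Y w \<in> A}"
    if [measurable]: "Y \<in> borel_measurable P" for Y :: "'a \<Rightarrow> real"
  proof -
    have "expectation (\<lambda>w. indicat_real A (Y w)) = expectation (indicator {w \<in> space P. Y w \<in> A})"
      by (intro Bochner_Integration.integral_cong) (auto simp: indicator_def)
    then show ?thesis by simp
  qed
  ultimately show ?thesis using T_reindexed_measurable[of uminus "\<lambda>i. i"]
      T_reindexed_measurable[of "\<lambda>i. i" "\<lambda>i. i"] by simp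
qed

text \<open>The first cost reads sites in \<open>{u - s..u + s}\<close> and times in
  \<open>{v + 1..v + s}\<close>, the second likewise. Site windows are closed at both ends, whence
  the strict inequality; time windows start one step late, whence the weak one.\<close>

lemma indep_T_from:
  assumes "2 * int s < \<bar>u - u'\<bar>" "v + int s \<le> v' \<or> v' + int s \<le> v"
  shows "indep_var borel (T_from u v x s) borel (T_from u' v' x' s)"
proof -
  let ?J = "\<lambda>u v. Inl ` {u - int s..u + int s} \<union> Inr ` {v + 1..v + int s}"
  have loc: "passage \<phi> (\<lambda>y. \<omega> (Inl (u + y))) (\<lambda>i. \<omega> (Inr (v + i))) x s =
     passage \<phi> (\<lambda>y. \<omega>' (Inl (u + y))) (\<lambda>i. \<omega>' (Inr (v + i))) x s"
    if "\<And>k. k \<in> ?J u v \<Longrightarrow> \<omega> k = \<omega>' k" for u v x and \<omega> \<omega>' :: "int + int \<Rightarrow> real"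
    by (rule passage_cong; rule that) force+
  have "indep_var borel
      (\<lambda>w. (\<lambda>\<omega>. passage \<phi> (\<lambda>y. \<omega> (Inl (u + y))) (\<lambda>i. \<omega> (Inr (v + i))) x s) (\<lambda>k. case_sum F B k w))
      borel
      (\<lambda>w. (\<lambda>\<omega>. passage \<phi> (\<lambda>y. \<omega> (Inl (u' + y))) (\<lambda>i. \<omega> (Inr (v' + i))) x' s) (\<lambda>k. case_sum F B k w))"
    by (rule indep_local_functions[of "?J u v" "?J u' v'"], use assms in force)
      (rule passage_functional_measurable loc; assumption)+
  then show ?thesis by simp
qed

text \<open>By subadditivity this infimum is the limit of the normalised mean cost of going from \<open>0\<close> to
  \<open>p * b\<close> in exactly \<open>r * b\<close> steps.\<close>

definition speed_const :: "nat \<Rightarrow> nat \<Rightarrow> real" where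
  "speed_const p r = (INF b\<in>{1..}. expectation (T (int (p * b)) (r * b)) / real b)"

context
  fixes p r :: nat
  assumes pr: "1 \<le> p" "p \<le> r"
begin

lemma T_bounds: "0 \<le> T_from u v (int (p * b)) (r * b) w" "T_from u v (int (p * b)) (r * b) w \<le> C * (real r * real b)"
proof -
  have "\<bar>int (p * b)\<bar> \<le> int (r * b)" using pr by (simp flip: of_nat_mult)
  from passage_bounds[OF \<phi>_nonneg \<phi>_le this]
  show "0 \<le> T_from u v (int (p * b)) (r * b) w" "T_from u v (int (p * b)) (r * b) w \<le> C * (real r * real b)"
    by auto
qed

lemma T_integrable: "integrable P (T_from u v (int (p * b)) (r * b))"
  by (rule integrable_const_bound[of _ "C * (real r * real b)"]) (use T_bounds in auto)

lemma speed_const_le: "1 \<le> b \<Longrightarrow> speed_const p r * real b \<le> expectation (T (int (p * b)) (r * b))"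
proof -
  assume b: "1 \<le> b"
  have "0 \<le> expectation (T (int (p * b)) (r * b))" for b
    using T_bounds(1)[where u=0 and v=0] by (intro Bochner_Integration.integral_nonneg) simp
  then have "speed_const p r \<le> expectation (T (int (p * b)) (r * b)) / real b"
    unfolding speed_const_def using b
    by (intro cINF_lower bdd_belowI2[of _ 0]) auto
  then show ?thesis using b by (simp add: field_simps)
qed

lemma speed_const_ge:
  assumes "\<And>b. 1 \<le> b \<Longrightarrow> e * real b \<le> expectation (T (int (p * b)) (r * b))"
  shows "e \<le> speed_const p r"
  unfolding speed_const_def using assms by (intro cINF_greatest) (auto simp: field_simps)

lemma speed_const_nonneg: "0 \<le> speed_const p r"
  by (rule speed_const_ge) (use T_bounds(1)[where u=0 and v=0] in \<open>auto intro!: Bochner_Integration.integral_nonneg\<close>)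

lemma T_block_subadditive:
  "T (int (p * (L * k))) (r * (L * k)) w \<le>
    (\<Sum>j<k. T_from (int (p * (L * j))) (int (r * (L * j))) (int (p * L)) (r * L) w)"
proof (induction k)
  case 0
  show ?case using passage_bounds(2)[of \<phi> C 0 0] \<phi>_nonneg \<phi>_le by simp
next
  case (Suc k)
  have 1: "\<bar>int (p * (L * k))\<bar> \<le> int (r * (L * k))" "\<bar>int (p * L)\<bar> \<le> int (r * L)"
    using pr by (auto simp flip: of_nat_mult)
  have 2: "int (p * (L * Suc k)) = int (p * (L * k)) + int (p * L)" "r * (L * Suc k) = r * (L * k) + r * L"
    by (auto simp: algebra_simps)
  show ?case using passage_subadditive[OF 1, of \<phi> "\<lambda>y. F y w" "\<lambda>i. B i w"] Suc unfolding 2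
    by (auto simp: add.commute)
qed

text \<open>Take a block length \<open>L\<close> whose normalised mean nearly attains the infimum.
  The cost is then at most a sum of equally distributed block costs, to which the weak law applies,
  plus an incomplete block of bounded cost.\<close>

lemma T_upper_tendsto:
  assumes \<epsilon>: "\<epsilon> > 0"
  shows "(\<lambda>b. prob {w \<in> space P. T (int (p * b)) (r * b) w \<ge> (speed_const p r + \<epsilon>) * real b}) \<longlonglongrightarrow> 0"
proof -
  let ?G = "speed_const p r"
  obtain L where L: "1 \<le> L" "expectation (T (int (p * L)) (r * L)) / real L < ?G + \<epsilon>/4"
  proof -
    have "(INF b\<in>{1..}. expectation (T (int (p * b)) (r * b)) / real b) < ?G + \<epsilon>/4"
      using \<epsilon> unfolding speed_const_def by simp
    from this[THEN cInf_lessD[rotated]] show ?thesis using that by auto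
  qed
  let ?m = "expectation (T (int (p * L)) (r * L))"
  let ?Y = "\<lambda>j. T_from (int (p * (L * j))) (int (r * (L * j))) (int (p * L)) (r * L)"
  have m: "?m \<le> (?G + \<epsilon>/4) * L" using L by (simp add: field_simps)
  have EY: "expectation (?Y j) = ?m" for j by (rule integral_T_from)
  have "(\<lambda>k. prob {w \<in> space P. \<epsilon>/4 * real k \<le> \<bar>(\<Sum>j<k. ?Y j w) - (\<Sum>j<k. expectation (?Y j))\<bar>}) \<longlonglongrightarrow> 0"
  \<comment> \<open>Blocks \<open>i < j\<close> start \<open>p * L * (j - i)\<close> apart, which
    exceeds the doubled window radius \<open>2 * r * L\<close> once \<open>j - i > 2 * r\<close>,
    because \<open>p \<ge> 1\<close>.\<close>
  proof (rule finite_range_weak_law_tendsto[where K = "C * (real r * real L)" and D = "2 * r"])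
    show "AE w in P. \<bar>?Y j w\<bar> \<le> C * (real r * real L)" for j
      using T_bounds[where u="int (p * (L * j))" and v="int (r * (L * j))" and b=L] by (auto simp: abs_le_iff intro!: AE_I2 order_trans[of "- _" 0])
    fix i j assume ij: "i + 2 * r < j"
    have "indep_var borel (?Y i) borel (?Y j)"
    proof (rule indep_T_from)
      have "2 * (r * L) < L * (j - i)" using ij L by simp
      also have "\<dots> \<le> p * (L * (j - i))" using pr by simp
      also have "\<dots> = p * (L * j) - p * (L * i)" by (simp add: diff_mult_distrib2)
      finally show "2 * int (r * L) < \<bar>int (p * (L * i)) - int (p * (L * j))\<bar>" by linarith
      have "r * (L * i) + r * L = r * (L * Suc i)" by (simp add: algebra_simps)
      also have "\<dots> \<le> r * (L * j)" using ij by (intro mult_le_mono2) auto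
      finally show "int (r * (L * i)) + int (r * L) \<le> int (r * (L * j)) \<or> int (r * (L * j)) + int (r * L) \<le> int (r * (L * i))"
        by linarith
    qed
    then show "expectation (\<lambda>w. ?Y i w * ?Y j w) = expectation (?Y i) * expectation (?Y j)"
      by (rule indep_var_lebesgue_integral) (rule T_integrable)+
  qed (use \<epsilon> in auto)
  then have lim: "(\<lambda>k. prob {w \<in> space P. \<epsilon>/4 * real k \<le> \<bar>(\<Sum>j<k. ?Y j w) - real k * ?m\<bar>}) \<longlonglongrightarrow> 0"
    by (simp only: EY sum_constant card_lessThan)
  have "filterlim (\<lambda>b. b div L) at_top sequentially"
    unfolding filterlim_at_top
  proof
    fix Z
    show "\<forall>\<^sub>F b in sequentially. Z \<le> b div L"
      using eventually_ge_at_top[of "Z * L"] by eventually_elim (use L in \<open>auto simp: less_eq_div_iff_mult_less_eq\<close>)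
  qed
  then have lim': "(\<lambda>b. prob {w \<in> space P. \<epsilon>/4 * real (b div L) \<le> \<bar>(\<Sum>j<b div L. ?Y j w) - real (b div L) * ?m\<bar>}) \<longlonglongrightarrow> 0"
    using filterlim_compose[OF lim] by blast
  show ?thesis
  proof (rule tendsto_sandwich[OF _ _ tendsto_const lim'])
    \<comment> \<open>The allowance \<open>\<epsilon>\<close> is split: a quarter for the mean of a
      block, a quarter for fluctuations, and half for the incomplete block, which costs at most
      \<open>C * (r * L)\<close>.\<close>
    have "\<forall>\<^sub>F b in sequentially. 2 * C * (r * L) / \<epsilon> + 1 \<le> real b"
      by (rule eventually_nat_real) (rule eventually_ge_at_top)
    then show "\<forall>\<^sub>F b in sequentially. prob {w \<in> space P. T (int (p * b)) (r * b) w \<ge> (?G + \<epsilon>) * real b}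
       \<le> prob {w \<in> space P. \<epsilon>/4 * real (b div L) \<le> \<bar>(\<Sum>j<b div L. ?Y j w) - real (b div L) * ?m\<bar>}"
    proof eventually_elim
      case (elim b)
      let ?k = "b div L"
      show ?case
      proof (intro finite_measure_mono subsetI CollectI conjI)
        fix w assume w: "w \<in> {w \<in> space P. T (int (p * b)) (r * b) w \<ge> (?G + \<epsilon>) * real b}"
        show "\<epsilon>/4 * real ?k \<le> \<bar>(\<Sum>j<?k. ?Y j w) - real ?k * ?m\<bar>"
        proof (rule ccontr)
          assume neg: "\<not> ?thesis"
          have b: "b = L * ?k + b mod L" by simp
          have kL: "real L * real ?k \<le> real b" by (metis b le_add1 of_nat_le_iff of_nat_mult)
          have "real ?k \<le> real b" by (simp add: div_le_dividend)
          have "T (int (p * b)) (r * b) w \<le> T (int (p * (L * ?k))) (r * (L * ?k)) w + C * real (r * (b mod L))"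
          proof -
            have "r * b = r * (L * ?k) + r * (b mod L)" by (metis b distrib_left)
            moreover have "int (p * b) - int (p * (L * ?k)) = int (p * (b mod L))"
              by (metis b add_diff_cancel_left' distrib_left of_nat_add)
            ultimately show ?thesis
              using passage_extend[of \<phi> C "int (p * (L * ?k))" "r * (L * ?k)" "int (p * b)" "r * (b mod L)"] \<phi>_nonneg \<phi>_le pr
              by (auto simp flip: of_nat_mult)
          qed
          also have "\<dots> \<le> (\<Sum>j<?k. ?Y j w) + C * (r * L)"
            using T_block_subadditive[where L=L and k="?k" and w=w] L C_nonneg
            by (intro add_mono mult_left_mono) (auto intro: mult_left_mono simp: less_imp_le)
          also have "\<dots> < real ?k * ?m + \<epsilon>/4 * real ?k + C * (r * L)" using neg by linarith
          also have "\<dots> \<le> (?G + \<epsilon>/4) * real b + \<epsilon>/4 * real b + C * (r * L)"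
          proof -
            have "real ?k * ?m \<le> real ?k * ((?G + \<epsilon>/4) * L)" using m by (intro mult_left_mono) auto
            also have "\<dots> = (?G + \<epsilon>/4) * (real L * real ?k)" by simp
            finally have "real ?k * ?m \<le> (?G + \<epsilon>/4) * (real L * real ?k)" .
            also have "\<dots> \<le> (?G + \<epsilon>/4) * real b" using kL speed_const_nonneg \<epsilon> by (intro mult_left_mono) auto
            moreover have "\<epsilon>/4 * real ?k \<le> \<epsilon>/4 * real b"
              using \<open>real ?k \<le> real b\<close> \<epsilon> by (intro mult_left_mono) auto
            ultimately show ?thesis by linarith
          qed
          also have "\<dots> \<le> (?G + \<epsilon>) * real b"
          proof -
            have "2 * C * (r * L) / \<epsilon> \<le> real b" using elim by linarith
            then have "C * (r * L) \<le> \<epsilon>/2 * real b" using \<epsilon> by (simp add: field_simps)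
            then show ?thesis by (simp add: algebra_simps)
          qed
          finally show False using w by simp
        qed
      qed auto
    qed
  qed auto
qed

text \<open>The mean of \<open>T / b\<close> is at least its limit and the upper deviations vanish, so the lower
  deviations must vanish too.\<close>

lemma T_lower_tendsto:
  assumes \<eta>: "\<eta> > 0"
  shows "(\<lambda>b. prob {w \<in> space P. T (int (p * b)) (r * b) w \<le> (speed_const p r - \<eta>) * real b}) \<longlonglongrightarrow> 0"
proof (rule tendstoI)
  fix e :: real assume e: "e > 0"
  let ?G = "speed_const p r"
  \<comment> \<open>Solves \<open>(1 + C * r) * \<epsilon> = \<eta> * (e / 2)\<close>, whose left
    side is the bound finally obtained for \<open>\<eta> * prob ?D\<close>.\<close>
  define \<epsilon> where "\<epsilon> = e * \<eta> / (2 * (1 + C * r))"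
  have Cr: "0 \<le> C * real r" using C_nonneg by simp
  have \<epsilon>: "\<epsilon> > 0" using e \<eta> Cr by (auto simp: \<epsilon>_def intro!: divide_pos_pos mult_pos_pos)
  have "\<forall>\<^sub>F b in sequentially. prob {w \<in> space P. T (int (p * b)) (r * b) w \<ge> (?G + \<epsilon>) * real b} < \<epsilon>"
    using T_upper_tendsto[OF \<epsilon>] \<epsilon> by (auto dest: order_tendstoD(2))
  then show "\<forall>\<^sub>F b in sequentially.
      dist (prob {w \<in> space P. T (int (p * b)) (r * b) w \<le> (?G - \<eta>) * real b}) 0 < e"
    using eventually_ge_at_top[of 1]
  proof eventually_elim
    case (elim b)
    let ?U = "{w \<in> space P. T (int (p * b)) (r * b) w \<ge> (?G + \<epsilon>) * real b}"
    let ?D = "{w \<in> space P. T (int (p * b)) (r * b) w \<le> (?G - \<eta>) * real b}"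
    have b: "real b \<ge> 1" using elim by simp
    have "?U \<in> sets P" "?D \<in> sets P" by measurable
    then have int: "integrable P (indicat_real ?U)" "integrable P (indicat_real ?D)"
      by (auto simp: emeasure_eq_measure)
    \<comment> \<open>The cost is below the upper threshold off \<open>?U\<close>, lower by a
      further \<open>\<eta> * b\<close> on \<open>?D\<close>, and trivially bounded on
      \<open>?U\<close>; integration ties \<open>prob ?D\<close> to \<open>prob ?U\<close>.\<close>
    have le: "T (int (p * b)) (r * b) w \<le> (?G + \<epsilon>) * real b - \<eta> * real b * indicator ?D w + C * r * real b * indicator ?U w"
      if "w \<in> space P" for w
    proof -
      have "w \<in> ?D \<Longrightarrow> w \<notin> ?U"
      proof
        assume "w \<in> ?D" "w \<in> ?U"
        then have "(?G + \<epsilon>) * real b \<le> (?G - \<eta>) * real b" by simp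
        then have "?G + \<epsilon> \<le> ?G - \<eta>" using b by simp
        then show False using \<epsilon> \<eta> by simp
      qed
      moreover have "w \<notin> ?U \<Longrightarrow> T (int (p * b)) (r * b) w \<le> (?G + \<epsilon>) * real b" using that by simp
      moreover have "w \<in> ?D \<Longrightarrow> T (int (p * b)) (r * b) w \<le> (?G + \<epsilon>) * real b - \<eta> * real b"
      proof -
        assume "w \<in> ?D"
        moreover have "0 \<le> \<epsilon> * real b" using \<epsilon> b by simp
        ultimately show ?thesis by (simp add: algebra_simps)
      qed
      moreover have "T (int (p * b)) (r * b) w \<le> (?G + \<epsilon>) * real b + C * r * real b"
        using T_bounds(2)[where u=0 and v=0 and b=b and w=w] speed_const_nonneg \<epsilon> b
        by (simp add: add_increasing mult.assoc)
      ultimately show ?thesis by (auto simp: indicator_def simp del: mem_Collect_eq)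
    qed
    have "?G * real b \<le> expectation (T (int (p * b)) (r * b))" using speed_const_le elim by simp
    also have "\<dots> \<le> expectation (\<lambda>w. (?G + \<epsilon>) * real b - \<eta> * real b * indicator ?D w + C * r * real b * indicator ?U w)"
    proof (rule integral_mono)
      show "integrable P (T (int (p * b)) (r * b))" using T_integrable[where u=0 and v=0 and b=b] by simp
      show "integrable P (\<lambda>w. (?G + \<epsilon>) * real b - \<eta> * real b * indicator ?D w + C * r * real b * indicator ?U w)"
        using int by (intro Bochner_Integration.integrable_add Bochner_Integration.integrable_diff integrable_mult_right) auto
    qed (rule le)
    also have "\<dots> = (?G + \<epsilon>) * real b - \<eta> * real b * prob ?D + C * r * real b * prob ?U"
      using int \<open>?U \<in> sets P\<close> \<open>?D \<in> sets P\<close> by (simp add: prob_space)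
    also have "\<dots> = ((?G + \<epsilon>) - \<eta> * prob ?D + C * r * prob ?U) * real b" by (simp add: algebra_simps)
    finally have "?G \<le> (?G + \<epsilon>) - \<eta> * prob ?D + C * r * prob ?U" using b by simp
    then have "\<eta> * prob ?D \<le> \<epsilon> + C * r * prob ?U" by simp
    also have "\<dots> \<le> \<epsilon> + C * r * \<epsilon>" using elim Cr by (intro add_left_mono mult_left_mono) auto
    also have "\<dots> = (1 + C * r) * \<epsilon>" by (simp add: algebra_simps)
    also have "\<dots> = \<eta> * (e / 2)" using Cr by (simp add: \<epsilon>_def field_simps add_nonneg_eq_0_iff)
    finally have "prob ?D \<le> e / 2" using \<eta> by simp
    then show ?case using e by simp
  qed
qed

end
end

section \<open>The travel constant\<close>

lemma (in finite_measure) measure_UN_tendsto_0: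
  assumes "finite I" "\<And>i n. i \<in> I \<Longrightarrow> A i n \<in> sets M" "\<And>i. i \<in> I \<Longrightarrow> (\<lambda>n. measure M (A i n)) \<longlonglongrightarrow> 0"
  shows "(\<lambda>n. measure M (\<Union>i\<in>I. A i n)) \<longlonglongrightarrow> 0"
proof (rule tendsto_sandwich[OF _ _ tendsto_const])
  show "(\<lambda>n. \<Sum>i\<in>I. measure M (A i n)) \<longlonglongrightarrow> 0"
    using tendsto_sum[of I "\<lambda>i n. measure M (A i n)" "\<lambda>_. 0"] assms(3) by simp
  show "\<forall>\<^sub>F n in sequentially. measure M (\<Union>i\<in>I. A i n) \<le> (\<Sum>i\<in>I. measure M (A i n))"
    using assms by (intro always_eventually allI finite_measure_subadditive_finite) auto
qed auto

lemma (in finite_measure) measure_Un_tendsto_0: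
  assumes "\<And>n. A n \<in> sets M" "\<And>n. B n \<in> sets M"
    "(\<lambda>n. measure M (A n)) \<longlonglongrightarrow> 0" "(\<lambda>n. measure M (B n)) \<longlonglongrightarrow> 0"
  shows "(\<lambda>n. measure M (A n \<union> B n)) \<longlonglongrightarrow> 0"
proof (rule tendsto_sandwich[OF _ _ tendsto_const])
  show "(\<lambda>n. measure M (A n) + measure M (B n)) \<longlonglongrightarrow> 0"
    using tendsto_add[OF assms(3,4)] by simp
  show "\<forall>\<^sub>F n in sequentially. measure M (A n \<union> B n) \<le> measure M (A n) + measure M (B n)"
    using assms by (intro always_eventually allI measure_Un_le) auto
qed auto

lemma filterlim_nat_floor_divide:
  assumes "filterlim N at_top sequentially" "Q > (0::real)"
  shows "filterlim (\<lambda>n. nat \<lfloor>N n / Q\<rfloor>) at_top sequentially"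
  unfolding filterlim_at_top
proof
  fix Z
  have "\<forall>\<^sub>F n in sequentially. real Z * Q \<le> N n"
    using assms(1) by (simp add: filterlim_at_top)
  then show "\<forall>\<^sub>F n in sequentially. Z \<le> nat \<lfloor>N n / Q\<rfloor>"
    by eventually_elim (use assms(2) in \<open>simp add: le_nat_floor field_simps\<close>)
qed

lemma path_cost_reflect: "path_cost \<phi> (\<lambda>y. f (- y)) b (\<lambda>i. - \<gamma> i) s = path_cost \<phi> f b \<gamma> s"
  by (simp add: path_cost_def)

lemma lazy_walk_reflect: "lazy_walk s (\<lambda>i. - \<gamma> i) \<longleftrightarrow> lazy_walk s \<gamma>"
  by (simp add: lazy_walk_def abs_minus_commute)

context passage_environment
begin

text \<open>Walks from \<open>0\<close> to \<open>x\<close> taking \<open>O(\<bar>x\<bar>)\<close> steps cost at least about \<open>travel_const M * \<bar>x\<bar>\<close>: the infimum is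
  over all speeds \<open>p / r\<close> compatible with the time constraint.\<close>

definition travel_const :: "nat \<Rightarrow> real" where
  "travel_const M = Inf {speed_const p r / real p | p r. 1 \<le> p \<and> p \<le> r \<and> r \<le> 2 * M * p}"

lemma travel_const_le:
  assumes "1 \<le> p" "p \<le> r" "r \<le> 2 * M * p"
  shows "travel_const M * real p \<le> speed_const p r"
proof -
  have "travel_const M \<le> speed_const p r / real p"
    unfolding travel_const_def using assms
    by (intro cInf_lower bdd_belowI[of _ 0]) (auto simp: speed_const_nonneg)
  then show ?thesis using assms by (simp add: field_simps)
qed

lemma travel_const_ge:
  assumes "1 \<le> M" "\<And>p r. 1 \<le> p \<Longrightarrow> p \<le> r \<Longrightarrow> e * real p \<le> speed_const p r"
  shows "e \<le> travel_const M"
  unfolding travel_const_def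
proof (rule cInf_greatest)
  show "{speed_const p r / real p | p r. 1 \<le> p \<and> p \<le> r \<and> r \<le> 2 * M * p} \<noteq> {}"
    using assms(1) by (auto intro!: exI[of _ "1::nat"])
qed (use assms(2) in \<open>auto simp: field_simps\<close>)

lemma travel_const_nonneg: "1 \<le> M \<Longrightarrow> 0 \<le> travel_const M"
  by (rule travel_const_ge) (auto simp: speed_const_nonneg)

lemma travel_const_approx:
  assumes "1 \<le> M" "\<epsilon> > 0"
  obtains p r where "1 \<le> p" "p \<le> r" "speed_const p r < (travel_const M + \<epsilon>) * real p"
proof -
  have "{speed_const p r / real p | p r. 1 \<le> p \<and> p \<le> r \<and> r \<le> 2 * M * p} \<noteq> {}"
    using assms(1) by (auto intro!: exI[of _ "1::nat"])
  moreover have "Inf {speed_const p r / real p | p r. 1 \<le> p \<and> p \<le> r \<and> r \<le> 2 * M * p} < travel_const M + \<epsilon>"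
    using assms(2) by (simp add: travel_const_def)
  ultimately obtain z where "z \<in> {speed_const p r / real p | p r. 1 \<le> p \<and> p \<le> r \<and> r \<le> 2 * M * p}" "z < travel_const M + \<epsilon>"
    using cInf_lessD[of "{speed_const p r / real p | p r. 1 \<le> p \<and> p \<le> r \<and> r \<le> 2 * M * p}"] by blast
  then show ?thesis using that by (auto simp: field_simps)
qed

text \<open>The endpoint is rounded up to a multiple \<open>p * b\<close> and the duration to
  \<open>r * b\<close>, at the price of at most \<open>2 * b\<close> additional steps. On the grid
  only finitely many pairs \<open>(p, r)\<close> have to be controlled.\<close>

lemma walk_cost_lower:
  assumes b: "1 \<le> b" and M: "1 \<le> M"
    and grid: "\<And>p r. 1 \<le> p \<Longrightarrow> p \<le> m \<Longrightarrow> p \<le> r \<Longrightarrow> r \<le> 2 * M * p \<Longrightarrow>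
        (speed_const p r - 1) * real b \<le> passage \<phi> f g (int (p * b)) (r * b)"
    and walk: "lazy_walk s \<gamma>" "\<gamma> s = int x" "1 \<le> x" and s: "s \<le> M * (x + 1)" and x: "x \<le> m * b"
  shows "travel_const M * real x - (1 + 2 * C) * real b \<le> path_cost \<phi> f g \<gamma> s"
proof -
  define p where "p = (x + b - 1) div b"
  \<comment> \<open>Duration after continuing at full speed from \<open>x\<close> to the grid point
    \<open>p * b\<close>.\<close>
  define s' where "s' = s + (p * b - x)"
  define r where "r = (s' + b - 1) div b"
  have ceil: "y \<le> ((y + b - 1) div b) * b \<and> ((y + b - 1) div b) * b \<le> y + b - 1" for y :: nat
  proof -
    have "(y + b - 1) = ((y + b - 1) div b) * b + (y + b - 1) mod b" by simp
    moreover have "(y + b - 1) mod b < b" using b by simp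
    ultimately show ?thesis using b by linarith
  qed
  have xs: "x \<le> s" using lazy_walk_bound[OF walk(1), of s] walk(2) by simp
  have px: "x \<le> p * b" "p * b \<le> x + b - 1" using ceil[of x] by (auto simp: p_def)
  have rs: "s' \<le> r * b" "r * b \<le> s' + b - 1" using ceil[of s'] by (auto simp: r_def)
  have p1: "1 \<le> p" using px walk(3) by (cases p) auto
  have "p * b < (m + 1) * b" using px x b by (simp add: algebra_simps)
  then have pm: "p \<le> m" by (simp only: mult_less_cancel2) simp
  have "p * b \<le> r * b" using rs xs px unfolding s'_def by linarith
  then have pr: "p \<le> r" using b by simp
  \<comment> \<open>Here the factor \<open>2 * M\<close> in \<open>travel_const\<close> arises:
    \<open>M * (p * b + 1)\<close> is at most \<open>2 * M * (p * b)\<close>, and rounding the time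
    up does not push \<open>r\<close> beyond \<open>2 * M * p\<close>.\<close>
  have "s' \<le> M * (x + 1) + M * (p * b - x)"
    unfolding s'_def using s M by (intro add_mono) auto
  also have "\<dots> = M * (p * b + 1)" using px by (simp flip: distrib_left)
  also have "\<dots> \<le> M * (2 * (p * b))" using p1 b by (intro mult_le_mono2) (cases "p * b", auto)
  finally have "r * b < (2 * M * p + 1) * b" using rs b by (simp add: algebra_simps)
  then have rM: "r \<le> 2 * M * p" by (simp only: mult_less_cancel2) simp
  define t where "t = r * b - s"
  have st: "s + t = r * b" using rs by (simp add: t_def s'_def)
  \<comment> \<open>At most \<open>b - 1\<close> for rounding the endpoint, and again for rounding
    the time.\<close>
  have t2: "t \<le> 2 * b" "p * b - x \<le> t" using rs px by (auto simp: t_def s'_def)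
  have dist: "\<bar>int (p * b) - int x\<bar> \<le> int t" using t2 px by linarith
  have "(speed_const p r - 1) * real b \<le> passage \<phi> f g (int (p * b)) (s + t)"
    unfolding st by (rule grid) fact+
  also have "\<dots> \<le> passage \<phi> f g (int x) s + C * real t"
    using passage_extend[OF \<phi>_nonneg \<phi>_le _ dist] xs by simp
  also have "\<dots> \<le> path_cost \<phi> f g \<gamma> s + C * real (2 * b)"
    using walk t2 C_nonneg by (intro add_mono passage_le_path_cost mult_left_mono) auto
  finally have "speed_const p r * real b - (1 + 2 * C) * real b \<le> path_cost \<phi> f g \<gamma> s"
    by (simp add: algebra_simps)
  moreover have "travel_const M * real x \<le> speed_const p r * real b"
  proof -
    have "travel_const M * real x \<le> travel_const M * real (p * b)"
      using px(1) travel_const_nonneg[OF M] by (intro mult_left_mono) (simp_all only: of_nat_le_iff)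
    also have "\<dots> = travel_const M * real p * real b" by simp
    also have "\<dots> \<le> speed_const p r * real b"
      using travel_const_le[OF p1 pr rM] by (intro mult_right_mono) auto
    finally show ?thesis .
  qed
  ultimately show ?thesis by linarith
qed

lemma T_lower_reflected_tendsto:
  assumes "1 \<le> p" "p \<le> r" "\<eta> > 0"
  shows "(\<lambda>b. prob {w \<in> space P. passage \<phi> (\<lambda>y. F (- y) w) (\<lambda>i. B i w) (int (p * b)) (r * b)
      \<le> (speed_const p r - \<eta>) * real b}) \<longlonglongrightarrow> 0"
  using T_lower_tendsto[OF assms] prob_T_reflected[of "{..(speed_const p r - \<eta>) * real _}"] by simp

lemma T_upper_reflected_tendsto:
  assumes "1 \<le> p" "p \<le> r" "\<eta> > 0"
  shows "(\<lambda>b. prob {w \<in> space P. passage \<phi> (\<lambda>y. F (- y) w) (\<lambda>i. B i w) (int (p * b)) (r * b)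
      \<ge> (speed_const p r + \<eta>) * real b}) \<longlonglongrightarrow> 0"
  using T_upper_tendsto[OF assms] prob_T_reflected[of "{(speed_const p r + \<eta>) * real _..}"] by simp

text \<open>The exceptional event is chosen before the walk: with blocks of length proportional to
  \<open>N n\<close>, a bounded number of grid pairs covers all relevant endpoints and durations,
  and each pair fails with vanishing probability. The \<open>+ 1\<close> in the time constraint
  leaves room for arriving at a neighbour of the intended site.\<close>

lemma travel_lower:
  fixes N :: "nat \<Rightarrow> real"
  assumes M: "1 \<le> M" and \<epsilon>: "\<epsilon> > 0" and K: "0 \<le> K" and N: "filterlim N at_top sequentially"
  obtains Bad where "\<And>n. Bad n \<in> sets P" "(\<lambda>n. prob (Bad n)) \<longlonglongrightarrow> 0"
    "\<forall>\<^sub>F n in sequentially. \<forall>w \<in> space P - Bad n. \<forall>s \<gamma>. lazy_walk s \<gamma> \<longrightarrow>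
        int s \<le> int M * (\<bar>\<gamma> s\<bar> + 1) \<longrightarrow> real_of_int \<bar>\<gamma> s\<bar> \<le> K * N n \<longrightarrow>
        travel_const M * real_of_int \<bar>\<gamma> s\<bar> - \<epsilon> * N n \<le> path_cost \<phi> (\<lambda>y. F y w) (\<lambda>i. B i w) \<gamma> s"
proof -
  \<comment> \<open>With \<open>b\<close> about \<open>N / Q\<close> the rounding error
    \<open>(1 + 2 * C) * b\<close> is at most \<open>\<epsilon> * N\<close>.\<close>
  define Q where "Q = (1 + 2 * C) / \<epsilon>"
  have Q: "Q > 0" using \<epsilon> C_nonneg by (simp add: Q_def)
  define b where "b n = nat \<lfloor>N n / Q\<rfloor>" for n
  have b: "filterlim b at_top sequentially" unfolding b_def by (rule filterlim_nat_floor_divide[OF N Q])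
  \<comment> \<open>Rounding down still leaves \<open>N \<le> 2 * Q * b\<close>, so endpoints up to
    \<open>K * N\<close> lie within \<open>m\<close> grid steps.\<close>
  define m where "m = nat \<lceil>2 * K * Q\<rceil>"
  define I where "I = (SIGMA p:{1..m}. {p..2*M*p})"
  define A1 where "A1 = (\<lambda>(p, r) n. {w \<in> space P. T (int (p * n)) (r * n) w \<le> (speed_const p r - 1) * real n})"
  define A2 where "A2 = (\<lambda>(p, r) n. {w \<in> space P. passage \<phi> (\<lambda>y. F (- y) w) (\<lambda>i. B i w) (int (p * n)) (r * n) \<le> (speed_const p r - 1) * real n})"
  define Bad where "Bad n = (\<Union>i\<in>I. A1 i (b n)) \<union> (\<Union>i\<in>I. A2 i (b n))" for n
  have fin: "finite I" unfolding I_def by auto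
  have meas: "A1 i n \<in> sets P" "A2 i n \<in> sets P" for i n
    unfolding A1_def A2_def by (auto split: prod.split)
  show ?thesis
  proof (rule that[of Bad])
    show "Bad n \<in> sets P" for n unfolding Bad_def using meas fin by auto
    show "(\<lambda>n. prob (Bad n)) \<longlonglongrightarrow> 0"
      unfolding Bad_def
    proof (intro measure_Un_tendsto_0 measure_UN_tendsto_0)
      fix i assume "i \<in> I"
      then obtain p r where i: "i = (p, r)" "1 \<le> p" "p \<le> r" by (auto simp: I_def)
      show "(\<lambda>n. prob (A1 i (b n))) \<longlonglongrightarrow> 0"
        using filterlim_compose[OF T_lower_tendsto[OF i(2,3), of 1] b] by (simp add: A1_def i)
      show "(\<lambda>n. prob (A2 i (b n))) \<longlonglongrightarrow> 0"
        using filterlim_compose[OF T_lower_reflected_tendsto[OF i(2,3), of 1] b] by (simp add: A2_def i)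
    qed (use fin meas in auto)
    have "\<forall>\<^sub>F n in sequentially. 1 \<le> b n" using b by (simp add: filterlim_at_top)
    moreover have "\<forall>\<^sub>F n in sequentially. 0 \<le> N n" using N by (simp add: filterlim_at_top)
    ultimately show "\<forall>\<^sub>F n in sequentially. \<forall>w \<in> space P - Bad n. \<forall>s \<gamma>. lazy_walk s \<gamma> \<longrightarrow>
        int s \<le> int M * (\<bar>\<gamma> s\<bar> + 1) \<longrightarrow> real_of_int \<bar>\<gamma> s\<bar> \<le> K * N n \<longrightarrow>
        travel_const M * real_of_int \<bar>\<gamma> s\<bar> - \<epsilon> * N n \<le> path_cost \<phi> (\<lambda>y. F y w) (\<lambda>i. B i w) \<gamma> s"
    proof eventually_elim
      case (elim n)
      have bN: "real (b n) \<le> N n / Q" using elim Q unfolding b_def by simp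
      have Nb: "N n \<le> 2 * Q * real (b n)"
      proof -
        have "N n / Q \<le> real (b n) + 1" unfolding b_def by linarith
        also have "\<dots> \<le> 2 * real (b n)" using elim by simp
        finally show ?thesis using Q by (simp add: field_simps)
      qed
      have err: "(1 + 2 * C) * real (b n) \<le> \<epsilon> * N n"
      proof -
        have "(1 + 2 * C) * real (b n) \<le> (1 + 2 * C) * (N n / Q)" using bN C_nonneg by (intro mult_left_mono) auto
        also have "\<dots> = \<epsilon> * N n" using \<epsilon> C_nonneg by (simp add: Q_def)
        finally show ?thesis .
      qed
      have main: "travel_const M * real x - \<epsilon> * N n \<le> path_cost \<phi> f g \<gamma> s"
        if grid: "\<And>p r. 1 \<le> p \<Longrightarrow> p \<le> m \<Longrightarrow> p \<le> r \<Longrightarrow> r \<le> 2 * M * p \<Longrightarrow>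
            (speed_const p r - 1) * real (b n) \<le> passage \<phi> f g (int (p * b n)) (r * b n)"
          and walk: "lazy_walk s \<gamma>" "\<gamma> s = int x" "int s \<le> int M * (int x + 1)" "real x \<le> K * N n"
        for f g s \<gamma> x
      proof (cases "x = 0")
        case True
        have "0 \<le> path_cost \<phi> f g \<gamma> s" using path_cost_bounds(1)[of \<phi> C] \<phi>_nonneg \<phi>_le by simp
        moreover have "0 \<le> \<epsilon> * N n" using \<epsilon> elim by simp
        ultimately show ?thesis using True by simp
      next
        case False
        have "real x \<le> K * (2 * Q * real (b n))" using walk(4) Nb K mult_left_mono[OF Nb K] by linarith
        also have "\<dots> = (2 * K * Q) * real (b n)" by simp
        also have "\<dots> \<le> real m * real (b n)" unfolding m_def by (intro mult_right_mono) linarith+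
        finally have xm: "x \<le> m * b n" by (simp flip: of_nat_mult)
        have sM: "s \<le> M * (x + 1)"
        proof -
          have "int (M * (x + 1)) = int M * (int x + 1)" by (simp add: algebra_simps)
          then show ?thesis using walk(3) by linarith
        qed
        have "travel_const M * real x - (1 + 2 * C) * real (b n) \<le> path_cost \<phi> f g \<gamma> s"
          by (rule walk_cost_lower[OF _ M grid walk(1,2) _ sM xm]) (use elim False in auto)
        then show ?thesis using err by linarith
      qed
      show ?case
      proof (intro ballI allI impI)
        fix w s \<gamma>
        assume w: "w \<in> space P - Bad n" and walk: "lazy_walk s \<gamma>"
          and s: "int s \<le> int M * (\<bar>\<gamma> s\<bar> + 1)" and x: "real_of_int \<bar>\<gamma> s\<bar> \<le> K * N n"
        have g1: "(speed_const p r - 1) * real (b n) \<le> T (int (p * b n)) (r * b n) w"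
          and g2: "(speed_const p r - 1) * real (b n) \<le> passage \<phi> (\<lambda>y. F (- y) w) (\<lambda>i. B i w) (int (p * b n)) (r * b n)"
          if "1 \<le> p" "p \<le> m" "p \<le> r" "r \<le> 2 * M * p" for p r
        proof -
          have "(p, r) \<in> I" using that by (simp add: I_def)
          then have "w \<notin> A1 (p, r) (b n)" "w \<notin> A2 (p, r) (b n)" "w \<in> space P" using w by (auto simp: Bad_def)
          then show "(speed_const p r - 1) * real (b n) \<le> T (int (p * b n)) (r * b n) w"
           "(speed_const p r - 1) * real (b n) \<le> passage \<phi> (\<lambda>y. F (- y) w) (\<lambda>i. B i w) (int (p * b n)) (r * b n)"
            by (auto simp: A1_def A2_def)
        qed
        show "travel_const M * real_of_int \<bar>\<gamma> s\<bar> - \<epsilon> * N n \<le> path_cost \<phi> (\<lambda>y. F y w) (\<lambda>i. B i w) \<gamma> s"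
        proof (cases "0 \<le> \<gamma> s")
          case True
          then show ?thesis
            using main[of "\<lambda>y. F y w" "\<lambda>i. B i w" s \<gamma> "nat (\<gamma> s)", OF g1] walk s x by auto
        next
          case False
          then show ?thesis
            using main[of "\<lambda>y. F (- y) w" "\<lambda>i. B i w" s "\<lambda>i. - \<gamma> i" "nat (- \<gamma> s)", OF g2] walk s x
            path_cost_reflect[of \<phi> "\<lambda>y. F y w"] by (auto simp: lazy_walk_reflect)
        qed
      qed
    qed
  qed
qed


text \<open>A nearly optimal speed \<open>p / r\<close> is used up to the last multiple of
  \<open>p * b\<close> before \<open>x\<close>, and the short remainder is covered at the trivial
  cost. The bound on the duration makes the travelling time negligible against \<open>n\<close> in
  the application.\<close>

lemma travel_upper:
  fixes N :: "nat \<Rightarrow> real"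
  assumes M: "1 \<le> M" and \<epsilon>: "\<epsilon> > 0" and K: "0 \<le> K" and N: "filterlim N at_top sequentially"
  obtains Bad R where "\<And>n. Bad n \<in> sets P" "(\<lambda>n. prob (Bad n)) \<longlonglongrightarrow> 0"
    "\<forall>\<^sub>F n in sequentially. \<forall>w \<in> space P - Bad n. \<forall>x. real_of_int \<bar>x\<bar> \<le> K * N n \<longrightarrow>
        (\<exists>s \<gamma>. lazy_walk s \<gamma> \<and> \<gamma> s = x \<and> real s \<le> R * N n \<and>
          path_cost \<phi> (\<lambda>y. F y w) (\<lambda>i. B i w) \<gamma> s \<le> (travel_const M + \<epsilon>) * real_of_int \<bar>x\<bar> + \<epsilon> * N n)"
proof -
  let ?a = "travel_const M + \<epsilon>"
  obtain p r where pr: "1 \<le> p" "p \<le> r" "speed_const p r < ?a * real p"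
    using travel_const_approx[OF M \<epsilon>] .
  \<comment> \<open>The slack in the choice of speed serves as tolerance in the upper deviation
    bound: \<open>speed_const p r + \<eta> = ?a * p\<close>.\<close>
  define \<eta> where "\<eta> = ?a * real p - speed_const p r"
  have \<eta>: "\<eta> > 0" using pr by (simp add: \<eta>_def)
  \<comment> \<open>The remainder takes at most \<open>p * b\<close> steps, so it costs at most
    \<open>C * p * b \<le> \<epsilon> * N\<close>; the summand \<open>1\<close> gives
    \<open>b \<le> N\<close>.\<close>
  define Q where "Q = C * p / \<epsilon> + 1"
  have Q: "Q \<ge> 1" using \<epsilon> C_nonneg by (simp add: Q_def)
  define b where "b n = nat \<lfloor>N n / Q\<rfloor>" for n
  have b: "filterlim b at_top sequentially" unfolding b_def
    by (rule filterlim_nat_floor_divide[OF N]) (use Q in simp)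
  define m where "m = nat \<lceil>2 * K * Q\<rceil>"
  define A1 where "A1 k n = {w \<in> space P. T (int (p * (k * n))) (r * (k * n)) w \<ge> (speed_const p r + \<eta>) * real (k * n)}" for k n
  define A2 where "A2 k n = {w \<in> space P. passage \<phi> (\<lambda>y. F (- y) w) (\<lambda>i. B i w) (int (p * (k * n))) (r * (k * n)) \<ge> (speed_const p r + \<eta>) * real (k * n)}" for k n
  define Bad where "Bad n = (\<Union>k\<in>{1..m}. A1 k (b n)) \<union> (\<Union>k\<in>{1..m}. A2 k (b n))" for n
  have meas: "A1 k n \<in> sets P" "A2 k n \<in> sets P" for k n
    unfolding A1_def A2_def by auto
  show ?thesis
  proof (rule that[of Bad "r * K + p"])
    show "Bad n \<in> sets P" for n unfolding Bad_def using meas by auto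
    show "(\<lambda>n. prob (Bad n)) \<longlonglongrightarrow> 0"
      unfolding Bad_def
    proof (intro measure_Un_tendsto_0 measure_UN_tendsto_0)
      fix k assume k: "k \<in> {1..m}"
      have kb: "filterlim (\<lambda>n. k * b n) at_top sequentially"
        by (rule filterlim_at_top_mono[OF b]) (use k in auto)
      show "(\<lambda>n. prob (A1 k (b n))) \<longlonglongrightarrow> 0"
        using filterlim_compose[OF T_upper_tendsto[OF pr(1,2) \<eta>] kb] by (simp only: A1_def)
      show "(\<lambda>n. prob (A2 k (b n))) \<longlonglongrightarrow> 0"
        using filterlim_compose[OF T_upper_reflected_tendsto[OF pr(1,2) \<eta>] kb] by (simp only: A2_def)
    qed (use meas in auto)
    have "\<forall>\<^sub>F n in sequentially. 1 \<le> b n" using b by (simp add: filterlim_at_top)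
    moreover have "\<forall>\<^sub>F n in sequentially. 0 \<le> N n" using N by (simp add: filterlim_at_top)
    ultimately show "\<forall>\<^sub>F n in sequentially. \<forall>w \<in> space P - Bad n. \<forall>x. real_of_int \<bar>x\<bar> \<le> K * N n \<longrightarrow>
        (\<exists>s \<gamma>. lazy_walk s \<gamma> \<and> \<gamma> s = x \<and> real s \<le> (r * K + p) * N n \<and>
          path_cost \<phi> (\<lambda>y. F y w) (\<lambda>i. B i w) \<gamma> s \<le> ?a * real_of_int \<bar>x\<bar> + \<epsilon> * N n)"
    proof eventually_elim
      case (elim n)
      have bN: "real (b n) \<le> N n / Q" using elim Q unfolding b_def by simp
      have "N n / Q \<le> N n" using elim Q by (simp add: divide_le_eq mult_left_le mult_le_cancel_left1)
      then have bN': "real (b n) \<le> N n" using bN by linarith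
      have Nb: "N n \<le> 2 * Q * real (b n)"
      proof -
        have "N n / Q \<le> real (b n) + 1" unfolding b_def by linarith
        also have "\<dots> \<le> 2 * real (b n)" using elim by simp
        finally show ?thesis using Q by (simp add: field_simps)
      qed
      have err: "C * real (p * b n) \<le> \<epsilon> * N n"
      proof -
        have "C * real (p * b n) \<le> \<epsilon> * Q * real (b n)" using \<epsilon> by (simp add: Q_def field_simps)
        also have "\<dots> \<le> \<epsilon> * Q * (N n / Q)" using bN \<epsilon> Q by (intro mult_left_mono) auto
        finally show ?thesis using Q by simp
      qed
      have main: "\<exists>s \<gamma>. lazy_walk s \<gamma> \<and> \<gamma> s = int x \<and> real s \<le> (r * K + p) * N n \<and>
          path_cost \<phi> f g \<gamma> s \<le> ?a * real x + \<epsilon> * N n"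
        if grid: "\<And>k. 1 \<le> k \<Longrightarrow> k \<le> m \<Longrightarrow>
            passage \<phi> f g (int (p * (k * b n))) (r * (k * b n)) \<le> (speed_const p r + \<eta>) * real (k * b n)"
          and x: "real x \<le> K * N n" for f g x
      proof -
        define k where "k = x div (p * b n)"
        define j where "j = x mod (p * b n)"
        have "x = (p * b n) * k + j" unfolding k_def j_def by (rule mult_div_mod_eq[symmetric])
        then have xkj: "x = p * (k * b n) + j" by (simp add: mult_ac)
        have j: "j \<le> p * b n" using pr elim unfolding j_def by (simp add: less_imp_le)
        have kx: "real (k * b n) \<le> real x"
        proof -
          have "k * b n \<le> p * (k * b n)" using pr by simp
          then show ?thesis unfolding xkj by linarith
        qed
        have "real k * real (b n) \<le> K * (2 * Q * real (b n))"
          using kx x mult_left_mono[OF Nb K] by simp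
        then have "real k \<le> 2 * K * Q" using elim by simp
        then have km: "k \<le> m" unfolding m_def by linarith
        have pk: "passage \<phi> f g (int (p * (k * b n))) (r * (k * b n)) \<le> ?a * real (p * (k * b n))"
        proof (cases "k = 0")
          case True
          then show ?thesis using passage_bounds(2)[of \<phi> C 0 0 f g] \<phi>_nonneg \<phi>_le by simp
        next
          case False
          then show ?thesis using grid[of k] km by (simp add: \<eta>_def mult.assoc)
        qed
        have xs: "\<bar>int (p * (k * b n))\<bar> \<le> int (r * (k * b n))"
          using pr(2) by (simp only: abs_of_nat of_nat_le_iff mult_le_mono1)
        have "\<bar>int x\<bar> \<le> int (r * (k * b n) + j)" using xs unfolding xkj by simp
        then obtain \<gamma> where \<gamma>: "lazy_walk (r * (k * b n) + j) \<gamma>" "\<gamma> (r * (k * b n) + j) = int x"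
          "passage \<phi> f g (int x) (r * (k * b n) + j) = path_cost \<phi> f g \<gamma> (r * (k * b n) + j)"
          by (rule passage_attained)
        have "path_cost \<phi> f g \<gamma> (r * (k * b n) + j) \<le> passage \<phi> f g (int (p * (k * b n))) (r * (k * b n)) + C * real j"
          unfolding \<gamma>(3)[symmetric] by (rule passage_extend) (use \<phi>_nonneg \<phi>_le xs in \<open>auto simp: xkj\<close>)
        also have "\<dots> \<le> ?a * real (p * (k * b n)) + C * real (p * b n)"
          using pk j C_nonneg by (intro add_mono mult_left_mono) (auto simp flip: of_nat_mult)
        also have "\<dots> \<le> ?a * real x + \<epsilon> * N n"
          using err travel_const_nonneg[OF M] \<epsilon> by (intro add_mono mult_left_mono) (auto simp: xkj)
        finally have "path_cost \<phi> f g \<gamma> (r * (k * b n) + j) \<le> ?a * real x + \<epsilon> * N n" .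
        moreover have "real (r * (k * b n) + j) \<le> (r * K + p) * N n"
        proof -
          have "real (r * (k * b n) + j) \<le> r * real (k * b n) + p * real (b n)"
            using j by (simp flip: of_nat_mult)
          also have "\<dots> \<le> r * (K * N n) + p * N n"
            using kx x bN' by (intro add_mono mult_left_mono) auto
          finally show ?thesis by (simp add: algebra_simps)
        qed
        ultimately show ?thesis using \<gamma> by blast
      qed
      show ?case
      proof (intro ballI allI impI)
        fix w x
        assume w: "w \<in> space P - Bad n" and x: "real_of_int \<bar>x\<bar> \<le> K * N n"
        have g1: "T (int (p * (k * b n))) (r * (k * b n)) w \<le> (speed_const p r + \<eta>) * real (k * b n)"
          and g2: "passage \<phi> (\<lambda>y. F (- y) w) (\<lambda>i. B i w) (int (p * (k * b n))) (r * (k * b n)) \<le> (speed_const p r + \<eta>) * real (k * b n)"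
          if "1 \<le> k" "k \<le> m" for k
        proof -
          have "k \<in> {1..m}" using that by simp
          then have "w \<notin> A1 k (b n)" "w \<notin> A2 k (b n)" "w \<in> space P" using w by (auto simp: Bad_def)
          then show "T (int (p * (k * b n))) (r * (k * b n)) w \<le> (speed_const p r + \<eta>) * real (k * b n)"
            "passage \<phi> (\<lambda>y. F (- y) w) (\<lambda>i. B i w) (int (p * (k * b n))) (r * (k * b n)) \<le> (speed_const p r + \<eta>) * real (k * b n)"
            unfolding A1_def A2_def by auto
        qed
        show "\<exists>s \<gamma>. lazy_walk s \<gamma> \<and> \<gamma> s = x \<and> real s \<le> (r * K + p) * N n \<and>
          path_cost \<phi> (\<lambda>y. F y w) (\<lambda>i. B i w) \<gamma> s \<le> ?a * real_of_int \<bar>x\<bar> + \<epsilon> * N n"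
        proof (cases "0 \<le> x")
          case True
          then show ?thesis using main[of "\<lambda>y. F y w" "\<lambda>i. B i w" "nat x", OF g1] x by auto
        next
          case False
          then obtain s \<gamma> where "lazy_walk s \<gamma>" "\<gamma> s = - x" "real s \<le> (r * K + p) * N n"
            "path_cost \<phi> (\<lambda>y. F (- y) w) (\<lambda>i. B i w) \<gamma> s \<le> ?a * (- x) + \<epsilon> * N n"
            using main[of "\<lambda>y. F (- y) w" "\<lambda>i. B i w" "nat (- x)", OF g2] x by auto
          then show ?thesis
            using False path_cost_reflect[of \<phi> "\<lambda>y. F (- y) w" _ \<gamma>]
            by (intro exI[of _ s] exI[of _ "\<lambda>i. - \<gamma> i"]) (auto simp: lazy_walk_reflect)
        qed
      qed
    qed
  qed
qed

end

section \<open>The cost of staying near one place\<close>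

lemma sum_signs_card:
  fixes b :: "nat \<Rightarrow> real"
  assumes "finite I" "\<And>i. i \<in> I \<Longrightarrow> b i = 1 \<or> b i = -1"
  shows "(\<Sum>i\<in>I. b i) = real (card {i\<in>I. b i = 1}) - real (card {i\<in>I. b i = -1})"
    and "real (card I) = real (card {i\<in>I. b i = 1}) + real (card {i\<in>I. b i = -1})"
proof -
  have I: "I = {i\<in>I. b i = 1} \<union> {i\<in>I. b i = -1}" using assms(2) by auto
  have *: "sum g I = sum g {i\<in>I. b i = 1} + sum g {i\<in>I. b i = -1}" for g :: "nat \<Rightarrow> real"
    by (subst I, rule sum.union_disjoint) (use assms(1) in auto)
  show "(\<Sum>i\<in>I. b i) = real (card {i\<in>I. b i = 1}) - real (card {i\<in>I. b i = -1})"
    using *[of b] by simp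
  show "real (card I) = real (card {i\<in>I. b i = 1}) + real (card {i\<in>I. b i = -1})"
    using *[of "\<lambda>_. 1"] by simp
qed

text \<open>In a block all of whose steps cost less than \<open>\<theta>\<close> the walk only meets sites where \<open>\<bar>f\<bar>\<close> is close to
  \<open>c\<close>; as no three consecutive sites are like that, it lives on two neighbouring sites, one for
  each sign of \<open>b\<close>.\<close>

lemma block_cost_lower:
  fixes f :: "int \<Rightarrow> real" and b :: "nat \<Rightarrow> real"
  assumes f: "\<And>y. \<bar>f y\<bar> < c" and b: "\<And>i. b i = 1 \<or> b i = -1"
    and step: "\<And>i. s < i \<Longrightarrow> i < s + m \<Longrightarrow> \<bar>\<gamma> (Suc i) - \<gamma> i\<bar> \<le> 1"
    and no_triple: "\<And>x. {x, x + 1, x + 2} \<subseteq> \<gamma> ` {s+1..s+m} \<Longrightarrow> \<exists>y\<in>{x, x + 1, x + 2}. \<bar>f y\<bar> \<le> c - \<theta>"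
    and D: "\<And>x. x \<in> \<gamma> ` {s+1..s+m} \<Longrightarrow> D \<le> 2 * c - \<bar>f (x + 1) - f x\<bar>" "0 \<le> D"
    and \<theta>: "\<theta> < c"
    and cheap: "\<And>i. i \<in> {s+1..s+m} \<Longrightarrow> c + b i * f (\<gamma> i) < \<theta>"
  shows "D / 2 * (real m - \<bar>\<Sum>i=s+1..s+m. b i\<bar>) \<le> (\<Sum>i=s+1..s+m. c + b i * f (\<gamma> i))"
proof -
  let ?I = "{s+1..s+m}"
  let ?P = "{i\<in>?I. b i = 1}" and ?M = "{i\<in>?I. b i = -1}"
  let ?k = "\<lambda>i. c + b i * f (\<gamma> i)"
  have pos: "0 \<le> ?k i" for i using f[of "\<gamma> i"] b[of i] by auto
  have good: "\<bar>f (\<gamma> i)\<bar> > c - \<theta>" if "i \<in> ?I" for i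
    using cheap[OF that] b[of i] by (auto simp: abs_if split: if_splits)
  \<comment> \<open>A lazy walk cannot skip sites: two visited sites at distance at least
    \<open>2\<close> would put three consecutive ones into the block, all with
    \<open>\<bar>f\<bar> > c - \<theta>\<close>.\<close>
  have close_le: "\<bar>\<gamma> i - \<gamma> j\<bar> \<le> 1" if ij: "i \<in> ?I" "j \<in> ?I" "i \<le> j" for i j
  proof (rule ccontr)
    assume far: "\<not> ?thesis"
    define x where "x = min (\<gamma> i) (\<gamma> j)"
    have "z \<in> \<gamma> ` ?I" if z: "z \<in> {x, x + 1, x + 2}" for z
    proof -
      have "\<gamma> i \<le> z \<and> z \<le> \<gamma> j \<or> \<gamma> j \<le> z \<and> z \<le> \<gamma> i"
        using z far unfolding x_def min_def by (cases "\<gamma> i \<le> \<gamma> j") auto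
      then obtain l where "i \<le> l" "l \<le> j" "\<gamma> l = z"
        by (rule lazy_walk_intermediate[of i j \<gamma> z, rotated 2]) (use ij step in auto)
      then show ?thesis using ij by auto
    qed
    then have sub: "{x, x + 1, x + 2} \<subseteq> \<gamma> ` ?I" by blast
    from no_triple[OF this] obtain y where "y \<in> {x, x + 1, x + 2}" "\<bar>f y\<bar> \<le> c - \<theta>" by blast
    moreover then obtain l where "l \<in> ?I" "y = \<gamma> l" using sub by blast
    ultimately show False using good[of l] by simp
  qed
  have close: "\<bar>\<gamma> i - \<gamma> j\<bar> \<le> 1" if "i \<in> ?I" "j \<in> ?I" for i j
    using close_le[of i j] close_le[of j i] that by (cases "i \<le> j") auto
  \<comment> \<open>A cheap step with \<open>b = 1\<close> needs \<open>f\<close> near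
    \<open>- c\<close>, one with \<open>b = -1\<close> needs \<open>f\<close> near \<open>c\<close>.
    Hence the two sites are distinct neighbours, and their costs add up to the discrepancy of the
    pair.\<close>
  have pair: "D \<le> ?k i + ?k j" if i: "i \<in> ?P" and j: "j \<in> ?M" for i j
  proof -
    have fi: "f (\<gamma> i) < \<theta> - c" "c - \<theta> < f (\<gamma> j)" using cheap[of i] cheap[of j] i j by auto
    then have "\<gamma> i \<noteq> \<gamma> j" using \<theta> by auto
    then have "\<gamma> j = \<gamma> i + 1 \<or> \<gamma> i = \<gamma> j + 1" using close[of i j] i j by auto
    moreover have "\<gamma> i \<in> \<gamma> ` ?I" "\<gamma> j \<in> \<gamma> ` ?I" using i j by auto
    ultimately show ?thesis using D(1)[of "\<gamma> i"] D(1)[of "\<gamma> j"] fi i j \<theta> by auto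
  qed
  have sums: "(\<Sum>i\<in>?I. b i) = real (card ?P) - real (card ?M)" "real m = real (card ?P) + real (card ?M)"
    using sum_signs_card[of ?I b] b by auto
  \<comment> \<open>This is the number of steps of the minority sign; only so many disjoint pairs of
    opposite steps are available.\<close>
  have mn: "(real m - \<bar>\<Sum>i\<in>?I. b i\<bar>) / 2 = min (real (card ?P)) (real (card ?M))"
    unfolding sums by auto
  have split: "(\<Sum>i\<in>?I. ?k i) = (\<Sum>i\<in>?P. ?k i) + (\<Sum>i\<in>?M. ?k i)"
  proof -
    have I: "?I = ?P \<union> ?M" using b by auto
    show ?thesis by (subst I, rule sum.union_disjoint) auto
  qed
  show ?thesis
  proof (cases "?P = {} \<or> ?M = {}")
    case True
    then have "card ?P = 0 \<or> card ?M = 0" by (metis (no_types, lifting) card.empty)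
    then have "min (real (card ?P)) (real (card ?M)) = 0" by (elim disjE; simp only: of_nat_0; simp)
    then have "(real m - \<bar>\<Sum>i\<in>?I. b i\<bar>) / 2 = 0" by (simp only: mn)
    then have "real m - \<bar>\<Sum>i\<in>?I. b i\<bar> = 0" by simp
    then show ?thesis using sum_nonneg[of ?I ?k] pos by simp
  next
    case False
    \<comment> \<open>Cheapest step of each sign. Both are attained, so their sum is at least
      \<open>D\<close>, and every step costs at least the value for its sign.\<close>
    define \<alpha> where "\<alpha> = Min (?k ` ?P)"
    define \<beta> where "\<beta> = Min (?k ` ?M)"
    have "\<alpha> \<in> ?k ` ?P" "\<beta> \<in> ?k ` ?M" unfolding \<alpha>_def \<beta>_def using False by (auto intro!: Min_in)
    then obtain i j where "i \<in> ?P" "\<alpha> = ?k i" "j \<in> ?M" "\<beta> = ?k j" by blast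
    then have \<alpha>\<beta>: "D \<le> \<alpha> + \<beta>" "0 \<le> \<alpha>" "0 \<le> \<beta>"
      using pair[of i j] pos[of i] pos[of j] by (simp_all only:)
    have lo: "\<alpha> \<le> ?k i" if "i \<in> ?P" for i unfolding \<alpha>_def using that by (intro Min_le) auto
    have lo': "\<beta> \<le> ?k i" if "i \<in> ?M" for i unfolding \<beta>_def using that by (intro Min_le) auto
    let ?n = "min (real (card ?P)) (real (card ?M))"
    have "D * ?n \<le> (\<alpha> + \<beta>) * ?n" using \<alpha>\<beta> by (intro mult_right_mono) auto
    also have "\<dots> \<le> real (card ?P) * \<alpha> + real (card ?M) * \<beta>"
      using \<alpha>\<beta> by (simp add: distrib_right mult.commute add_mono mult_left_mono)
    also have "\<dots> \<le> (\<Sum>i\<in>?P. ?k i) + (\<Sum>i\<in>?M. ?k i)"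
      using sum_mono[of ?P "\<lambda>_. \<alpha>" ?k] sum_mono[of ?M "\<lambda>_. \<beta>" ?k] lo lo' by (intro add_mono) auto
    finally have "D * ((real m - \<bar>\<Sum>i\<in>?I. b i\<bar>) / 2) \<le> (\<Sum>i\<in>?I. ?k i)" using split mn by simp
    then show ?thesis by simp
  qed
qed

text \<open>Blocks of length \<open>m\<close> that lie after \<open>\<tau>\<close> and contain no
  step of cost \<open>\<theta>\<close> or more obey the block estimate. The total cost
  \<open>V\<close> allows at most \<open>V / \<theta>\<close> blocks with such a step, each wasting
  \<open>m\<close> steps.\<close>

lemma stay_cost_lower:
  fixes f :: "int \<Rightarrow> real" and b :: "nat \<Rightarrow> real"
  assumes f: "\<And>y. \<bar>f y\<bar> < c" and b: "\<And>i. b i = 1 \<or> b i = -1"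
    and walk: "lazy_walk n \<gamma>"
    and no_triple: "\<And>x. {x, x + 1, x + 2} \<subseteq> \<gamma> ` {0..n} \<Longrightarrow> \<exists>y\<in>{x, x + 1, x + 2}. \<bar>f y\<bar> \<le> c - \<theta>"
    and D: "\<And>x. x \<in> \<gamma> ` {0..n} \<Longrightarrow> D \<le> 2 * c - \<bar>f (x + 1) - f x\<bar>" "0 \<le> D"
    and \<theta>: "0 < \<theta>" "\<theta> < c" and m: "1 \<le> m"
    and total: "(\<Sum>i=1..n. c + b i * f (\<gamma> i)) \<le> V"
  shows "D / 2 * (real n - 2 * real m - real \<tau> - real m * (V / \<theta>)
      - (\<Sum>k<n div m. \<bar>\<Sum>i=k*m+1..k*m+m. b i\<bar>)) \<le> (\<Sum>i=\<tau>+1..n. c + b i * f (\<gamma> i))"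
proof -
  let ?k = "\<lambda>i. c + b i * f (\<gamma> i)"
  let ?I = "\<lambda>k. {k*m+1..k*m+m}"
  define S where "S k = \<bar>\<Sum>i\<in>?I k. b i\<bar>" for k
  have pos: "0 \<le> ?k i" for i using f[of "\<gamma> i"] b[of i] by auto
  define A where "A = {k. k < n div m \<and> \<tau> \<le> k * m}"
  define E where "E = {k\<in>A. \<exists>i\<in>?I k. \<theta> \<le> ?k i}"
  have finA: "finite A" "finite E" "E \<subseteq> A" by (auto simp: A_def E_def)
  have block_end: "k * m + m \<le> n" if "k < n div m" for k
  proof -
    have "Suc k * m \<le> (n div m) * m" using that by (intro mult_le_mono1) simp
    also have "\<dots> \<le> n" by simp
    finally show ?thesis by simp
  qed
  have disj: "?I k \<inter> ?I l = {}" if "k < l" for k l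
  proof -
    have "Suc k * m \<le> l * m" using that by (intro mult_le_mono1) simp
    then show ?thesis by auto
  qed
  have disj': "?I k \<inter> ?I l = {}" if "k \<noteq> l" for k l
    using disj[of k l] disj[of l k] that by (metis Int_commute linorder_neqE_nat)
  have blocks: "(\<Sum>k\<in>X. \<Sum>i\<in>?I k. ?k i) \<le> (\<Sum>i\<in>Y. ?k i)"
    if "finite X" "finite Y" "\<And>k. k \<in> X \<Longrightarrow> ?I k \<subseteq> Y" for X Y
  proof -
    have "(\<Sum>k\<in>X. \<Sum>i\<in>?I k. ?k i) = (\<Sum>i\<in>(\<Union>k\<in>X. ?I k). ?k i)"
      using that disj' by (subst sum.UNION_disjoint) auto
    also have "\<dots> \<le> (\<Sum>i\<in>Y. ?k i)" using that pos by (intro sum_mono2) auto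
    finally show ?thesis .
  qed
  have cardE: "real (card E) \<le> V / \<theta>"
  proof -
    have "\<theta> * real (card E) = (\<Sum>k\<in>E. \<theta>)" by simp
    also have "\<dots> \<le> (\<Sum>k\<in>E. \<Sum>i\<in>?I k. ?k i)"
    proof (rule sum_mono)
      fix k assume "k \<in> E"
      then obtain i where i: "i \<in> ?I k" "\<theta> \<le> ?k i" by (auto simp: E_def)
      then show "\<theta> \<le> (\<Sum>i\<in>?I k. ?k i)" using member_le_sum[of i "?I k" ?k] pos by force
    qed
    also have "\<dots> \<le> (\<Sum>i=1..n. ?k i)"
      using finA block_end by (intro blocks) (force simp: E_def A_def)+
    also have "\<dots> \<le> V" by (rule total)
    finally show ?thesis using \<theta> by (simp add: field_simps)
  qed
  \<comment> \<open>One block length is lost to the block in which \<open>\<tau>\<close> falls,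
    another to the incomplete block at the end.\<close>
  have cardA: "real n - 2 * real m - real \<tau> \<le> real m * real (card A)"
  proof -
    have "{..<n div m} \<subseteq> A \<union> {..\<tau> div m}"
    proof
      fix k assume "k \<in> {..<n div m}"
      moreover have "k \<le> \<tau> div m" if "k * m < \<tau>" using that m by (simp add: less_eq_div_iff_mult_less_eq)
      ultimately show "k \<in> A \<union> {..\<tau> div m}" unfolding A_def by force
    qed
    then have "card {..<n div m} \<le> card (A \<union> {..\<tau> div m})" using finA by (intro card_mono) auto
    also have "\<dots> \<le> card A + (\<tau> div m + 1)" using card_Un_le[of A "{..\<tau> div m}"] by simp
    finally have "m * (n div m) \<le> m * card A + m * (\<tau> div m) + m"
      using mult_le_mono2[of "n div m" "card A + (\<tau> div m + 1)" m] by (simp add: algebra_simps)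
    moreover have "m * (\<tau> div m) \<le> \<tau>" by simp
    moreover have "n < m * (n div m) + m"
      using mult_div_mod_eq[of m n] mod_less_divisor[of m n] m by linarith
    ultimately have "n \<le> m * card A + \<tau> + 2 * m" by linarith
    then have "real n \<le> real (m * card A + \<tau> + 2 * m)" by (simp only: of_nat_le_iff)
    then show ?thesis by simp
  qed
  have "D / 2 * (real n - 2 * real m - real \<tau> - real m * (V / \<theta>) - (\<Sum>k<n div m. S k))
      \<le> D / 2 * (real m * real (card (A - E)) - (\<Sum>k\<in>A-E. S k))"
  proof (intro mult_left_mono diff_mono)
    have "real (card (A - E)) = real (card A) - real (card E)"
      using finA by (simp add: card_Diff_subset card_mono of_nat_diff)
    then have "real m * real (card (A - E)) = real m * real (card A) - real m * real (card E)"
      by (simp add: right_diff_distrib)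
    moreover have "real m * real (card E) \<le> real m * (V / \<theta>)" using cardE by (intro mult_left_mono) auto
    ultimately show "real n - 2 * real m - real \<tau> - real m * (V / \<theta>) \<le> real m * real (card (A - E))"
      using cardA by linarith
    show "(\<Sum>k\<in>A-E. S k) \<le> (\<Sum>k<n div m. S k)"
      by (intro sum_mono2) (auto simp: A_def S_def)
  qed (use D in auto)
  also have "\<dots> = (\<Sum>k\<in>A-E. D / 2 * (real m - S k))"
    by (subst sum_distrib_left[symmetric]) (simp add: sum_subtractf)
  also have "\<dots> \<le> (\<Sum>k\<in>A-E. \<Sum>i\<in>?I k. ?k i)"
  proof (rule sum_mono)
    fix k assume k: "k \<in> A - E"
    then have "k * m + m \<le> n" using block_end by (simp add: A_def)
    then have sub: "\<gamma> ` ?I k \<subseteq> \<gamma> ` {0..n}" by (intro image_mono) auto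
    have "D / 2 * (real m - \<bar>\<Sum>i\<in>?I k. b i\<bar>) \<le> (\<Sum>i\<in>?I k. ?k i)"
    proof (rule block_cost_lower[where \<theta>=\<theta>])
      show "\<bar>\<gamma> (Suc i) - \<gamma> i\<bar> \<le> 1" if "k * m < i" "i < k * m + m" for i
        using walk that \<open>k * m + m \<le> n\<close> by (simp add: lazy_walk_def)
      show "\<exists>y\<in>{x, x + 1, x + 2}. \<bar>f y\<bar> \<le> c - \<theta>" if "{x, x + 1, x + 2} \<subseteq> \<gamma> ` ?I k" for x
        using no_triple[of x] that sub by blast
      show "D \<le> 2 * c - \<bar>f (x + 1) - f x\<bar>" if "x \<in> \<gamma> ` ?I k" for x using D(1) that sub by blast
      show "?k i < \<theta>" if "i \<in> ?I k" for i using k that unfolding E_def by force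
    qed (use f b D \<theta> in auto)
    then show "D / 2 * (real m - S k) \<le> (\<Sum>i\<in>?I k. ?k i)" by (simp add: S_def)
  qed
  also have "\<dots> \<le> (\<Sum>i=\<tau>+1..n. ?k i)"
    using finA block_end by (intro blocks) (force simp: A_def)+
  finally show ?thesis by (simp add: S_def)
qed

text \<open>After reaching \<open>x\<close> the competitor sits at each time on the cheaper of
  \<open>x\<close> and \<open>x + 1\<close> for the current sign. It pays \<open>u\<close> for one
  sign and \<open>v\<close> for the other, where \<open>u + v\<close> is the discrepancy, and each
  sign occurs at most as often as the majority sign.\<close>

lemma stay_cost_upper:
  fixes f :: "int \<Rightarrow> real" and b :: "nat \<Rightarrow> real"
  assumes f: "\<And>y. \<bar>f y\<bar> < c" and b: "\<And>i. b i = 1 \<or> b i = -1"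
    and walk: "lazy_walk s \<gamma>" "\<gamma> s = x" "s \<le> n"
  obtains \<delta> where "lazy_walk n \<delta>"
    "(\<Sum>i=1..n. c + b i * f (\<delta> i)) \<le> (\<Sum>i=1..s. c + b i * f (\<gamma> i)) +
      (2 * c - \<bar>f (x + 1) - f x\<bar>) * ((real n + \<bar>\<Sum>i=1..n. b i\<bar>) / 2)"
proof -
  define \<delta> where "\<delta> i = (if i \<le> s then \<gamma> i else if b i * f x \<le> b i * f (x + 1) then x else x + 1)" for i
  define u where "u = c + min (f x) (f (x + 1))"
  define v where "v = c - max (f x) (f (x + 1))"
  have uv: "0 \<le> u" "0 \<le> v" "u + v = 2 * c - \<bar>f (x + 1) - f x\<bar>"
    using f[of x] f[of "x + 1"] by (auto simp: u_def v_def min_def max_def)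
  let ?P = "{i\<in>{1..n}. b i = 1}" and ?M = "{i\<in>{1..n}. b i = -1}"
  have sums: "(\<Sum>i=1..n. b i) = real (card ?P) - real (card ?M)" "real n = real (card ?P) + real (card ?M)"
    using sum_signs_card[of "{1..n}" b] b by auto
  have lw: "lazy_walk n \<delta>"
    unfolding lazy_walk_def
  proof (intro conjI allI impI)
    show "\<delta> 0 = 0" using walk(1) by (simp add: \<delta>_def lazy_walk_def)
    fix i assume "i < n"
    show "\<bar>\<delta> (Suc i) - \<delta> i\<bar> \<le> 1"
    proof (cases "i < s")
      case True
      then show ?thesis using walk(1) by (simp add: \<delta>_def lazy_walk_def)
    next
      case False
      then show ?thesis using walk(2) by (cases "i = s") (auto simp: \<delta>_def)
    qed
  qed
  have cost: "c + b i * f (\<delta> i) = (if b i = 1 then u else v)" if "s < i" for i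
    using b[of i] that by (auto simp: \<delta>_def u_def v_def min_def max_def)
  have "(\<Sum>i=1..n. c + b i * f (\<delta> i)) = (\<Sum>i=1..s. c + b i * f (\<delta> i)) + (\<Sum>i=s+1..n. c + b i * f (\<delta> i))"
  proof -
    have "{1..n} = {1..s} \<union> {s+1..n}" using walk(3) by auto
    then show ?thesis by (simp add: sum.union_disjoint)
  qed
  also have "(\<Sum>i=1..s. c + b i * f (\<delta> i)) = (\<Sum>i=1..s. c + b i * f (\<gamma> i))"
    by (intro sum.cong) (auto simp: \<delta>_def)
  also have "(\<Sum>i=s+1..n. c + b i * f (\<delta> i)) = (\<Sum>i=s+1..n. if b i = 1 then u else v)"
    by (intro sum.cong) (auto simp: cost)
  \<comment> \<open>Charging the travelling time as well only raises the bound, and lets the sign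
    sum over the whole of \<open>{1..n}\<close> appear.\<close>
  also have "\<dots> \<le> (\<Sum>i=1..n. if b i = 1 then u else v)"
    using uv by (intro sum_mono2) auto
  also have "(\<Sum>i=1..n. if b i = 1 then u else v) = real (card ?P) * u + real (card ?M) * v"
  proof -
    have "{1..n} \<inter> {i. b i = 1} = ?P" "{1..n} \<inter> - {i. b i = 1} = ?M" using b by auto
    then show ?thesis by (simp add: sum.If_cases)
  qed
  also have "\<dots> \<le> max (real (card ?P)) (real (card ?M)) * u + max (real (card ?P)) (real (card ?M)) * v"
    using uv by (intro add_mono mult_right_mono) auto
  also have "\<dots> = (2 * c - \<bar>f (x + 1) - f x\<bar>) * ((real n + \<bar>\<Sum>i=1..n. b i\<bar>) / 2)"
  proof -
    have "(real n + \<bar>\<Sum>i=1..n. b i\<bar>) / 2 = max (real (card ?P)) (real (card ?M))"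
    proof -
      have "(y + z + \<bar>y - z\<bar>) / 2 = max y z" for y z :: real by (simp add: max_def)
      then show ?thesis unfolding sums(1) by (subst sums(2))
    qed
    then show ?thesis unfolding uv(3)[symmetric] by (simp only: distrib_left distrib_right mult.commute)
  qed
  finally show ?thesis using that[OF lw] by simp
qed

section \<open>Avoiding rare one-dependent events\<close>

lemma abs_one_minus_exp_le:
  fixes p :: real
  assumes "0 \<le> p"
  shows "\<bar>(1 - p) - exp (- p)\<bar> \<le> p\<^sup>2"
proof -
  have "1 - p \<le> exp (- p)" using exp_ge_add_one_self[of "- p"] by simp
  moreover have "exp (- p) \<le> (1 - p) + p\<^sup>2"
  proof -
    have "exp (- p) = inverse (exp p)" by (simp add: exp_minus)
    also have "\<dots> \<le> inverse (1 + p)" using assms exp_ge_add_one_self[of p] by (intro le_imp_inverse_le) auto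
    also have "\<dots> \<le> (1 - p) + p\<^sup>2"
    proof -
      have "1 \<le> ((1 - p) + p\<^sup>2) * (1 + p)" using assms by (simp add: algebra_simps power2_eq_square)
      then show ?thesis using assms by (simp add: field_simps)
    qed
    finally show ?thesis .
  qed
  ultimately show ?thesis by simp
qed

text \<open>Each step multiplies the avoidance probability by about
  \<open>exp (- prob (A k))\<close>. As \<open>A k\<close> is independent of avoiding everything
  before its predecessor, ignoring the predecessor costs at most \<open>\<eta> * prob (A k)\<close>
  and the joint occurrence of both at most \<open>\<xi>\<close>; the second \<open>\<eta>\<close>
  comes from replacing \<open>1 - p\<close> by \<open>exp (- p)\<close>. Errors merely add up
  because the factors are at most \<open>1\<close>.\<close>

lemma (in prob_space) one_dependent_avoidance:
  fixes A :: "nat \<Rightarrow> 'a set"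
  assumes A [measurable]: "\<And>k. A k \<in> events"
    and indep: "\<And>k. prob (A (Suc k) \<inter> (space M - (\<Union>j<k. A j))) =
        prob (A (Suc k)) * prob (space M - (\<Union>j<k. A j))"
    and \<eta>: "\<And>k. prob (A k) \<le> \<eta>" and \<xi>: "\<And>k. prob (A k \<inter> A (Suc k)) \<le> \<xi>"
  shows "\<bar>prob (space M - (\<Union>j<K. A j)) - exp (- (\<Sum>j<K. prob (A j)))\<bar>
    \<le> real K * \<xi> + 2 * \<eta> * (\<Sum>j<K. prob (A j))"
proof -
  define none where "none k = space M - (\<Union>j<k. A j)" for k
  have none [measurable]: "none k \<in> events" for k unfolding none_def by auto
  have none_Suc: "none (Suc k) = none k - A k" for k
    unfolding none_def by (auto simp: lessThan_Suc)
  have \<eta>0: "0 \<le> \<eta>" using \<eta>[of 0] measure_nonneg[of M "A 0"] by linarith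
  have \<xi>0: "0 \<le> \<xi>" using \<xi>[of 0] measure_nonneg[of M "A 0 \<inter> A (Suc 0)"] by linarith
  have none_diff: "prob (none (Suc k)) = prob (none k) - prob (A k \<inter> none k)" for k
    unfolding none_Suc by (subst finite_measure_Diff') (auto simp: Int_commute)
  have step: "\<bar>prob (none (Suc k)) - exp (- prob (A k)) * prob (none k)\<bar> \<le> \<xi> + 2 * \<eta> * prob (A k)" for k
  proof -
    let ?p = "prob (A k)"
    have p: "0 \<le> ?p" by simp
    have 1: "- \<eta> * ?p \<le> prob (none (Suc k)) - (1 - ?p) * prob (none k)
       \<and> prob (none (Suc k)) - (1 - ?p) * prob (none k) \<le> \<xi>"
    proof (cases k)
      case 0
      have "prob (A 0 \<inter> none 0) = prob (A 0)" unfolding none_def using sets.sets_into_space[OF A[of 0]]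
        by (auto intro!: arg_cong[where f=prob])
      then show ?thesis unfolding none_diff using 0 \<xi>0 \<eta>0 by (simp add: none_def prob_space)
    next
      case (Suc l)
      let ?X = "prob (A k \<inter> none k)" and ?Y = "prob (A k \<inter> none l \<inter> A l)"
      have "prob (A k \<inter> none l) = ?p * prob (none l)" using indep[of l] Suc by (simp add: none_def)
      \<comment> \<open>Split by whether the predecessor \<open>A l\<close> occurs; the part where
        it does is bounded by \<open>\<xi>\<close>.\<close>
      moreover have "prob (A k \<inter> none l) = ?X + ?Y"
      proof -
        have "A k \<inter> none l = (A k \<inter> none k) \<union> (A k \<inter> none l \<inter> A l)" using none_Suc[of l] Suc by auto
        moreover have "(A k \<inter> none k) \<inter> (A k \<inter> none l \<inter> A l) = {}" using none_Suc[of l] Suc by auto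
        ultimately show ?thesis by (metis finite_measure_Union A none sets.Int)
      qed
      ultimately have XY: "?X = ?p * prob (none l) - ?Y" by (metis add_diff_cancel_right')
      have Y: "0 \<le> ?Y" "?Y \<le> \<xi>"
        using Suc by (auto intro!: order_trans[OF finite_measure_mono \<xi>[of l]])
      have "prob (none k) = prob (none l) - prob (A l \<inter> none l)" using none_diff[of l] Suc by simp
      moreover have "prob (A l \<inter> none l) \<le> \<eta>" by (rule order_trans[OF finite_measure_mono \<eta>[of l]]) auto
      ultimately have "prob (none k) \<le> prob (none l)" "prob (none l) \<le> prob (none k) + \<eta>" by auto
      then have le: "?p * prob (none k) \<le> ?p * prob (none l)" "?p * prob (none l) \<le> ?p * (prob (none k) + \<eta>)"
        using p by (auto intro!: mult_left_mono)
      have eq: "prob (none (Suc k)) - (1 - ?p) * prob (none k) = ?p * prob (none k) - ?p * prob (none l) + ?Y"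
        unfolding none_diff XY by (simp add: algebra_simps)
      have "?p * prob (none l) \<le> ?p * prob (none k) + \<eta> * ?p" using le(2) by (simp add: algebra_simps)
      then show ?thesis unfolding eq mult_minus_left using le(1) Y by (intro conjI) linarith+
    qed
    have 2: "\<bar>((1 - ?p) - exp (- ?p)) * prob (none k)\<bar> \<le> \<eta> * ?p"
    proof -
      have "\<bar>((1 - ?p) - exp (- ?p)) * prob (none k)\<bar> \<le> \<bar>(1 - ?p) - exp (- ?p)\<bar> * 1"
        unfolding abs_mult by (intro mult_left_mono) auto
      also have "\<dots> \<le> ?p\<^sup>2" using abs_one_minus_exp_le[OF p] by simp
      also have "\<dots> \<le> \<eta> * ?p" unfolding power2_eq_square using \<eta> by (intro mult_right_mono) auto
      finally show ?thesis .
    qed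
    have "prob (none (Suc k)) - exp (- ?p) * prob (none k) =
       (prob (none (Suc k)) - (1 - ?p) * prob (none k)) + ((1 - ?p) - exp (- ?p)) * prob (none k)"
      by (simp add: algebra_simps)
    moreover have "0 \<le> \<eta> * ?p" using \<eta>0 by simp
    ultimately show ?thesis using 1 2 \<xi>0 by linarith
  qed
  have "\<bar>prob (none K) - exp (- (\<Sum>j<K. prob (A j)))\<bar> \<le> real K * \<xi> + 2 * \<eta> * (\<Sum>j<K. prob (A j))"
  proof (induction K)
    case 0
    show ?case by (simp add: none_def prob_space)
  next
    case (Suc K)
    let ?p = "prob (A K)" and ?S = "\<Sum>j<K. prob (A j)"
    have "exp (- (\<Sum>j<Suc K. prob (A j))) = exp (- ?p) * exp (- ?S)" by (simp flip: exp_add)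
    then have eq: "prob (none (Suc K)) - exp (- (\<Sum>j<Suc K. prob (A j))) =
       (prob (none (Suc K)) - exp (- ?p) * prob (none K)) + exp (- ?p) * (prob (none K) - exp (- ?S))"
      by (simp add: algebra_simps)
    have "\<bar>exp (- ?p) * (prob (none K) - exp (- ?S))\<bar> \<le> 1 * \<bar>prob (none K) - exp (- ?S)\<bar>"
      unfolding abs_mult by (intro mult_right_mono) auto
    then have "\<bar>prob (none (Suc K)) - exp (- (\<Sum>j<Suc K. prob (A j)))\<bar> \<le>
        (\<xi> + 2 * \<eta> * ?p) + (real K * \<xi> + 2 * \<eta> * ?S)"
      unfolding eq using Suc step[of K] by (intro order_trans[OF abs_triangle_ineq] add_mono) auto
    then show ?case by (simp add: algebra_simps)
  qed
  then show ?thesis by (simp add: none_def)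
qed

section \<open>Riemann sums of a truncated power\<close>

lemma powr_difference_bounds:
  fixes p u v :: real
  assumes "0 < p" "v \<le> u"
  shows "(u - v) * (max 0 v) powr p \<le> ((max 0 u) powr (p + 1) - (max 0 v) powr (p + 1)) / (p + 1)"
    and "((max 0 u) powr (p + 1) - (max 0 v) powr (p + 1)) / (p + 1) \<le> (u - v) * (max 0 u) powr p"
proof -
  have "(u - v) * (max 0 v) powr p \<le> ((max 0 u) powr (p + 1) - (max 0 v) powr (p + 1)) / (p + 1) \<and>
     ((max 0 u) powr (p + 1) - (max 0 v) powr (p + 1)) / (p + 1) \<le> (u - v) * (max 0 u) powr p"
  proof (cases "u \<le> 0 \<or> u = v")
    case True
    then show ?thesis using assms by auto
  next
    case u: False
    show ?thesis
    \<comment> \<open>The mean value theorem is applied away from the kink of \<open>max 0\<close>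
      at \<open>0\<close>; for \<open>v \<le> 0\<close> the claim is direct.\<close>
    proof (cases "v \<le> 0")
      case True
      have "u powr (p + 1) = u * u powr p" using u by (simp add: powr_add)
      also have "\<dots> \<le> (p + 1) * ((u - v) * u powr p)"
      proof -
        have "u * u powr p \<le> (u - v) * u powr p" using True by (intro mult_right_mono) auto
        also have "\<dots> \<le> (p + 1) * ((u - v) * u powr p)"
          using assms by (simp add: mult_le_cancel_right1 distrib_right)
        finally show ?thesis .
      qed
      finally have "u powr (p + 1) \<le> (p + 1) * ((u - v) * u powr p)" .
      then show ?thesis using u True assms by (auto simp: field_simps)
    next
      case False
      have "v < u" using u assms by simp
      have "\<exists>z. v < z \<and> z < u \<and> u powr (p + 1) - v powr (p + 1) = (u - v) * ((p + 1) * z powr p)"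
      proof (rule MVT2[OF \<open>v < u\<close>])
        fix x assume "v \<le> x" "x \<le> u"
        then show "((\<lambda>x. x powr (p + 1)) has_real_derivative (p + 1) * x powr p) (at x)"
          using False has_real_derivative_powr[of x "p + 1"] by simp
      qed
      then obtain z where z: "v < z" "z < u" "u powr (p + 1) - v powr (p + 1) = (u - v) * ((p + 1) * z powr p)"
        by blast
      then have "(u powr (p + 1) - v powr (p + 1)) / (p + 1) = (u - v) * z powr p" using assms by simp
      moreover have "v powr p \<le> z powr p" "z powr p \<le> u powr p"
        using z False assms by (auto intro!: powr_mono2)
      ultimately show ?thesis using \<open>v < u\<close> False by (auto simp: mult_left_mono)
    qed
  qed
  then show "(u - v) * (max 0 v) powr p \<le> ((max 0 u) powr (p + 1) - (max 0 v) powr (p + 1)) / (p + 1)"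
    "((max 0 u) powr (p + 1) - (max 0 v) powr (p + 1)) / (p + 1) \<le> (u - v) * (max 0 u) powr p" by auto
qed

text \<open>Comparison of a decreasing summand with its integral: increments of the antiderivative
  telescope, and shifting the sum by one index costs just the first term
  \<open>\<theta> powr p\<close>. The condition on \<open>m\<close> says that the sum runs until the
  summands vanish.\<close>

lemma tent_sum_bounds:
  fixes p \<alpha> \<theta> :: real
  assumes p: "0 < p" and \<alpha>: "0 < \<alpha>" and \<theta>: "0 < \<theta>" and m: "\<theta> \<le> \<alpha> * real m"
  shows "\<theta> powr (p + 1) / (\<alpha> * (p + 1)) \<le> (\<Sum>k<m. (max 0 (\<theta> - \<alpha> * real k)) powr p)"
    and "(\<Sum>k<m. (max 0 (\<theta> - \<alpha> * real k)) powr p) \<le> \<theta> powr (p + 1) / (\<alpha> * (p + 1)) + \<theta> powr p"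
proof -
  let ?u = "\<lambda>k. \<theta> - \<alpha> * real k"
  let ?g = "\<lambda>k. (max 0 (?u k)) powr (p + 1) / (p + 1)"
  have tel: "(\<Sum>k<m. ?g k - ?g (Suc k)) = \<theta> powr (p + 1) / (p + 1)"
    using sum_lessThan_telescope'[of ?g m] m \<theta> p by simp
  have eq: "\<theta> powr (p + 1) / (\<alpha> * (p + 1)) = \<theta> powr (p + 1) / (p + 1) / \<alpha>"
    by (simp add: mult.commute)
  have diff: "?u k - ?u (Suc k) = \<alpha>" "?u (Suc k) \<le> ?u k" for k using \<alpha> by (auto simp: algebra_simps)
  have up: "?g k - ?g (Suc k) \<le> \<alpha> * (max 0 (?u k)) powr p"
    and lo: "\<alpha> * (max 0 (?u (Suc k))) powr p \<le> ?g k - ?g (Suc k)" for k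
    using powr_difference_bounds[OF p diff(2), of k] unfolding diff(1) diff_divide_distrib by auto
  have "\<theta> powr (p + 1) / (p + 1) \<le> (\<Sum>k<m. \<alpha> * (max 0 (?u k)) powr p)"
    unfolding tel[symmetric] by (intro sum_mono up)
  then have "\<theta> powr (p + 1) / (p + 1) \<le> \<alpha> * (\<Sum>k<m. (max 0 (?u k)) powr p)" by (simp add: sum_distrib_left)
  then show "\<theta> powr (p + 1) / (\<alpha> * (p + 1)) \<le> (\<Sum>k<m. (max 0 (?u k)) powr p)"
    unfolding eq using \<alpha> by (simp only: pos_divide_le_eq mult.commute)
  have "(\<Sum>k<m. \<alpha> * (max 0 (?u (Suc k))) powr p) \<le> \<theta> powr (p + 1) / (p + 1)"
    unfolding tel[symmetric] by (intro sum_mono lo)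
  then have 1: "\<alpha> * (\<Sum>k<m. (max 0 (?u (Suc k))) powr p) \<le> \<theta> powr (p + 1) / (p + 1)" by (simp add: sum_distrib_left)
  have "(\<Sum>k<m. (max 0 (?u k)) powr p) \<le> (\<Sum>k<Suc m. (max 0 (?u k)) powr p)" by simp
  also have "\<dots> = \<theta> powr p + (\<Sum>k<m. (max 0 (?u (Suc k))) powr p)"
    using \<theta> by (subst sum.lessThan_Suc_shift) simp
  also have "(\<Sum>k<m. (max 0 (?u (Suc k))) powr p) \<le> \<theta> powr (p + 1) / (\<alpha> * (p + 1))"
    unfolding eq using 1 \<alpha> by (simp only: pos_le_divide_eq mult.commute)
  finally show "(\<Sum>k<m. (max 0 (?u k)) powr p) \<le> \<theta> powr (p + 1) / (\<alpha> * (p + 1)) + \<theta> powr p" by simp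
qed

section \<open>The tail of the discrepancy\<close>

locale disorder = prob_space P for P :: "'a measure" +
  fixes F B :: "int \<Rightarrow> 'a \<Rightarrow> real" and rho :: "real \<Rightarrow> real" and c q \<kappa> :: real
  assumes c: "c > 0" and q: "q > 0" and \<kappa>: "\<kappa> > -1"
    and indep_FB: "indep_vars (\<lambda>_. borel) (case_sum F B) (UNIV :: (int + int) set)"
    and F_distr: "\<And>x. distributed P lborel (F x) (\<lambda>y. ennreal (rho y))"
    and B_plus: "\<And>i. measure P {w \<in> space P. B i w = 1} = 1/2"
    and B_minus: "\<And>i. measure P {w \<in> space P. B i w = -1} = 1/2"
    and rho_even: "\<And>y. rho (-y) = rho y"
    and rho_pos: "\<And>y. -c < y \<Longrightarrow> y < c \<Longrightarrow> rho y > 0"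
    and rho_zero: "\<And>y. \<bar>y\<bar> \<ge> c \<Longrightarrow> rho y = 0"
    and rho_edge: "((\<lambda>y. rho y / \<bar>c - y\<bar> powr \<kappa>) \<longlongrightarrow> q) (at_left c)"
begin

lemma B_rv [measurable]: "B i \<in> borel_measurable P"
proof -
  have "case_sum F B (Inr i) \<in> borel_measurable P" using indep_FB unfolding indep_vars_def by blast
  then show ?thesis by simp
qed

lemma AE_B: "AE w in P. B i w = 1 \<or> B i w = -1"
proof -
  have "prob ({w \<in> space P. B i w = 1} \<union> {w \<in> space P. B i w = -1}) = 1"
    using B_plus[of i] B_minus[of i] by (subst finite_measure_Union) auto
  moreover have "{w \<in> space P. B i w = 1} \<union> {w \<in> space P. B i w = -1} \<in> events" by measurable
  ultimately show ?thesis using prob_eq_1 by fastforce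
qed

lemma distr_B: "distr P borel (B i) = distr P borel (B 0)"
proof (rule measure_eqI)
  have "emeasure (distr P borel (B i)) A = ennreal (indicator A 1 / 2 + indicator A (-1) / 2)"
    if [measurable]: "A \<in> sets borel" for A i
  proof -
    have "prob {w \<in> space P. B i w \<in> A} = expectation (\<lambda>w. indicator A 1 * indicator {w \<in> space P. B i w = 1} w
      + indicator A (-1) * indicator {w \<in> space P. B i w = -1} w)"
    proof -
      have "prob {w \<in> space P. B i w \<in> A} = expectation (indicator {w \<in> space P. B i w \<in> A})" by simp
      also have "\<dots> = expectation (\<lambda>w. indicator A 1 * indicator {w \<in> space P. B i w = 1} w
          + indicator A (-1) * indicator {w \<in> space P. B i w = -1} w)"
        using AE_B[of i] by (intro integral_cong_AE) (auto simp: indicator_def)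
      finally show ?thesis .
    qed
    also have "\<dots> = indicator A 1 * prob {w \<in> space P. B i w = 1} + indicator A (-1) * prob {w \<in> space P. B i w = -1}"
      by (subst Bochner_Integration.integral_add) (auto simp: emeasure_eq_measure)
    finally have "prob {w \<in> space P. B i w \<in> A} = indicator A 1 / 2 + indicator A (-1) / 2"
      using B_plus B_minus by simp
    moreover have "B i -` A \<inter> space P = {w \<in> space P. B i w \<in> A}" by auto
    ultimately show ?thesis by (simp add: emeasure_distr emeasure_eq_measure)
  qed
  note eq = this
  fix A assume "A \<in> sets (distr P borel (B i))"
  then show "emeasure (distr P borel (B i)) A = emeasure (distr P borel (B 0)) A" using eq by simp
qed simp

sublocale iid_environment P F B
proof
  show "distr P borel (F x) = distr P borel (F 0)" for x
  proof -
    have "distr P borel (F x) = distr P lborel (F x)" for x by (rule distr_cong) auto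
    then show ?thesis using F_distr[of x] F_distr[of 0] by (simp add: distributed_def)
  qed
qed (use indep_FB distr_B in auto)

lemma rho_measurable [measurable]: "(\<lambda>y. ennreal (rho y)) \<in> borel_measurable borel"
  using distributed_borel_measurable[OF F_distr[of 0]] by simp

lemma AE_F: "AE w in P. \<bar>F x w\<bar> < c"
proof -
  have "emeasure P (F x -` {y. c \<le> \<bar>y\<bar>} \<inter> space P) = (\<integral>\<^sup>+y. ennreal (rho y) * indicator {y. c \<le> \<bar>y\<bar>} y \<partial>lborel)"
    by (rule distributed_emeasure[OF F_distr]) auto
  also have "\<dots> = (\<integral>\<^sup>+(y::real). 0 \<partial>lborel)"
    by (intro nn_integral_cong) (auto simp: indicator_def rho_zero)
  finally have "F x -` {y. c \<le> \<bar>y\<bar>} \<inter> space P \<in> null_sets P" by (auto simp: null_sets_def)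
  then show ?thesis by (rule AE_I') auto
qed

section \<open>Comparison of the density near the edge with a pure power\<close>

lemma rho_edge_bounds:
  assumes "\<epsilon> > 0"
  obtains \<delta> where "\<delta> > 0" "\<And>u. 0 < u \<Longrightarrow> u < \<delta> \<Longrightarrow> (q - \<epsilon>) * u powr \<kappa> \<le> rho (c - u)"
    "\<And>u. 0 < u \<Longrightarrow> u < \<delta> \<Longrightarrow> rho (c - u) \<le> (q + \<epsilon>) * u powr \<kappa>"
proof -
  have "\<forall>\<^sub>F y in at_left c. dist (rho y / \<bar>c - y\<bar> powr \<kappa>) q < \<epsilon>" using rho_edge assms by (rule tendstoD)
  then obtain b where b: "b < c" "\<And>y. b < y \<Longrightarrow> y < c \<Longrightarrow> dist (rho y / \<bar>c - y\<bar> powr \<kappa>) q < \<epsilon>"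
    by (auto simp: eventually_at_left[of "c - 1" c])
  have *: "(q - \<epsilon>) * u powr \<kappa> \<le> rho (c - u) \<and> rho (c - u) \<le> (q + \<epsilon>) * u powr \<kappa>" if u: "0 < u" "u < c - b" for u
  proof -
    have "\<bar>rho (c - u) / u powr \<kappa> - q\<bar> < \<epsilon>" using b(2)[of "c - u"] u by (simp add: dist_real_def)
    then have "q - \<epsilon> \<le> rho (c - u) / u powr \<kappa>" "rho (c - u) / u powr \<kappa> \<le> q + \<epsilon>" by linarith+
    moreover have "0 < u powr \<kappa>" using u by simp
    ultimately show ?thesis by (simp add: pos_le_divide_eq pos_divide_le_eq)
  qed
  show ?thesis by (rule that[of "c - b"]) (use b * in auto)
qed

text \<open>Model density in terms of the distance \<open>u\<close> to the edge. All integrals of it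
  are nonnegative Lebesgue integrals, so its unboundedness for \<open>\<kappa> < 0\<close> is no
  obstacle.\<close>

definition edge_power :: "real \<Rightarrow> ennreal" where
  "edge_power u = ennreal (u powr \<kappa>) * indicator {0..} u"

lemma edge_power_measurable [measurable]: "edge_power \<in> borel_measurable borel"
  unfolding edge_power_def by measurable

lemma nn_integral_edge_power:
  assumes "0 \<le> s"
  shows "(\<integral>\<^sup>+u. edge_power u * indicator {..s} u \<partial>lborel) = ennreal (s powr (\<kappa> + 1) / (\<kappa> + 1))"
proof -
  have "(\<integral>\<^sup>+u. edge_power u * indicator {..s} u \<partial>lborel) = (\<integral>\<^sup>+u. ennreal (u powr \<kappa>) * indicator {0..s} u \<partial>lborel)"
    by (intro nn_integral_cong) (auto simp: edge_power_def indicator_def)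
  also have "\<dots> = ennreal (s powr (\<kappa> + 1) / (\<kappa> + 1))"
    by (rule nn_integral_has_integral_lebesgue'[OF _ has_integral_powr_from_0]) (use \<kappa> assms in auto)
  finally show ?thesis .
qed

lemma rho_le_edge_power:
  assumes "\<And>u. 0 < u \<Longrightarrow> u < \<delta> \<Longrightarrow> rho (c - u) \<le> K * u powr \<kappa>" "0 \<le> K" "u < \<delta>"
  shows "ennreal (rho (c - u)) \<le> ennreal K * edge_power u"
proof (cases "0 < u")
  case True
  then show ?thesis using assms by (auto simp: edge_power_def indicator_def simp flip: ennreal_mult intro!: ennreal_leI)
next
  case False
  then show ?thesis using rho_zero[of "c - u"] by simp
qed

lemma edge_power_le_rho:
  assumes "\<And>u. 0 < u \<Longrightarrow> u < \<delta> \<Longrightarrow> K * u powr \<kappa> \<le> rho (c - u)" "0 \<le> K" "u < \<delta>"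
  shows "ennreal K * edge_power u \<le> ennreal (rho (c - u))"
proof (cases "0 < u")
  case True
  then show ?thesis using assms by (auto simp: edge_power_def indicator_def simp flip: ennreal_mult intro!: ennreal_leI)
next
  case False
  \<comment> \<open>\<open>0 powr \<kappa>\<close> is \<open>0\<close> by convention, so the edge
    point is harmless even for negative \<open>\<kappa>\<close>.\<close>
  then show ?thesis by (cases "u = 0") (auto simp: edge_power_def indicator_def)
qed

lemma F_tail_bound:
  obtains C \<delta> where "C > 0" "\<delta> > 0"
    "\<And>x s. 0 < s \<Longrightarrow> s < \<delta> \<Longrightarrow> prob {w \<in> space P. \<bar>F x w\<bar> > c - s} \<le> C * s powr (\<kappa> + 1)"
proof -
  \<comment> \<open>Any constant above \<open>q\<close> would do: the bound only serves to make
    triples of extreme charges improbable.\<close>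
  obtain \<delta> where \<delta>: "\<delta> > 0" "\<And>u. 0 < u \<Longrightarrow> u < \<delta> \<Longrightarrow> rho (c - u) \<le> (q + q) * u powr \<kappa>"
    using rho_edge_bounds[OF q] by metis
  have bound: "prob {w \<in> space P. \<bar>F x w\<bar> > c - s} \<le> (4 * q / (\<kappa> + 1)) * s powr (\<kappa> + 1)" if s: "0 < s" "s < \<delta>" for x s
  proof -
    let ?J = "\<integral>\<^sup>+u. ennreal (rho (c - u)) * indicator {..<s} u \<partial>lborel"
    have J: "?J \<le> ennreal (2 * q * (s powr (\<kappa> + 1) / (\<kappa> + 1)))"
    proof -
      have "?J \<le> (\<integral>\<^sup>+u. ennreal (2 * q) * (edge_power u * indicator {..s} u) \<partial>lborel)"
        using rho_le_edge_power[OF \<delta>(2)] q s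
        by (intro nn_integral_mono) (auto simp: indicator_def mult.assoc)
      also have "\<dots> = ennreal (2 * q) * ennreal (s powr (\<kappa> + 1) / (\<kappa> + 1))"
        using s by (subst nn_integral_cmult) (auto simp: nn_integral_edge_power)
      also have "\<dots> = ennreal (2 * q * (s powr (\<kappa> + 1) / (\<kappa> + 1)))"
        using q \<kappa> by (subst ennreal_mult) auto
      finally show ?thesis .
    qed
    have "emeasure P (F x -` {y. \<bar>y\<bar> > c - s} \<inter> space P) = (\<integral>\<^sup>+y. ennreal (rho y) * indicator {y. \<bar>y\<bar> > c - s} y \<partial>lborel)"
      by (rule distributed_emeasure[OF F_distr]) auto
    also have "\<dots> \<le> (\<integral>\<^sup>+y. ennreal (rho y) * indicator {c - s<..} y + ennreal (rho y) * indicator {..<s - c} y \<partial>lborel)"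
      by (intro nn_integral_mono) (auto simp: indicator_def abs_if split: if_splits)
    also have "\<dots> = (\<integral>\<^sup>+y. ennreal (rho y) * indicator {c - s<..} y \<partial>lborel) + (\<integral>\<^sup>+y. ennreal (rho y) * indicator {..<s - c} y \<partial>lborel)"
      by (rule nn_integral_add) auto
    also have "(\<integral>\<^sup>+y. ennreal (rho y) * indicator {c - s<..} y \<partial>lborel) = ?J"
      by (subst nn_integral_real_affine[where c = "-1" and t = c]) (auto intro!: nn_integral_cong simp: indicator_def)
    also have "(\<integral>\<^sup>+y. ennreal (rho y) * indicator {..<s - c} y \<partial>lborel) = ?J"
      by (subst nn_integral_real_affine[where c = 1 and t = "-c"])
        (auto intro!: nn_integral_cong simp: indicator_def rho_even[of "c - _", simplified])
    also have "?J + ?J \<le> ennreal (2 * q * (s powr (\<kappa> + 1) / (\<kappa> + 1))) + ennreal (2 * q * (s powr (\<kappa> + 1) / (\<kappa> + 1)))"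
      by (intro add_mono J)
    also have "\<dots> = ennreal ((4 * q / (\<kappa> + 1)) * s powr (\<kappa> + 1))"
      using q \<kappa> by (subst ennreal_plus[symmetric]) (auto intro!: arg_cong[where f=ennreal])
    finally have "emeasure P (F x -` {y. \<bar>y\<bar> > c - s} \<inter> space P) \<le> ennreal ((4 * q / (\<kappa> + 1)) * s powr (\<kappa> + 1))" .
    moreover have "F x -` {y. \<bar>y\<bar> > c - s} \<inter> space P = {w \<in> space P. \<bar>F x w\<bar> > c - s}" by auto
    ultimately show ?thesis using q \<kappa> by (simp add: emeasure_eq_measure)
  qed
  show ?thesis by (rule that[OF _ \<delta>(1) bound]) (use q \<kappa> in auto)
qed

text \<open>For a density \<open>g\<close> of the distance to the edge, this is the mass of two
  independent such distances with sum below \<open>s\<close>.\<close>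

definition pair_integral :: "(real \<Rightarrow> ennreal) \<Rightarrow> real \<Rightarrow> ennreal" where
  "pair_integral g s = (\<integral>\<^sup>+u. \<integral>\<^sup>+v. g u * g v * indicator {..<s} (u + v) \<partial>lborel \<partial>lborel)"

lemma pair_integral_cmult:
  assumes [measurable]: "g \<in> borel_measurable borel"
  shows "pair_integral (\<lambda>u. k * g u) s = k * k * pair_integral g s"
proof -
  have "pair_integral (\<lambda>u. k * g u) s = (\<integral>\<^sup>+u. (k * k) * (\<integral>\<^sup>+v. g u * g v * indicator {..<s} (u + v) \<partial>lborel) \<partial>lborel)"
    unfolding pair_integral_def
    by (intro nn_integral_cong, subst nn_integral_cmult[symmetric]) (auto intro!: nn_integral_cong simp: mult_ac)
  also have "\<dots> = k * k * pair_integral g s"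
    unfolding pair_integral_def by (rule nn_integral_cmult) measurable
  finally show ?thesis .
qed

lemma edge_power_scale: "0 < s \<Longrightarrow> edge_power (s * u) = ennreal (s powr \<kappa>) * edge_power u"
  by (auto simp: edge_power_def indicator_def powr_mult ennreal_mult zero_le_mult_iff)

text \<open>Rescaling both variables by \<open>s\<close> yields \<open>s\<close> twice from Lebesgue
  measure and \<open>s powr \<kappa>\<close> twice from the densities; this is the origin of the
  exponent \<open>2 * \<kappa> + 2\<close>.\<close>

lemma pair_integral_edge_scale:
  assumes s: "0 < s"
  shows "pair_integral edge_power s = ennreal (s powr (2 * \<kappa> + 2)) * pair_integral edge_power 1"
proof -
  let ?g = "edge_power"
  have "pair_integral ?g s = ennreal s * (\<integral>\<^sup>+u. \<integral>\<^sup>+v. ?g (s * u) * ?g v * indicator {..<s} (s * u + v) \<partial>lborel \<partial>lborel)"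
    unfolding pair_integral_def using s
    by (subst nn_integral_real_affine[where c = s and t = 0]) auto
  also have "(\<integral>\<^sup>+u. \<integral>\<^sup>+v. ?g (s * u) * ?g v * indicator {..<s} (s * u + v) \<partial>lborel \<partial>lborel) =
      (\<integral>\<^sup>+u. ennreal s * (\<integral>\<^sup>+v. ?g (s * u) * ?g (s * v) * indicator {..<s} (s * u + s * v) \<partial>lborel) \<partial>lborel)"
  proof (intro nn_integral_cong)
    fix u
    show "(\<integral>\<^sup>+v. ?g (s * u) * ?g v * indicator {..<s} (s * u + v) \<partial>lborel) =
       ennreal s * (\<integral>\<^sup>+v. ?g (s * u) * ?g (s * v) * indicator {..<s} (s * u + s * v) \<partial>lborel)"
      using s by (subst nn_integral_real_affine[where c = s and t = 0]) auto
  qed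
  also have "\<dots> = ennreal s * (\<integral>\<^sup>+u. \<integral>\<^sup>+v. ?g (s * u) * ?g (s * v) * indicator {..<s} (s * u + s * v) \<partial>lborel \<partial>lborel)"
    by (rule nn_integral_cmult) measurable
  also have "(\<integral>\<^sup>+u. \<integral>\<^sup>+v. ?g (s * u) * ?g (s * v) * indicator {..<s} (s * u + s * v) \<partial>lborel \<partial>lborel) =
      pair_integral (\<lambda>u. ennreal (s powr \<kappa>) * ?g u) 1"
  proof -
    have "indicator {..<s} (s * u + s * v) = (indicator {..<1} (u + v) :: ennreal)" for u v
    proof -
      have "s * u + s * v < s * 1 \<longleftrightarrow> u + v < 1" using s by (simp only: distrib_left[symmetric] mult_less_cancel_left_pos)
      then show ?thesis by (auto simp: indicator_def)
    qed
    then show ?thesis unfolding pair_integral_def edge_power_scale[OF s] by simp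
  qed
  also have "\<dots> = ennreal (s powr \<kappa>) * ennreal (s powr \<kappa>) * pair_integral ?g 1"
    by (rule pair_integral_cmult) measurable
  also have "ennreal s * (ennreal s * (ennreal (s powr \<kappa>) * ennreal (s powr \<kappa>) * pair_integral ?g 1)) =
     ennreal (s powr (2 * \<kappa> + 2)) * pair_integral ?g 1"
  proof -
    have "s powr (2 * \<kappa> + 2) = s * s * (s powr \<kappa> * s powr \<kappa>)"
      using s powr_add[of s "\<kappa> + \<kappa>" 2] powr_add[of s \<kappa> \<kappa>] by (simp add: power2_eq_square mult_ac)
    then show ?thesis using s by (simp add: ennreal_mult' ennreal_mult'' mult_ac)
  qed
  finally show ?thesis .
qed

text \<open>Within the quadrant, the region \<open>u + v < 1\<close> lies between the squares of
  side \<open>1/3\<close> and \<open>1\<close>, on which the integral factorises. A closed square of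
  side \<open>1/2\<close> would already touch the excluded line.\<close>

lemma pair_integral_edge_pos_finite:
  obtains K where "K > 0" "pair_integral edge_power 1 = ennreal K"
proof -
  have prod: "(\<integral>\<^sup>+u. \<integral>\<^sup>+v. (edge_power u * indicator {..s} u) * (edge_power v * indicator {..s} v) \<partial>lborel \<partial>lborel)
     = ennreal ((s powr (\<kappa> + 1) / (\<kappa> + 1)) * (s powr (\<kappa> + 1) / (\<kappa> + 1)))" if "0 \<le> s" for s
    using that \<kappa> by (subst ennreal_mult) (auto simp: nn_integral_cmult nn_integral_multc nn_integral_edge_power)
  have "pair_integral edge_power 1 \<le> (\<integral>\<^sup>+u. \<integral>\<^sup>+v. (edge_power u * indicator {..1} u) * (edge_power v * indicator {..1} v) \<partial>lborel \<partial>lborel)"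
    unfolding pair_integral_def by (intro nn_integral_mono) (auto simp: edge_power_def indicator_def)
  also have "\<dots> < \<infinity>" by (subst prod) auto
  finally have fin: "pair_integral edge_power 1 < \<infinity>" .
  have "0 < ennreal (((1/3) powr (\<kappa> + 1) / (\<kappa> + 1)) * ((1/3) powr (\<kappa> + 1) / (\<kappa> + 1)))"
    using \<kappa> by simp
  also have "\<dots> = (\<integral>\<^sup>+u. \<integral>\<^sup>+v. (edge_power u * indicator {..1/3} u) * (edge_power v * indicator {..1/3} v) \<partial>lborel \<partial>lborel)"
    by (subst prod) auto
  also have "\<dots> \<le> pair_integral edge_power 1"
    unfolding pair_integral_def by (intro nn_integral_mono) (auto simp: edge_power_def indicator_def)
  finally have pos: "0 < pair_integral edge_power 1" .
  show ?thesis
    by (rule that[of "enn2real (pair_integral edge_power 1)"]) (use fin pos in \<open>auto simp: enn2real_positive_iff\<close>)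
qed

lemma indep_F: "x \<noteq> y \<Longrightarrow> indep_var lborel (F x) lborel (F y)"
proof -
  assume "x \<noteq> y"
  then have "indep_var borel (\<lambda>w. (\<lambda>\<omega>. \<omega> (Inl x)) (\<lambda>k. case_sum F B k w)) borel (\<lambda>w. (\<lambda>\<omega>. \<omega> (Inl y)) (\<lambda>k. case_sum F B k w))"
    by (intro indep_local_functions[of "{Inl x}" "{Inl y}"]) auto
  from indep_var_compose[OF this, of "\<lambda>x. x" lborel "\<lambda>x. x" lborel]
  show ?thesis by (simp add: comp_def)
qed

text \<open>A small discrepancy means that one of the two charges is near \<open>c\<close> and the
  other near \<open>- c\<close>. The two orders exclude each other for \<open>s < 2 * c\<close> and
  are equally likely, whence the factor \<open>2\<close>; evenness turns the distance to
  \<open>- c\<close> into a distance to \<open>c\<close>.\<close>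

lemma prob_discrepancy_eq:
  assumes "s < 2 * c"
  shows "ennreal (prob {w \<in> space P. discrepancy c F x w < s}) = 2 * pair_integral (\<lambda>u. ennreal (rho (c - u))) s"
proof -
  let ?r = "\<lambda>u. ennreal (rho (c - u))"
  have D: "distributed P (lborel \<Otimes>\<^sub>M lborel) (\<lambda>w. (F x w, F (x + 1) w)) (\<lambda>(y, z). ennreal (rho y) * ennreal (rho z))"
    by (intro distributed_joint_indep F_distr indep_F lborel.sigma_finite_measure_axioms) simp
  have em: "emeasure P ((\<lambda>w. (F x w, F (x + 1) w)) -` A \<inter> space P) =
     (\<integral>\<^sup>+y. \<integral>\<^sup>+z. ennreal (rho y) * ennreal (rho z) * indicator A (y, z) \<partial>lborel \<partial>lborel)"
    if [measurable]: "A \<in> sets (lborel \<Otimes>\<^sub>M lborel)" for A :: "(real \<times> real) set"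
  proof -
    have "emeasure P ((\<lambda>w. (F x w, F (x + 1) w)) -` A \<inter> space P) =
      (\<integral>\<^sup>+yz. (case yz of (y, z) \<Rightarrow> ennreal (rho y) * ennreal (rho z)) * indicator A yz \<partial>(lborel \<Otimes>\<^sub>M lborel))"
      by (rule distributed_emeasure[OF D]) measurable
    also have "\<dots> = (\<integral>\<^sup>+y. \<integral>\<^sup>+z. ennreal (rho y) * ennreal (rho z) * indicator A (y, z) \<partial>lborel \<partial>lborel)"
      by (subst lborel.nn_integral_fst[symmetric]) (auto simp: split_beta')
    finally show ?thesis .
  qed
  let ?U = "{yz :: real \<times> real. snd yz - fst yz > 2 * c - s}" and ?L = "{yz :: real \<times> real. fst yz - snd yz > 2 * c - s}"
  have setsUL [measurable]: "?U \<in> sets (lborel \<Otimes>\<^sub>M lborel)" "?L \<in> sets (lborel \<Otimes>\<^sub>M lborel)"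
  proof -
    have "?U = {yz \<in> space (lborel \<Otimes>\<^sub>M lborel). snd yz - fst yz > 2 * c - s}"
      "?L = {yz \<in> space (lborel \<Otimes>\<^sub>M lborel). fst yz - snd yz > 2 * c - s}" by (auto simp: space_pair_measure)
    then show "?U \<in> sets (lborel \<Otimes>\<^sub>M lborel)" "?L \<in> sets (lborel \<Otimes>\<^sub>M lborel)" by (simp_all only:) measurable
  qed
  have U: "emeasure P {w \<in> space P. F (x + 1) w - F x w > 2 * c - s} = pair_integral ?r s"
  proof -
    have "emeasure P {w \<in> space P. F (x + 1) w - F x w > 2 * c - s} =
       (\<integral>\<^sup>+y. \<integral>\<^sup>+z. ennreal (rho y) * ennreal (rho z) * indicator ?U (y, z) \<partial>lborel \<partial>lborel)"
      by (subst em[OF setsUL(1), symmetric]) (auto intro!: arg_cong2[where f=emeasure])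
    also have "\<dots> = (\<integral>\<^sup>+u. \<integral>\<^sup>+z. ennreal (rho (- c + u)) * ennreal (rho z) * indicator ?U (- c + u, z) \<partial>lborel \<partial>lborel)"
      by (subst nn_integral_real_affine[where c = 1 and t = "- c"]) auto
    also have "\<dots> = pair_integral ?r s"
      unfolding pair_integral_def
    proof (rule nn_integral_cong)
      fix u
      show "(\<integral>\<^sup>+z. ennreal (rho (- c + u)) * ennreal (rho z) * indicator ?U (- c + u, z) \<partial>lborel) =
         (\<integral>\<^sup>+v. ?r u * ?r v * indicator {..<s} (u + v) \<partial>lborel)"
        using rho_even[of "c - u"]
        by (subst nn_integral_real_affine[where c = "-1" and t = c]) (auto intro!: nn_integral_cong simp: indicator_def)
    qed
    finally show ?thesis .
  qed
  have L: "emeasure P {w \<in> space P. F x w - F (x + 1) w > 2 * c - s} = pair_integral ?r s"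
  proof -
    have "emeasure P {w \<in> space P. F x w - F (x + 1) w > 2 * c - s} =
       (\<integral>\<^sup>+y. \<integral>\<^sup>+z. ennreal (rho y) * ennreal (rho z) * indicator ?L (y, z) \<partial>lborel \<partial>lborel)"
      by (subst em[OF setsUL(2), symmetric]) (auto intro!: arg_cong2[where f=emeasure])
    also have "\<dots> = (\<integral>\<^sup>+u. \<integral>\<^sup>+z. ennreal (rho (c - u)) * ennreal (rho z) * indicator ?L (c - u, z) \<partial>lborel \<partial>lborel)"
      by (subst nn_integral_real_affine[where c = "-1" and t = c]) auto
    also have "\<dots> = pair_integral ?r s"
      unfolding pair_integral_def
    proof (rule nn_integral_cong)
      fix u
      have "rho (v - c) = rho (c - v)" for v using rho_even[of "c - v"] by simp
      then show "(\<integral>\<^sup>+z. ennreal (rho (c - u)) * ennreal (rho z) * indicator ?L (c - u, z) \<partial>lborel) =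
         (\<integral>\<^sup>+v. ?r u * ?r v * indicator {..<s} (u + v) \<partial>lborel)"
        by (subst nn_integral_real_affine[where c = 1 and t = "- c"]) (auto intro!: nn_integral_cong simp: indicator_def)
    qed
    finally show ?thesis .
  qed
  have "{w \<in> space P. discrepancy c F x w < s} =
     {w \<in> space P. F (x + 1) w - F x w > 2 * c - s} \<union> {w \<in> space P. F x w - F (x + 1) w > 2 * c - s}"
    unfolding discrepancy_def by auto
  moreover have "{w \<in> space P. F (x + 1) w - F x w > 2 * c - s} \<inter> {w \<in> space P. F x w - F (x + 1) w > 2 * c - s} = {}"
    using assms by auto
  ultimately have "emeasure P {w \<in> space P. discrepancy c F x w < s} =
      emeasure P {w \<in> space P. F (x + 1) w - F x w > 2 * c - s} + emeasure P {w \<in> space P. F x w - F (x + 1) w > 2 * c - s}"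
    by (simp only:) (rule plus_emeasure[symmetric]; measurable)
  then have "emeasure P {w \<in> space P. discrepancy c F x w < s} = pair_integral ?r s + pair_integral ?r s"
    by (simp only: U L)
  then show ?thesis by (simp add: emeasure_eq_measure mult_2)
qed

text \<open>Asymptotic equivalence of the distribution function with
  \<open>C * s powr (2 * \<kappa> + 2)\<close> as \<open>s\<close> tends to \<open>0\<close>,
  uniformly in \<open>x\<close>, because it is applied to thresholds that vary with the
  site.\<close>

definition discrepancy_tail :: "real \<Rightarrow> bool" where
  "discrepancy_tail C \<longleftrightarrow> (\<forall>\<epsilon>>0. \<exists>\<delta>>0. \<forall>s x. 0 < s \<longrightarrow> s < \<delta> \<longrightarrow>
     (C - \<epsilon>) * s powr (2 * \<kappa> + 2) \<le> prob {w \<in> space P. discrepancy c F x w < s} \<and>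
     prob {w \<in> space P. discrepancy c F x w < s} \<le> (C + \<epsilon>) * s powr (2 * \<kappa> + 2))"

lemma discrepancy_tailD:
  assumes "discrepancy_tail C" "\<epsilon> > 0"
  shows "\<exists>\<delta>>0. \<forall>s x. 0 < s \<longrightarrow> s < \<delta> \<longrightarrow>
     (C - \<epsilon>) * s powr (2 * \<kappa> + 2) \<le> prob {w \<in> space P. discrepancy c F x w < s} \<and>
     prob {w \<in> space P. discrepancy c F x w < s} \<le> (C + \<epsilon>) * s powr (2 * \<kappa> + 2)"
  using assms unfolding discrepancy_tail_def by blast

text \<open>Near the edge \<open>rho\<close> lies between \<open>q - e\<close> and
  \<open>q + e\<close> times the pure power, and the pair integral is quadratic in the density. So
  the constant is \<open>2 * q\<^sup>2 * K\<close>, with \<open>K\<close> the pair integral of the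
  pure power at \<open>s = 1\<close>.\<close>

lemma discrepancy_asymptotics:
  obtains C where "C > 0" "discrepancy_tail C"
proof -
  obtain K where K: "K > 0" "pair_integral edge_power 1 = ennreal K" by (rule pair_integral_edge_pos_finite)
  let ?C = "2 * q\<^sup>2 * K"
  show ?thesis
  proof (rule that[of ?C])
    show "0 < ?C" using q K by simp
    show "discrepancy_tail ?C" unfolding discrepancy_tail_def
    proof (intro allI impI)
      fix \<epsilon> :: real assume \<epsilon>: "\<epsilon> > 0"
      have "((\<lambda>e. 2 * (q + e)\<^sup>2 * K) \<longlongrightarrow> 2 * (q + 0)\<^sup>2 * K) (at_right 0)"
        "((\<lambda>e. 2 * (q - e)\<^sup>2 * K) \<longlongrightarrow> 2 * (q - 0)\<^sup>2 * K) (at_right 0)"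
        by (intro tendsto_intros)+
      then have "\<forall>\<^sub>F e in at_right 0. 2 * (q + e)\<^sup>2 * K < ?C + \<epsilon>" "\<forall>\<^sub>F e in at_right 0. ?C - \<epsilon> < 2 * (q - e)\<^sup>2 * K"
        using \<epsilon> by (auto dest: order_tendstoD(1)[of _ _ _ "?C - \<epsilon>"] order_tendstoD(2)[of _ _ _ "?C + \<epsilon>"])
      moreover have "\<forall>\<^sub>F e in at_right (0::real). 0 < e" by (simp add: eventually_at_right_less)
      moreover have "\<forall>\<^sub>F e in at_right (0::real). e < q" using q by (auto simp: eventually_at_right[of 0 1] intro!: exI[of _ q])
      ultimately have "\<forall>\<^sub>F e in at_right (0::real). 2 * (q + e)\<^sup>2 * K < ?C + \<epsilon> \<and> ?C - \<epsilon> < 2 * (q - e)\<^sup>2 * K \<and> 0 < e \<and> e < q"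
        by eventually_elim auto
      then obtain e where e: "2 * (q + e)\<^sup>2 * K < ?C + \<epsilon>" "?C - \<epsilon> < 2 * (q - e)\<^sup>2 * K" "0 < e" "e < q"
        by (metis (mono_tags, lifting) eventually_happens trivial_limit_at_right_real)
      obtain \<delta> where \<delta>: "\<delta> > 0" "\<And>u. 0 < u \<Longrightarrow> u < \<delta> \<Longrightarrow> (q - e) * u powr \<kappa> \<le> rho (c - u)"
        "\<And>u. 0 < u \<Longrightarrow> u < \<delta> \<Longrightarrow> rho (c - u) \<le> (q + e) * u powr \<kappa>"
        using rho_edge_bounds[OF e(3)] by metis
      let ?r = "\<lambda>u. ennreal (rho (c - u))"
      show "\<exists>\<delta>>0. \<forall>s x. 0 < s \<longrightarrow> s < \<delta> \<longrightarrow>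
         (?C - \<epsilon>) * s powr (2 * \<kappa> + 2) \<le> prob {w \<in> space P. discrepancy c F x w < s} \<and>
         prob {w \<in> space P. discrepancy c F x w < s} \<le> (?C + \<epsilon>) * s powr (2 * \<kappa> + 2)"
      proof (intro exI[of _ "min \<delta> c"] conjI allI impI)
        show "0 < min \<delta> c" using \<delta> c by simp
        fix s :: real and x assume s: "0 < s" "s < min \<delta> c"
        let ?p = "prob {w \<in> space P. discrepancy c F x w < s}"
        have p: "ennreal ?p = 2 * pair_integral ?r s" using s c by (intro prob_discrepancy_eq) auto
        have scaled: "2 * pair_integral (\<lambda>u. ennreal k * edge_power u) s = ennreal (2 * k\<^sup>2 * K * s powr (2 * \<kappa> + 2))" if "0 \<le> k" for k
        proof -
          have "2 * pair_integral (\<lambda>u. ennreal k * edge_power u) s = ennreal 2 * (ennreal k * ennreal k * (ennreal (s powr (2 * \<kappa> + 2)) * ennreal K))"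
            using s by (simp add: pair_integral_cmult pair_integral_edge_scale K(2))
          also have "\<dots> = ennreal (2 * k\<^sup>2 * K * s powr (2 * \<kappa> + 2))"
            using that K(1) by (simp add: power2_eq_square ennreal_mult' ennreal_mult'' mult_ac flip: ennreal_numeral)
          finally show ?thesis .
        qed
        have "pair_integral ?r s \<le> pair_integral (\<lambda>u. ennreal (q + e) * edge_power u) s"
          unfolding pair_integral_def
        proof (intro nn_integral_mono)
          fix u v
          show "?r u * ?r v * indicator {..<s} (u + v) \<le> ennreal (q + e) * edge_power u * (ennreal (q + e) * edge_power v) * indicator {..<s} (u + v)"
          proof (cases "u + v < s \<and> 0 < u \<and> 0 < v")
            case True
            then have "u < \<delta>" "v < \<delta>" using s by auto
            then have "?r u \<le> ennreal (q + e) * edge_power u" "?r v \<le> ennreal (q + e) * edge_power v"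
              using rho_le_edge_power[OF \<delta>(3)] q e by auto
            then show ?thesis by (intro mult_mono) auto
          next
            case False
            then have "?r u * ?r v * indicator {..<s} (u + v) = 0"
              using rho_zero[of "c - u"] rho_zero[of "c - v"] by (cases "u \<le> 0"; cases "v \<le> 0") auto
            then show ?thesis by (simp only: zero_le)
          qed
        qed
        then have "ennreal ?p \<le> ennreal (2 * (q + e)\<^sup>2 * K * s powr (2 * \<kappa> + 2))"
          unfolding p using scaled[of "q + e"] q e by (metis add_nonneg_nonneg less_imp_le mult_left_mono zero_le)
        then have "?p \<le> 2 * (q + e)\<^sup>2 * K * s powr (2 * \<kappa> + 2)" using K by (subst (asm) ennreal_le_iff) auto
        also have "\<dots> \<le> (?C + \<epsilon>) * s powr (2 * \<kappa> + 2)" using e by (intro mult_right_mono) auto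
        finally show "?p \<le> (?C + \<epsilon>) * s powr (2 * \<kappa> + 2)" .
        have "pair_integral (\<lambda>u. ennreal (q - e) * edge_power u) s \<le> pair_integral ?r s"
          unfolding pair_integral_def
        proof (intro nn_integral_mono)
          fix u v
          show "ennreal (q - e) * edge_power u * (ennreal (q - e) * edge_power v) * indicator {..<s} (u + v) \<le> ?r u * ?r v * indicator {..<s} (u + v)"
          proof (cases "u + v < s \<and> 0 < u \<and> 0 < v")
            case True
            then have "u < \<delta>" "v < \<delta>" using s by auto
            then have "ennreal (q - e) * edge_power u \<le> ?r u" "ennreal (q - e) * edge_power v \<le> ?r v"
              using edge_power_le_rho[OF \<delta>(2)] q e by auto
            then show ?thesis by (intro mult_mono) auto
          next
            case False
            have "edge_power z = 0" if "z \<le> 0" for z using that by (cases "z = 0") (auto simp: edge_power_def)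
            then have "ennreal (q - e) * edge_power u * (ennreal (q - e) * edge_power v) * indicator {..<s} (u + v) = 0"
              using False by (cases "u \<le> 0"; cases "v \<le> 0") auto
            then show ?thesis by (simp only: zero_le)
          qed
        qed
        then have "ennreal (2 * (q - e)\<^sup>2 * K * s powr (2 * \<kappa> + 2)) \<le> ennreal ?p"
          unfolding p using scaled[of "q - e"] e by (metis diff_ge_0_iff_ge less_imp_le mult_left_mono zero_le)
        then have "2 * (q - e)\<^sup>2 * K * s powr (2 * \<kappa> + 2) \<le> ?p" by (subst (asm) ennreal_le_iff) auto
        moreover have "(?C - \<epsilon>) * s powr (2 * \<kappa> + 2) \<le> 2 * (q - e)\<^sup>2 * K * s powr (2 * \<kappa> + 2)"
          using e by (intro mult_right_mono) auto
        ultimately show "(?C - \<epsilon>) * s powr (2 * \<kappa> + 2) \<le> ?p" by linarith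
      qed
    qed
  qed
qed

end

section \<open>The extremal limit\<close>

lemma (in iid_environment) prob_local_events:
  fixes p r :: "(int + int \<Rightarrow> real) \<Rightarrow> bool"
  assumes "J \<inter> J' = {}"
    and [measurable]: "Measurable.pred (PiM UNIV (\<lambda>_. borel)) p" "Measurable.pred (PiM UNIV (\<lambda>_. borel)) r"
    and local: "\<And>\<omega> \<omega>'. (\<And>k. k \<in> J \<Longrightarrow> \<omega> k = \<omega>' k) \<Longrightarrow> p \<omega> = p \<omega>'"
      "\<And>\<omega> \<omega>'. (\<And>k. k \<in> J' \<Longrightarrow> \<omega> k = \<omega>' k) \<Longrightarrow> r \<omega> = r \<omega>'"
  shows "prob {w \<in> space P. p (\<lambda>k. case_sum F B k w) \<and> r (\<lambda>k. case_sum F B k w)} =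
    prob {w \<in> space P. p (\<lambda>k. case_sum F B k w)} * prob {w \<in> space P. r (\<lambda>k. case_sum F B k w)}"
proof -
  let ?\<Phi> = "\<lambda>\<omega>. (if p \<omega> then 1 else 0 :: real)" and ?\<Psi> = "\<lambda>\<omega>. (if r \<omega> then 1 else 0 :: real)"
  have "indep_var borel (\<lambda>w. ?\<Phi> (\<lambda>k. case_sum F B k w)) borel (\<lambda>w. ?\<Psi> (\<lambda>k. case_sum F B k w))"
  proof (rule indep_local_functions[OF assms(1)])
    show "?\<Phi> \<omega> = ?\<Phi> \<omega>'" if "\<And>k. k \<in> J \<Longrightarrow> \<omega> k = \<omega>' k" for \<omega> \<omega>'
      using local(1)[of \<omega> \<omega>', OF that] by simp
    show "?\<Psi> \<omega> = ?\<Psi> \<omega>'" if "\<And>k. k \<in> J' \<Longrightarrow> \<omega> k = \<omega>' k" for \<omega> \<omega>'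
      using local(2)[of \<omega> \<omega>', OF that] by simp
  qed measurable
  from indep_varD[OF this, of "{1}" "{1}"] have "prob ((\<lambda>w. (?\<Phi> (\<lambda>k. case_sum F B k w), ?\<Psi> (\<lambda>k. case_sum F B k w))) -` ({1} \<times> {1}) \<inter> space P) =
     prob ((\<lambda>w. ?\<Phi> (\<lambda>k. case_sum F B k w)) -` {1} \<inter> space P) * prob ((\<lambda>w. ?\<Psi> (\<lambda>k. case_sum F B k w)) -` {1} \<inter> space P)"
    by simp
  moreover have "(\<lambda>w. (?\<Phi> (\<lambda>k. case_sum F B k w), ?\<Psi> (\<lambda>k. case_sum F B k w))) -` ({1} \<times> {1}) \<inter> space P =
      {w \<in> space P. p (\<lambda>k. case_sum F B k w) \<and> r (\<lambda>k. case_sum F B k w)}"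
    "(\<lambda>w. ?\<Phi> (\<lambda>k. case_sum F B k w)) -` {1} \<inter> space P = {w \<in> space P. p (\<lambda>k. case_sum F B k w)}"
    "(\<lambda>w. ?\<Psi> (\<lambda>k. case_sum F B k w)) -` {1} \<inter> space P = {w \<in> space P. r (\<lambda>k. case_sum F B k w)}"
    by (auto split: if_splits)
  ultimately show ?thesis by (simp only:)
qed

context disorder
begin

lemma AE_F_all: "AE w in P. \<forall>x. \<bar>F x w\<bar> < c"
  by (subst AE_all_countable) (auto intro: AE_F)

lemma discrepancy_nonneg:
  assumes "\<And>x. \<bar>F x w\<bar> < c"
  shows "0 \<le> discrepancy c F x w"
  unfolding discrepancy_def using assms[of x] assms[of "x + 1"] by (auto simp: abs_if split: if_splits)

lemma discrepancy_measurable [measurable]: "discrepancy c F x \<in> borel_measurable P"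
  unfolding discrepancy_def by measurable

lemma prob_triple:
  "prob {w \<in> space P. \<bar>F x w\<bar> > t \<and> \<bar>F (x + 1) w\<bar> > t \<and> \<bar>F (x + 2) w\<bar> > t} =
    prob {w \<in> space P. \<bar>F x w\<bar> > t} * prob {w \<in> space P. \<bar>F (x + 1) w\<bar> > t} * prob {w \<in> space P. \<bar>F (x + 2) w\<bar> > t}"
proof -
  have 1: "prob {w \<in> space P. \<bar>F x w\<bar> > t \<and> (\<bar>F (x + 1) w\<bar> > t \<and> \<bar>F (x + 2) w\<bar> > t)} =
    prob {w \<in> space P. \<bar>F x w\<bar> > t} * prob {w \<in> space P. \<bar>F (x + 1) w\<bar> > t \<and> \<bar>F (x + 2) w\<bar> > t}"
  proof -
    let ?p = "\<lambda>\<omega> :: int + int \<Rightarrow> real. \<bar>\<omega> (Inl x)\<bar> > t"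
      and ?r = "\<lambda>\<omega> :: int + int \<Rightarrow> real. \<bar>\<omega> (Inl (x + 1))\<bar> > t \<and> \<bar>\<omega> (Inl (x + 2))\<bar> > t"
    have "prob {w \<in> space P. ?p (\<lambda>k. case_sum F B k w) \<and> ?r (\<lambda>k. case_sum F B k w)} =
       prob {w \<in> space P. ?p (\<lambda>k. case_sum F B k w)} * prob {w \<in> space P. ?r (\<lambda>k. case_sum F B k w)}"
      by (rule prob_local_events[of "{Inl x}" "{Inl (x + 1), Inl (x + 2)}"]) auto
    then show ?thesis by simp
  qed
  have 2: "prob {w \<in> space P. \<bar>F (x + 1) w\<bar> > t \<and> \<bar>F (x + 2) w\<bar> > t} =
    prob {w \<in> space P. \<bar>F (x + 1) w\<bar> > t} * prob {w \<in> space P. \<bar>F (x + 2) w\<bar> > t}"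
  proof -
    let ?p = "\<lambda>\<omega> :: int + int \<Rightarrow> real. \<bar>\<omega> (Inl (x + 1))\<bar> > t"
      and ?r = "\<lambda>\<omega> :: int + int \<Rightarrow> real. \<bar>\<omega> (Inl (x + 2))\<bar> > t"
    have "prob {w \<in> space P. ?p (\<lambda>k. case_sum F B k w) \<and> ?r (\<lambda>k. case_sum F B k w)} =
       prob {w \<in> space P. ?p (\<lambda>k. case_sum F B k w)} * prob {w \<in> space P. ?r (\<lambda>k. case_sum F B k w)}"
      by (rule prob_local_events[of "{Inl (x + 1)}" "{Inl (x + 2)}"]) auto
    then show ?thesis by simp
  qed
  show ?thesis using 1 unfolding 2 by (simp add: mult.assoc)
qed

lemma prob_triple_le:
  assumes "\<And>x. prob {w \<in> space P. \<bar>F x w\<bar> > t} \<le> y"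
  shows "prob {w \<in> space P. \<bar>F x w\<bar> > t \<and> \<bar>F (x + 1) w\<bar> > t \<and> \<bar>F (x + 2) w\<bar> > t} \<le> y ^ 3"
proof -
  have y: "0 \<le> y" using order_trans[OF measure_nonneg assms[of 0]] .
  have "prob {w \<in> space P. \<bar>F x w\<bar> > t} * prob {w \<in> space P. \<bar>F (x + 1) w\<bar> > t} * prob {w \<in> space P. \<bar>F (x + 2) w\<bar> > t} \<le> y * y * y"
    using y by (intro mult_mono assms) auto
  then show ?thesis unfolding prob_triple by (simp add: power3_eq_cube)
qed

section \<open>Powers of \<open>n\<close> on the critical scale\<close>

abbreviation \<zeta> :: real where "\<zeta> \<equiv> (2 * \<kappa> + 2) / (2 * \<kappa> + 3)"

abbreviation scale :: "nat \<Rightarrow> real" where "scale n \<equiv> real n powr \<zeta>"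

lemma scale_at_top: "filterlim scale at_top sequentially"
proof -
  have "0 < \<zeta>" using \<kappa> by auto
  show ?thesis
    unfolding filterlim_at_top
  proof
    fix Z :: real
    have "\<forall>\<^sub>F n in sequentially. (max 1 Z) powr (1 / \<zeta>) \<le> real n"
      by (rule eventually_nat_real) (rule eventually_ge_at_top)
    then show "\<forall>\<^sub>F n in sequentially. Z \<le> scale n"
    proof eventually_elim
      case (elim n)
      have "((max 1 Z) powr (1 / \<zeta>)) powr \<zeta> \<le> scale n" using elim \<open>0 < \<zeta>\<close> by (intro powr_mono2) auto
      moreover have "((max 1 Z) powr (1 / \<zeta>)) powr \<zeta> = max 1 Z" using \<open>0 < \<zeta>\<close> by (subst powr_powr) auto
      ultimately show ?case by linarith
    qed
  qed
qed

lemma scale_ratio_tendsto: "(\<lambda>n. scale n / real n) \<longlonglongrightarrow> 0"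
proof -
  have "\<zeta> - 1 < 0" using \<kappa> by (auto simp: field_simps)
  then have lim: "((\<lambda>x. x powr (\<zeta> - 1)) \<longlongrightarrow> 0) at_top" by (intro tendsto_neg_powr filterlim_ident) auto
  have "(\<lambda>n. real n powr (\<zeta> - 1)) \<longlonglongrightarrow> 0" using filterlim_compose[OF lim filterlim_real_sequentially] .
  moreover have "scale n / real n = real n powr (\<zeta> - 1)" for n
    by (cases "n = 0") (auto simp: powr_diff)
  ultimately show ?thesis by simp
qed

text \<open>These identities characterise \<open>\<zeta>\<close>: a discrepancy of order
  \<open>N / n\<close> has probability of order \<open>1 / N\<close>, so among order
  \<open>N\<close> sites boundedly many are expected to have one.\<close>

lemma scale_ratio_powr:
  assumes "n > 0"
  shows "(scale n / real n) powr (2 * \<kappa> + 2) = 1 / scale n"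
    and "scale n powr (2 * \<kappa> + 3) = real n powr (2 * \<kappa> + 2)"
proof -
  have k: "2 * \<kappa> + 3 > 0" using \<kappa> by simp
  have e: "(\<zeta> - 1) * (2 * \<kappa> + 2) = - \<zeta>" using k by (simp add: field_simps)
  have "(scale n / real n) powr (2 * \<kappa> + 2) = (real n powr (\<zeta> - 1)) powr (2 * \<kappa> + 2)" using assms by (simp add: powr_diff)
  also have "\<dots> = real n powr (- \<zeta>)" using e by (simp add: powr_powr)
  finally show "(scale n / real n) powr (2 * \<kappa> + 2) = 1 / scale n" by (simp add: powr_minus field_simps)
  show "scale n powr (2 * \<kappa> + 3) = real n powr (2 * \<kappa> + 2)" using k by (simp add: powr_powr)
qed

text \<open>Bounds the expected number of triples of neighbouring charges within order
  \<open>N / n\<close> of the edge. With \<open>y\<close> the bound for one charge,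
  \<open>y\<^sup>2\<close> is of order \<open>1 / N\<close>, so \<open>N * y ^ 3\<close> is of order
  \<open>y\<close>.\<close>

lemma triple_error_tendsto:
  assumes "0 \<le> a"
  shows "(\<lambda>n. (2 * (K * scale n) + 1) * (C * (a * (scale n / real n)) powr (\<kappa> + 1)) ^ 3) \<longlonglongrightarrow> 0"
proof -
  define y where "y n = C * (a * (scale n / real n)) powr (\<kappa> + 1)" for n
  define Z where "Z = C\<^sup>2 * a powr (2 * \<kappa> + 2)"
  have y0: "y \<longlonglongrightarrow> 0"
  proof -
    have "(\<lambda>n. a * (scale n / real n)) \<longlonglongrightarrow> 0" using tendsto_mult_left[OF scale_ratio_tendsto, of a] by simp
    then have "(\<lambda>n. (a * (scale n / real n)) powr (\<kappa> + 1)) \<longlonglongrightarrow> 0 powr (\<kappa> + 1)"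
      by (rule tendsto_powr2[OF _ tendsto_const]) (use \<kappa> assms in auto)
    from tendsto_mult_left[OF this, of C] show ?thesis by (simp add: y_def[abs_def])
  qed
  have y2: "(y n)\<^sup>2 = Z * (1 / scale n)" if "n > 0" for n
  proof -
    have "(y n)\<^sup>2 = C\<^sup>2 * (a * (scale n / real n)) powr (2 * \<kappa> + 2)"
      by (simp add: y_def power_mult_distrib power2_eq_square flip: powr_add)
    also have "(a * (scale n / real n)) powr (2 * \<kappa> + 2) = a powr (2 * \<kappa> + 2) * (scale n / real n) powr (2 * \<kappa> + 2)"
      by (rule powr_mult)
    finally show ?thesis using scale_ratio_powr(1)[OF that] by (simp add: Z_def)
  qed
  have invN: "(\<lambda>n. 1 / scale n) \<longlonglongrightarrow> 0"
    using tendsto_inverse_0_at_top[OF scale_at_top] by (simp add: divide_inverse)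
  have "(\<lambda>n. (2 * K * Z + Z * (1 / scale n)) * y n) \<longlonglongrightarrow> (2 * K * Z + Z * 0) * 0"
    by (intro tendsto_intros invN y0)
  moreover have "\<forall>\<^sub>F n in sequentially. (2 * K * Z + Z * (1 / scale n)) * y n = (2 * (K * scale n) + 1) * y n ^ 3"
    using eventually_gt_at_top[of 0]
  proof eventually_elim
    case (elim n)
    have "scale n \<noteq> 0" using elim by simp
    then have "2 * K * Z + Z * (1 / scale n) = (2 * (K * scale n) + 1) * (Z * (1 / scale n))" by (simp add: field_simps)
    then show ?case unfolding y2[OF elim, symmetric] by (simp add: power3_eq_cube power2_eq_square mult_ac)
  qed
  ultimately show ?thesis using Lim_transform_eventually unfolding y_def by fastforce
qed

text \<open>The condition fails at \<open>x\<close> when the discrepancy lies below a threshold that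
  decreases linearly in \<open>\<bar>x\<bar>\<close>. These events are rare and one-dependent, and
  their total probability converges as a Riemann sum. \<open>\<theta> \<le> \<alpha> * K\<close>
  puts all sites with positive threshold inside the window.\<close>

lemma extreme_limit:
  assumes asym: "discrepancy_tail C"
    and \<alpha>: "\<alpha> > 0" and \<beta>: "\<beta> > 0" and \<theta>: "\<theta> > 0" and K: "\<theta> \<le> \<alpha> * K"
  shows "(\<lambda>n. prob {w \<in> space P. \<forall>x. real_of_int \<bar>x\<bar> \<le> K * scale n \<longrightarrow>
       \<theta> * scale n \<le> \<alpha> * real_of_int \<bar>x\<bar> + \<beta> * real n * discrepancy c F x w})
    \<longlonglongrightarrow> exp (- (2 * C * \<theta> powr (2 * \<kappa> + 3) / (\<alpha> * \<beta> powr (2 * \<kappa> + 2) * (2 * \<kappa> + 3))))"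
proof -
  define p where "p = 2 * \<kappa> + 2"
  have p: "p > 0" using \<kappa> by (simp add: p_def)
  have p1: "2 * \<kappa> + 3 = p + 1" by (simp add: p_def)
  \<comment> \<open>Limit of the threshold powers summed over one half-line; the two sides together
    give \<open>2 * \<Lambda>\<close>.\<close>
  define \<Lambda> where "\<Lambda> = \<theta> powr (p + 1) / (\<alpha> * (p + 1)) / \<beta> powr p"
  \<comment> \<open>The largest threshold, attained at \<open>x = 0\<close>.\<close>
  define S where "S n = \<theta> * scale n / (\<beta> * real n)" for n
  define m where "m n = nat \<lfloor>K * scale n\<rfloor>" for n
  \<comment> \<open>Enumerates the window from left to right, so that consecutive indices are
    neighbouring sites and dependence reaches only one index back.\<close>
  define X where "X n j = int j - int (m n)" for n j
  define s where "s n x = (\<theta> * scale n - \<alpha> * real_of_int \<bar>x\<bar>) / (\<beta> * real n)" for n x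
  define A where "A n j = {w \<in> space P. discrepancy c F (X n j) w < s n (X n j)}" for n j
  have Am [measurable]: "A n j \<in> events" for n j unfolding A_def by measurable
  have "0 < \<alpha> * K" using K \<theta> by linarith
  then have K0: "K > 0" using \<alpha> by (simp add: zero_less_mult_iff)
  have S0: "S \<longlonglongrightarrow> 0"
  proof -
    have "(\<lambda>n. \<theta> / \<beta> * (scale n / real n)) \<longlonglongrightarrow> \<theta> / \<beta> * 0" by (intro tendsto_mult_left scale_ratio_tendsto)
    moreover have "S = (\<lambda>n. \<theta> / \<beta> * (scale n / real n))" by (simp add: S_def fun_eq_iff)
    ultimately show ?thesis by simp
  qed
  have Spos: "S n > 0" if "n > 0" for n using that \<theta> \<beta> by (simp add: S_def)
  have Sp: "S n powr p = (\<theta> / \<beta>) powr p / scale n" if "n > 0" for n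
  proof -
    have "S n powr p = (\<theta> / \<beta> * (scale n / real n)) powr p" by (simp add: S_def)
    also have "\<dots> = (\<theta> / \<beta>) powr p * (scale n / real n) powr p" using \<theta> \<beta> by (subst powr_mult) auto
    finally show ?thesis using scale_ratio_powr(1)[OF that] by (simp add: p_def)
  qed
  have sS: "s n x \<le> S n" for n x
    unfolding s_def S_def using \<alpha> \<beta> by (intro divide_right_mono) auto
  have invN: "(\<lambda>n. 1 / scale n) \<longlonglongrightarrow> 0"
    using tendsto_inverse_0_at_top[OF scale_at_top] by (simp add: divide_inverse)
  have Sp0: "(\<lambda>n. S n powr p) \<longlonglongrightarrow> 0"
  proof (rule Lim_transform_eventually)
    show "(\<lambda>n. (\<theta> / \<beta>) powr p * (1 / scale n)) \<longlonglongrightarrow> 0" using tendsto_mult_left[OF invN] by simp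
    show "\<forall>\<^sub>F n in sequentially. (\<theta> / \<beta>) powr p * (1 / scale n) = S n powr p"
      using eventually_gt_at_top[of 0] by eventually_elim (simp add: Sp)
  qed
  \<comment> \<open>Discrepancies are almost surely nonnegative, so sites with a nonpositive
    threshold contribute nothing.\<close>
  have prob0: "prob {w \<in> space P. discrepancy c F x w < t} = 0" if "t \<le> 0" for x t
  proof -
    have "prob {w \<in> space P. discrepancy c F x w < t} = prob {}"
    proof (rule finite_measure_eq_AE)
      show "AE w in P. w \<in> {w \<in> space P. discrepancy c F x w < t} \<longleftrightarrow> w \<in> {}"
        using AE_F_all
      proof eventually_elim
        case (elim w)
        then show ?case using discrepancy_nonneg[of w x] that by auto
      qed
    qed auto
    then show ?thesis by simp
  qed

  define \<sigma> where "\<sigma> n = (\<Sum>j<2 * m n + 1. (max 0 (s n (X n j))) powr p)" for n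
  have \<sigma>: "\<bar>\<sigma> n - 2 * \<Lambda>\<bar> \<le> S n powr p" if n: "n > 0" for n
  proof -
    let ?N = "scale n"
    have N: "?N > 0" using n by simp
    define g where "g k = (max 0 (\<theta> * ?N - \<alpha> * real k)) powr p" for k :: nat
    \<comment> \<open>The two half-lines share the site \<open>0\<close>, hence the subtracted
      \<open>g 0\<close>.\<close>
    have split: "(\<Sum>j<2 * m n + 1. (max 0 (\<theta> * ?N - \<alpha> * real_of_int \<bar>X n j\<bar>)) powr p) = 2 * (\<Sum>k<m n + 1. g k) - g 0"
    proof -
      have "(\<Sum>j<2 * m n + 1. (max 0 (\<theta> * ?N - \<alpha> * real_of_int \<bar>X n j\<bar>)) powr p) =
         (\<Sum>j<m n. (max 0 (\<theta> * ?N - \<alpha> * real_of_int \<bar>X n j\<bar>)) powr p) + (\<Sum>j=m n..<2 * m n + 1. (max 0 (\<theta> * ?N - \<alpha> * real_of_int \<bar>X n j\<bar>)) powr p)"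
        by (subst sum.atLeastLessThan_concat[of 0 "m n", symmetric, unfolded atLeast0LessThan]) auto
      also have "(\<Sum>j<m n. (max 0 (\<theta> * ?N - \<alpha> * real_of_int \<bar>X n j\<bar>)) powr p) = (\<Sum>k<m n. g (Suc k))"
        by (rule sum.reindex_bij_witness[of _ "\<lambda>k. m n - Suc k" "\<lambda>k. m n - Suc k"])
          (auto simp: g_def X_def of_nat_diff)
      also have "(\<Sum>j=m n..<2 * m n + 1. (max 0 (\<theta> * ?N - \<alpha> * real_of_int \<bar>X n j\<bar>)) powr p) = (\<Sum>k<m n + 1. g k)"
        by (rule sum.reindex_bij_witness[of _ "\<lambda>k. m n + k" "\<lambda>j. j - m n"])
          (auto simp: g_def X_def of_nat_diff)
      also have "(\<Sum>k<m n. g (Suc k)) = (\<Sum>k<m n + 1. g k) - g 0"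
        by (simp add: sum.lessThan_Suc_shift del: sum.lessThan_Suc)
      finally show ?thesis by simp
    qed
    have "\<sigma> n = (\<Sum>j<2 * m n + 1. (max 0 (\<theta> * ?N - \<alpha> * real_of_int \<bar>X n j\<bar>)) powr p / (\<beta> * real n) powr p)"
      unfolding \<sigma>_def
    proof (intro sum.cong refl)
      fix j
      have "max 0 (s n (X n j)) = max 0 (\<theta> * ?N - \<alpha> * real_of_int \<bar>X n j\<bar>) / (\<beta> * real n)"
      proof -
        have "0 < \<beta> * real n" using \<beta> n by simp
        then show ?thesis by (auto simp: s_def max_def zero_le_divide_iff)
      qed
      then show "(max 0 (s n (X n j))) powr p = (max 0 (\<theta> * ?N - \<alpha> * real_of_int \<bar>X n j\<bar>)) powr p / (\<beta> * real n) powr p"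
        using \<beta> by (simp add: powr_divide)
    qed
    then have \<sigma>n: "\<sigma> n = (2 * (\<Sum>k<m n + 1. g k) - g 0) / (\<beta> * real n) powr p"
      by (simp only: split[symmetric] sum_divide_distrib)
    have cover: "\<theta> * ?N \<le> \<alpha> * real (m n + 1)"
    proof -
      have "K * ?N \<le> real (m n + 1)" unfolding m_def by linarith
      then have "\<alpha> * (K * ?N) \<le> \<alpha> * real (m n + 1)" using \<alpha> by (intro mult_left_mono) auto
      moreover have "\<theta> * ?N \<le> \<alpha> * K * ?N" using K N by (intro mult_right_mono) auto
      ultimately show ?thesis by (simp add: mult.assoc)
    qed
    have \<theta>N: "0 < \<theta> * ?N" using \<theta> N by simp
    let ?L = "(\<theta> * ?N) powr (p + 1) / (\<alpha> * (p + 1))"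
    have b: "?L \<le> (\<Sum>k<m n + 1. g k)" "(\<Sum>k<m n + 1. g k) \<le> ?L + (\<theta> * ?N) powr p"
      unfolding g_def by (rule tent_sum_bounds[OF p \<alpha> \<theta>N cover])+
    have g0: "g 0 = (\<theta> * ?N) powr p" using \<theta>N by (simp add: g_def)
    have "\<bar>(2 * (\<Sum>k<m n + 1. g k) - g 0) - 2 * ?L\<bar> \<le> (\<theta> * ?N) powr p"
      using b unfolding g0 by linarith
    then have "\<bar>(2 * (\<Sum>k<m n + 1. g k) - g 0) - 2 * ?L\<bar> / (\<beta> * real n) powr p \<le> (\<theta> * ?N) powr p / (\<beta> * real n) powr p"
      by (intro divide_right_mono) auto
    moreover have "(\<theta> * ?N) powr p / (\<beta> * real n) powr p = S n powr p" unfolding S_def using \<theta>N \<beta> by (simp add: powr_divide)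
    moreover have "?L / (\<beta> * real n) powr p = \<Lambda>"
    proof -
      have "(\<theta> * ?N) powr (p + 1) = \<theta> powr (p + 1) * real n powr p"
      proof -
        have "?N powr (p + 1) = real n powr p"
          unfolding p1[symmetric] unfolding p_def by (rule scale_ratio_powr(2)[OF n])
        then show ?thesis using \<theta> by (simp add: powr_mult)
      qed
      moreover have "(\<beta> * real n) powr p = \<beta> powr p * real n powr p" using \<beta> by (simp add: powr_mult)
      ultimately show ?thesis using n by (simp add: \<Lambda>_def)
    qed
    moreover have "\<bar>(2 * (\<Sum>k<m n + 1. g k) - g 0) - 2 * ?L\<bar> / (\<beta> * real n) powr p = \<bar>\<sigma> n - 2 * (?L / (\<beta> * real n) powr p)\<bar>"
    proof -
      have gen: "\<bar>x - 2 * l\<bar> / d = \<bar>x / d - 2 * (l / d)\<bar>" if "0 \<le> d" for x l d :: real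
      proof -
        have "x / d - 2 * (l / d) = (x - 2 * l) / d" by (simp add: diff_divide_distrib)
        then show ?thesis using that by simp
      qed
      show ?thesis unfolding \<sigma>n by (rule gen) simp
    qed
    ultimately show ?thesis by simp
  qed
  have \<sigma>lim: "\<sigma> \<longlonglongrightarrow> 2 * \<Lambda>"
  proof -
    have "(\<lambda>n. \<sigma> n - 2 * \<Lambda>) \<longlonglongrightarrow> 0"
    proof (rule Lim_null_comparison[OF _ Sp0])
      show "\<forall>\<^sub>F n in sequentially. norm (\<sigma> n - 2 * \<Lambda>) \<le> S n powr p"
        using eventually_gt_at_top[of 0] by eventually_elim (simp add: \<sigma>)
    qed
    then show ?thesis by (simp add: LIM_zero_iff)
  qed
  define mass where "mass n = (\<Sum>j<2 * m n + 1. prob (A n j))" for n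
  \<comment> \<open>All thresholds are at most \<open>S n\<close>, so for large \<open>n\<close> the
    tail asymptotics apply at every site with the same \<open>\<epsilon>\<close>.\<close>
  have close: "\<forall>\<^sub>F n in sequentially. \<bar>mass n - C * \<sigma> n\<bar> \<le> \<epsilon> * \<sigma> n" if \<epsilon>: "\<epsilon> > 0" for \<epsilon>
  proof -
    obtain \<delta> where \<delta>: "\<delta> > 0" "\<And>t x. 0 < t \<Longrightarrow> t < \<delta> \<Longrightarrow>
       (C - \<epsilon>) * t powr p \<le> prob {w \<in> space P. discrepancy c F x w < t} \<and>
       prob {w \<in> space P. discrepancy c F x w < t} \<le> (C + \<epsilon>) * t powr p"
      using discrepancy_tailD[OF asym \<epsilon>] unfolding p_def by blast
    have "\<forall>\<^sub>F n in sequentially. S n < \<delta>" using S0 \<delta>(1) by (rule order_tendstoD)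
    then show ?thesis
    proof eventually_elim
      case (elim n)
      have "\<bar>prob (A n j) - C * (max 0 (s n (X n j))) powr p\<bar> \<le> \<epsilon> * (max 0 (s n (X n j))) powr p" for j
      proof (cases "s n (X n j) > 0")
        case True
        have "s n (X n j) < \<delta>" using sS[of n "X n j"] elim by linarith
        from \<delta>(2)[OF True this, of "X n j"] show ?thesis using True
          by (auto simp: A_def abs_le_iff algebra_simps)
      next
        case False
        then show ?thesis using prob0[of "s n (X n j)"] p by (simp add: A_def max_def)
      qed
      then have "(\<Sum>j<2 * m n + 1. \<bar>prob (A n j) - C * (max 0 (s n (X n j))) powr p\<bar>) \<le> (\<Sum>j<2 * m n + 1. \<epsilon> * (max 0 (s n (X n j))) powr p)"
        by (intro sum_mono)
      moreover have "\<bar>mass n - C * \<sigma> n\<bar> \<le> (\<Sum>j<2 * m n + 1. \<bar>prob (A n j) - C * (max 0 (s n (X n j))) powr p\<bar>)"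
        unfolding mass_def \<sigma>_def sum_distrib_left sum_subtractf[symmetric] by (rule sum_abs)
      moreover have "(\<Sum>j<2 * m n + 1. \<epsilon> * (max 0 (s n (X n j))) powr p) = \<epsilon> * \<sigma> n"
        unfolding \<sigma>_def by (rule sum_distrib_left[symmetric])
      ultimately show ?case by linarith
    qed
  qed
  have mass_lim: "mass \<longlonglongrightarrow> C * (2 * \<Lambda>)"
  proof -
    have "(\<lambda>n. mass n - C * \<sigma> n) \<longlonglongrightarrow> 0"
    proof (rule tendstoI)
      fix e :: real assume e: "e > 0"
      have L0: "\<Lambda> \<ge> 0" using \<alpha> p by (simp add: \<Lambda>_def)
      define \<epsilon> where "\<epsilon> = e / 2 / (2 * \<Lambda> + 1)"
      have \<epsilon>: "\<epsilon> > 0" using e L0 by (simp add: \<epsilon>_def)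
      have "\<forall>\<^sub>F n in sequentially. \<sigma> n < 2 * \<Lambda> + 1" using \<sigma>lim by (rule order_tendstoD) simp
      then show "\<forall>\<^sub>F n in sequentially. dist (mass n - C * \<sigma> n) 0 < e"
        using close[OF \<epsilon>]
      proof eventually_elim
        case (elim n)
        have "\<epsilon> * \<sigma> n \<le> \<epsilon> * (2 * \<Lambda> + 1)" using elim \<epsilon> by (intro mult_left_mono) auto
        also have "\<dots> = e / 2"
        proof -
          have "2 * \<Lambda> + 1 \<noteq> 0" using L0 by linarith
          then show ?thesis unfolding \<epsilon>_def by (rule nonzero_eq_divide_eq[THEN iffD1, OF _ refl])
        qed
        finally show ?case using elim e by simp
      qed
    qed
    from tendsto_add[OF this tendsto_mult_left[OF \<sigma>lim, of C]] show ?thesis by simp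
  qed

  text \<open>Two neighbouring small discrepancies force three consecutive extreme charges.\<close>
  obtain C1 \<delta>1 where C1: "C1 > 0" "\<delta>1 > 0"
    "\<And>x s. 0 < s \<Longrightarrow> s < \<delta>1 \<Longrightarrow> prob {w \<in> space P. \<bar>F x w\<bar> > c - s} \<le> C1 * s powr (\<kappa> + 1)"
    by (rule F_tail_bound) auto
  obtain \<delta>2 where \<delta>2: "\<delta>2 > 0" "\<And>t x. 0 < t \<Longrightarrow> t < \<delta>2 \<Longrightarrow>
       prob {w \<in> space P. discrepancy c F x w < t} \<le> (C + 1) * t powr p"
    using discrepancy_tailD[OF asym zero_less_one] unfolding p_def by blast
  define y where "y n = C1 * S n powr (\<kappa> + 1)" for n
  \<comment> \<open>The error of \<open>one_dependent_avoidance\<close> with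
    \<open>\<xi> = y ^ 3\<close>, a bound for an extreme triple, and \<open>\<eta>\<close> a
    multiple of \<open>S n powr p\<close>, which is of order \<open>1 / N\<close>.\<close>
  define err where "err n = real (2 * m n + 1) * y n ^ 3 + 2 * ((C + 1) * S n powr p) * mass n" for n
  have "\<forall>\<^sub>F n in sequentially. S n < \<delta>1" "\<forall>\<^sub>F n in sequentially. S n < \<delta>2"
    using S0 C1(2) \<delta>2(1) by (auto dest: order_tendstoD(2))
  then have bound: "\<forall>\<^sub>F n in sequentially. \<bar>prob (space P - (\<Union>j<2 * m n + 1. A n j)) - exp (- mass n)\<bar> \<le> err n"
    using eventually_gt_at_top[of 0]
  proof eventually_elim
    case (elim n)
    note Sn = Spos[OF elim(3)]
    show ?case unfolding mass_def err_def
    proof (rule one_dependent_avoidance)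
      fix k
      let ?p1 = "\<lambda>\<omega>. 2 * c - \<bar>\<omega> (Inl (X n (Suc k) + 1)) - \<omega> (Inl (X n (Suc k)))\<bar> < s n (X n (Suc k)) :: bool"
      let ?p2 = "\<lambda>\<omega>. \<forall>j\<in>{..<k}. \<not> (2 * c - \<bar>\<omega> (Inl (X n j + 1)) - \<omega> (Inl (X n j))\<bar> < s n (X n j)) :: bool"
      have "prob {w \<in> space P. ?p1 (\<lambda>k. case_sum F B k w) \<and> ?p2 (\<lambda>k. case_sum F B k w)} =
         prob {w \<in> space P. ?p1 (\<lambda>k. case_sum F B k w)} * prob {w \<in> space P. ?p2 (\<lambda>k. case_sum F B k w)}"
      \<comment> \<open>The event of index \<open>Suc k\<close> reads sites from
        \<open>X n (Suc k)\<close> on; those of index below \<open>k\<close> read sites up to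
        \<open>X n k\<close>, the right neighbour of the last one.\<close>
      proof (rule prob_local_events[of "Inl ` {X n (Suc k)..}" "Inl ` {..X n k}"])
        show "Inl ` {X n (Suc k)..} \<inter> Inl ` {..X n k} = ({} :: (int + int) set)" by (auto simp: X_def)
        fix \<omega> \<omega>' :: "int + int \<Rightarrow> real"
        assume "\<And>i. i \<in> Inl ` {..X n k} \<Longrightarrow> \<omega> i = \<omega>' i"
        then have "\<omega> (Inl (X n j)) = \<omega>' (Inl (X n j))" "\<omega> (Inl (X n j + 1)) = \<omega>' (Inl (X n j + 1))" if "j < k" for j
          using that by (auto simp: X_def)
        then show "?p2 \<omega> = ?p2 \<omega>'" by simp
      qed auto
      moreover have "A n (Suc k) \<inter> (space P - (\<Union>j<k. A n j)) = {w \<in> space P. ?p1 (\<lambda>k. case_sum F B k w) \<and> ?p2 (\<lambda>k. case_sum F B k w)}"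
        "A n (Suc k) = {w \<in> space P. ?p1 (\<lambda>k. case_sum F B k w)}"
        "space P - (\<Union>j<k. A n j) = {w \<in> space P. ?p2 (\<lambda>k. case_sum F B k w)}"
        by (auto simp: A_def discrepancy_def)
      ultimately show "prob (A n (Suc k) \<inter> (space P - (\<Union>j<k. A n j))) = prob (A n (Suc k)) * prob (space P - (\<Union>j<k. A n j))"
        by simp
    next
      fix k
      have "prob (A n k) \<le> prob {w \<in> space P. discrepancy c F (X n k) w < S n}"
        unfolding A_def using sS[of n "X n k"] by (intro finite_measure_mono) (auto simp: subset_iff)
      also have "\<dots> \<le> (C + 1) * S n powr p" by (rule \<delta>2(2)[OF Sn elim(2)])
      finally show "prob (A n k) \<le> (C + 1) * S n powr p" .
      let ?x = "X n k"
      have "prob (A n k \<inter> A n (Suc k)) \<le> prob {w \<in> space P. \<bar>F ?x w\<bar> > c - S n \<and> \<bar>F (?x + 1) w\<bar> > c - S n \<and> \<bar>F (?x + 2) w\<bar> > c - S n}"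
      proof (rule finite_measure_mono_AE)
        show "AE w in P. w \<in> A n k \<inter> A n (Suc k) \<longrightarrow> w \<in> {w \<in> space P. \<bar>F ?x w\<bar> > c - S n \<and> \<bar>F (?x + 1) w\<bar> > c - S n \<and> \<bar>F (?x + 2) w\<bar> > c - S n}"
          using AE_F_all
        proof eventually_elim
          case (elim w)
          show ?case
          proof
            assume w: "w \<in> A n k \<inter> A n (Suc k)"
            have X1: "X n (Suc k) = ?x + 1" by (simp add: X_def)
            have "discrepancy c F ?x w < S n" "discrepancy c F (?x + 1) w < S n" "w \<in> space P"
              using w sS[of n ?x] sS[of n "?x + 1"] by (auto simp: A_def X1)
            moreover have "\<bar>F ?x w\<bar> < c" "\<bar>F (?x + 1) w\<bar> < c" "\<bar>F (?x + 2) w\<bar> < c" using elim by auto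
            moreover have "?x + 1 + 1 = ?x + 2" by simp
            ultimately show "w \<in> {w \<in> space P. \<bar>F ?x w\<bar> > c - S n \<and> \<bar>F (?x + 1) w\<bar> > c - S n \<and> \<bar>F (?x + 2) w\<bar> > c - S n}"
              unfolding discrepancy_def by auto
          qed
        qed
      qed measurable
      also have "\<dots> \<le> y n ^ 3" unfolding y_def by (rule prob_triple_le) (rule C1(3)[OF Sn elim(1)])
      finally show "prob (A n k \<inter> A n (Suc k)) \<le> y n ^ 3" .
    qed measurable
  qed
  have err0: "err \<longlonglongrightarrow> 0"
  proof -
    have "(\<lambda>n. real (2 * m n + 1) * y n ^ 3) \<longlonglongrightarrow> 0"
    proof (rule Lim_null_comparison)
      show "\<forall>\<^sub>F n in sequentially. norm (real (2 * m n + 1) * y n ^ 3) \<le>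
          (2 * (K * scale n) + 1) * (C1 * (\<theta> / \<beta> * (scale n / real n)) powr (\<kappa> + 1)) ^ 3"
      proof (intro always_eventually allI)
        fix n
        have y: "0 \<le> y n" "y n = C1 * (\<theta> / \<beta> * (scale n / real n)) powr (\<kappa> + 1)" using C1 by (simp_all add: y_def S_def)
        have "0 \<le> K * scale n" using K0 by simp
        then have "real (2 * m n + 1) \<le> 2 * (K * scale n) + 1" unfolding m_def by simp
        then have "real (2 * m n + 1) * y n ^ 3 \<le> (2 * (K * scale n) + 1) * y n ^ 3" using y(1) by (intro mult_right_mono) auto
        then show "norm (real (2 * m n + 1) * y n ^ 3) \<le>
          (2 * (K * scale n) + 1) * (C1 * (\<theta> / \<beta> * (scale n / real n)) powr (\<kappa> + 1)) ^ 3"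
          unfolding y(2)[symmetric] using y(1) by simp
      qed
      show "(\<lambda>n. (2 * (K * scale n) + 1) * (C1 * (\<theta> / \<beta> * (scale n / real n)) powr (\<kappa> + 1)) ^ 3) \<longlonglongrightarrow> 0"
        using \<theta> \<beta> by (intro triple_error_tendsto) auto
    qed
    moreover have "(\<lambda>n. 2 * ((C + 1) * S n powr p) * mass n) \<longlonglongrightarrow> 2 * ((C + 1) * 0) * (C * (2 * \<Lambda>))"
      by (intro tendsto_intros Sp0 mass_lim)
    ultimately show ?thesis unfolding err_def[abs_def] using tendsto_add by fastforce
  qed
  have "(\<lambda>n. prob (space P - (\<Union>j<2 * m n + 1. A n j)) - exp (- mass n)) \<longlonglongrightarrow> 0"
    by (rule Lim_null_comparison[OF _ err0]) (use bound in simp)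
  moreover have "(\<lambda>n. exp (- mass n)) \<longlonglongrightarrow> exp (- (C * (2 * \<Lambda>)))" by (intro tendsto_intros mass_lim)
  ultimately have "(\<lambda>n. (prob (space P - (\<Union>j<2 * m n + 1. A n j)) - exp (- mass n)) + exp (- mass n)) \<longlonglongrightarrow> 0 + exp (- (C * (2 * \<Lambda>)))"
    by (rule tendsto_add)
  then have lim: "(\<lambda>n. prob (space P - (\<Union>j<2 * m n + 1. A n j))) \<longlonglongrightarrow> exp (- (C * (2 * \<Lambda>)))" by simp
  have "C * (2 * \<Lambda>) = 2 * C * \<theta> powr (2 * \<kappa> + 3) / (\<alpha> * \<beta> powr (2 * \<kappa> + 2) * (2 * \<kappa> + 3))"
    unfolding \<Lambda>_def p1 p_def[symmetric] by (simp add: mult_ac)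
  moreover have "\<forall>\<^sub>F n in sequentially. prob (space P - (\<Union>j<2 * m n + 1. A n j)) = prob {w \<in> space P. \<forall>x. real_of_int \<bar>x\<bar> \<le> K * scale n \<longrightarrow>
       \<theta> * scale n \<le> \<alpha> * real_of_int \<bar>x\<bar> + \<beta> * real n * discrepancy c F x w}"
    using eventually_gt_at_top[of 0]
  proof eventually_elim
    case (elim n)
    have mem: "w \<in> A n j \<longleftrightarrow> w \<in> space P \<and> \<not> (\<theta> * scale n \<le> \<alpha> * real_of_int \<bar>X n j\<bar> + \<beta> * real n * discrepancy c F (X n j) w)" for w j
    proof -
      have "0 < \<beta> * real n" using \<beta> elim by simp
      then show ?thesis by (auto simp: A_def s_def pos_less_divide_eq algebra_simps)
    qed
    have idx: "real_of_int \<bar>x\<bar> \<le> K * scale n \<longleftrightarrow> (\<exists>j<2 * m n + 1. x = X n j)" for x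
    proof -
      have "0 \<le> K * scale n" using K0 by simp
      then have "real_of_int \<bar>x\<bar> \<le> K * scale n \<longleftrightarrow> \<bar>x\<bar> \<le> int (m n)" unfolding m_def by (simp add: le_floor_iff)
      also have "\<dots> \<longleftrightarrow> (\<exists>j<2 * m n + 1. x = X n j)"
      proof
        assume "\<bar>x\<bar> \<le> int (m n)"
        then show "\<exists>j<2 * m n + 1. x = X n j" by (intro exI[of _ "nat (x + int (m n))"]) (auto simp: X_def)
      qed (auto simp: X_def)
      finally show ?thesis .
    qed
    have "space P - (\<Union>j<2 * m n + 1. A n j) = {w \<in> space P. \<forall>x. (\<exists>j<2 * m n + 1. x = X n j) \<longrightarrow>
       \<theta> * scale n \<le> \<alpha> * real_of_int \<bar>x\<bar> + \<beta> * real n * discrepancy c F x w}"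
      using mem by blast
    then show ?case by (simp only: idx)
  qed
  ultimately show ?thesis using Lim_transform_eventually[OF lim] by simp
qed

end

section \<open>Typical environments\<close>

text \<open>The clamp is inactive almost surely, but makes the cost bounded at every sample point.\<close>

definition step_cost :: "real \<Rightarrow> real \<Rightarrow> real \<Rightarrow> real" where
  "step_cost c u v = max 0 (min (2 * c) (c + u * v))"

context disorder
begin

sublocale passage_environment P F B "step_cost c" "2 * c"
proof
  show "case_prod (step_cost c) \<in> borel_measurable (borel \<Otimes>\<^sub>M borel)"
    unfolding step_cost_def by measurable
qed (use c in \<open>auto simp: step_cost_def\<close>)

definition typical :: "'a set" where
  "typical = {w \<in> space P. (\<forall>x. \<bar>F x w\<bar> < c) \<and> (\<forall>i. B i w = 1 \<or> B i w = -1)}"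

lemma typical_events [measurable]: "typical \<in> events"
  unfolding typical_def by measurable

lemma AE_typical: "AE w in P. w \<in> typical"
proof -
  have "AE w in P. \<forall>i. B i w = 1 \<or> B i w = -1" by (subst AE_all_countable) (auto intro: AE_B)
  with AE_F_all AE_space show ?thesis by eventually_elim (auto simp: typical_def)
qed

lemma step_cost_typical:
  assumes "w \<in> typical"
  shows "step_cost c (B i w) (F x w) = c + B i w * F x w"
proof -
  have "\<bar>F x w\<bar> < c" "B i w = 1 \<or> B i w = -1" using assms by (auto simp: typical_def)
  then show ?thesis by (auto simp: step_cost_def)
qed

abbreviation walk_cost :: "'a \<Rightarrow> (nat \<Rightarrow> int) \<Rightarrow> nat \<Rightarrow> real" where
  "walk_cost w \<equiv> path_cost (step_cost c) (\<lambda>y. F y w) (\<lambda>i. B i w)"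

lemma path_cost_typical:
  assumes "w \<in> typical"
  shows "walk_cost w \<gamma> s = (\<Sum>i=1..s. c + B (int i) w * F (\<gamma> i) w)"
  unfolding path_cost_def using step_cost_typical[OF assms] by simp

lemma path_cost_action:
  assumes "w \<in> typical"
  shows "walk_cost w \<gamma> s = c * real s + action B F s \<gamma> w"
  unfolding path_cost_typical[OF assms] action_def by (simp add: sum.distrib mult.commute)

section \<open>Cost of visiting new sites, and the range of cheap walks\<close>

definition mean_gap :: real where "mean_gap = expectation (\<lambda>w. c - \<bar>F 0 w\<bar>)"

lemma AE_gap: "AE w in P. \<bar>c - \<bar>F x w\<bar>\<bar> \<le> c"
  using AE_F[of x] by eventually_elim auto

lemma integrable_gap: "integrable P (\<lambda>w. c - \<bar>F x w\<bar>)"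
  by (rule integrable_const_bound[of _ c]) (use AE_gap in auto)

lemma expectation_gap: "expectation (\<lambda>w. c - \<bar>F x w\<bar>) = mean_gap"
proof -
  have "expectation (\<lambda>w. c - \<bar>F x w\<bar>) = integral\<^sup>L (distr P borel (F x)) (\<lambda>y. c - \<bar>y\<bar>)" for x
    by (subst integral_distr) auto
  then show ?thesis using F_same[of x] by (simp add: mean_gap_def)
qed

lemma mean_gap_pos: "0 < mean_gap"
proof -
  have nonneg: "AE w in P. 0 \<le> c - \<bar>F 0 w\<bar>" using AE_F[of 0] by eventually_elim auto
  then have "0 \<le> mean_gap" unfolding mean_gap_def by (rule integral_nonneg_AE)
  moreover have "mean_gap \<noteq> 0"
  proof
    assume "mean_gap = 0"
    then have "AE w in P. c - \<bar>F 0 w\<bar> = 0"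
      using integral_nonneg_eq_0_iff_AE[OF integrable_gap nonneg] by (simp add: mean_gap_def)
    with AE_F[of 0] have "AE w in P. False" by eventually_elim auto
    then show False by simp
  qed
  ultimately show ?thesis by simp
qed

lemma path_cost_ge_gaps:
  assumes "w \<in> typical" "lazy_walk n \<gamma>" "i \<le> n" "int m \<le> \<sigma> * \<gamma> i" "\<sigma> = 1 \<or> \<sigma> = -1"
  shows "(\<Sum>j=1..m. c - \<bar>F (\<sigma> * int j) w\<bar>) \<le> walk_cost w \<gamma> n"
proof (rule path_cost_ge_sum_sites[OF assms(2-5), of "step_cost c" "\<lambda>y. c - \<bar>y\<bar>"])
  show "c - \<bar>F y w\<bar> \<le> step_cost c (B j w) (F y w)" for j y
  proof -
    have "B j w = 1 \<or> B j w = -1" using assms(1) by (auto simp: typical_def)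
    then show ?thesis unfolding step_cost_typical[OF assms(1)] by (elim disjE) auto
  qed
qed (use \<phi>_nonneg in auto)

text \<open>A step onto site \<open>x\<close> costs at least \<open>c - \<bar>F x\<bar>\<close>
  whatever the sign, and a walk to \<open>p * b\<close> must visit all sites in between. So the mean
  cost per unit distance is at least \<open>mean_gap\<close>, at every speed.\<close>

lemma travel_const_pos:
  assumes "1 \<le> M"
  shows "0 < travel_const M"
proof -
  have "mean_gap \<le> travel_const M"
  proof (rule travel_const_ge[OF assms])
    fix p r :: nat assume pr: "1 \<le> p" "p \<le> r"
    show "mean_gap * real p \<le> speed_const p r"
    proof (rule speed_const_ge[OF pr])
      fix b :: nat
      have "mean_gap * real p * real b = expectation (\<lambda>w. \<Sum>j=1..p * b. c - \<bar>F (1 * int j) w\<bar>)"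
        using integrable_gap expectation_gap by (subst Bochner_Integration.integral_sum) auto
      also have "\<dots> \<le> expectation (T (int (p * b)) (r * b))"
      proof (rule integral_mono_AE)
        show "integrable P (T (int (p * b)) (r * b))"
          using T_integrable[OF pr, where u=0 and v=0 and b=b] by simp
        show "AE w in P. (\<Sum>j=1..p * b. c - \<bar>F (1 * int j) w\<bar>) \<le> T (int (p * b)) (r * b) w"
          using AE_typical
        proof eventually_elim
          case (elim w)
          have "\<bar>int (p * b)\<bar> \<le> int (r * b)" using pr by (simp flip: of_nat_mult)
          then obtain \<gamma> where \<gamma>: "lazy_walk (r * b) \<gamma>" "\<gamma> (r * b) = int (p * b)"
            "T (int (p * b)) (r * b) w = walk_cost w \<gamma> (r * b)"
            by (rule passage_attained)
          show ?case unfolding \<gamma>(3) by (rule path_cost_ge_gaps[OF elim \<gamma>(1) order_refl]) (use \<gamma>(2) in auto)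
        qed
      qed (use integrable_gap in auto)
      finally show "mean_gap * real p * real b \<le> expectation (T (int (p * b)) (r * b))" .
    qed
  qed
  then show ?thesis using mean_gap_pos by linarith
qed

lemma gap_law:
  assumes \<sigma>: "\<sigma> = 1 \<or> \<sigma> = -1" and \<epsilon>: "\<epsilon> > 0"
  shows "(\<lambda>k. prob {w \<in> space P. (\<Sum>j=1..k. c - \<bar>F (\<sigma> * int j) w\<bar>) \<le> (mean_gap - \<epsilon>) * real k}) \<longlonglongrightarrow> 0"
proof -
  let ?X = "\<lambda>j w. c - \<bar>F (\<sigma> * int (Suc j)) w\<bar>"
  have lim: "(\<lambda>k. prob {w \<in> space P. \<epsilon> * real k \<le> \<bar>(\<Sum>j<k. ?X j w) - (\<Sum>j<k. expectation (?X j))\<bar>}) \<longlonglongrightarrow> 0"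
  proof (rule finite_range_weak_law_tendsto[where K = c and D = 0])
    fix i j :: nat assume "i + 0 < j"
    then have "\<sigma> * int (Suc i) \<noteq> \<sigma> * int (Suc j)" using \<sigma> by auto
    from indep_F[OF this] have "indep_var borel ((\<lambda>y. c - \<bar>y\<bar>) \<circ> F (\<sigma> * int (Suc i))) borel ((\<lambda>y. c - \<bar>y\<bar>) \<circ> F (\<sigma> * int (Suc j)))"
      by (rule indep_var_compose) auto
    then show "expectation (\<lambda>w. ?X i w * ?X j w) = expectation (?X i) * expectation (?X j)"
      by (intro indep_var_lebesgue_integral integrable_gap) (simp add: comp_def)
  qed (use AE_gap \<epsilon> in auto)
  show ?thesis
  proof (rule tendsto_sandwich[OF _ _ tendsto_const lim])
    have "prob {w \<in> space P. (\<Sum>j=1..k. c - \<bar>F (\<sigma> * int j) w\<bar>) \<le> (mean_gap - \<epsilon>) * real k}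
       \<le> prob {w \<in> space P. \<epsilon> * real k \<le> \<bar>(\<Sum>j<k. ?X j w) - (\<Sum>j<k. expectation (?X j))\<bar>}" for k
    proof (intro finite_measure_mono subsetI CollectI conjI)
      fix w assume w: "w \<in> {w \<in> space P. (\<Sum>j=1..k. c - \<bar>F (\<sigma> * int j) w\<bar>) \<le> (mean_gap - \<epsilon>) * real k}"
      have "(\<Sum>j=1..k. c - \<bar>F (\<sigma> * int j) w\<bar>) = (\<Sum>j<k. ?X j w)"
        by (rule sum.reindex_bij_witness[of _ Suc "\<lambda>j. j - 1"]) auto
      moreover have "(\<Sum>j<k. expectation (?X j)) = mean_gap * real k" unfolding expectation_gap by simp
      ultimately show "\<epsilon> * real k \<le> \<bar>(\<Sum>j<k. ?X j w) - (\<Sum>j<k. expectation (?X j))\<bar>"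
        using w unfolding left_diff_distrib by auto
    qed auto
    then show "\<forall>\<^sub>F k in sequentially. prob {w \<in> space P. (\<Sum>j=1..k. c - \<bar>F (\<sigma> * int j) w\<bar>) \<le> (mean_gap - \<epsilon>) * real k}
       \<le> prob {w \<in> space P. \<epsilon> * real k \<le> \<bar>(\<Sum>j<k. ?X j w) - (\<Sum>j<k. expectation (?X j))\<bar>}" by simp
  qed auto
qed

text \<open>By the law of large numbers, reaching distance \<open>K * N\<close> costs at least about
  \<open>mean_gap * K * N\<close>, which exceeds \<open>t * N\<close> for large \<open>K\<close>.
  Cheap walks are thereby confined to a window of order \<open>N\<close>.\<close>

lemma range_bound:
  assumes "0 \<le> t"
  obtains Bad K where "K > 0" "\<And>n. Bad n \<in> events" "(\<lambda>n. prob (Bad n)) \<longlonglongrightarrow> 0"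
    "\<forall>\<^sub>F n in sequentially. \<forall>w \<in> typical - Bad n. \<forall>\<gamma> i. lazy_walk n \<gamma> \<longrightarrow>
       walk_cost w \<gamma> n < t * scale n \<longrightarrow> i \<le> n \<longrightarrow>
       real_of_int \<bar>\<gamma> i\<bar> \<le> K * scale n"
proof -
  \<comment> \<open>Half of the gap is given up to fluctuations, so each site still contributes
    \<open>e\<close> on average; then \<open>e * K = t + 1\<close> leaves one unit of
    \<open>N\<close> to cover the rounding of \<open>K * N\<close>.\<close>
  define e where "e = mean_gap / 2"
  have e: "e > 0" using mean_gap_pos by (simp add: e_def)
  define K where "K = (t + 1) / e"
  have K: "K > 0" using assms e by (simp add: K_def)
  define k where "k n = nat \<lfloor>K * scale n\<rfloor>" for n
  have klim: "filterlim k at_top sequentially"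
  proof -
    have "filterlim (\<lambda>n. nat \<lfloor>scale n / (1 / K)\<rfloor>) at_top sequentially"
      by (rule filterlim_nat_floor_divide[OF scale_at_top]) (use K in simp)
    then show ?thesis by (simp add: k_def[abs_def] mult.commute)
  qed
  define Bd where "Bd \<sigma> m = {w \<in> space P. (\<Sum>j=1..m. c - \<bar>F (\<sigma> * int j) w\<bar>) \<le> (mean_gap - e) * real m}" for \<sigma> m
  have meas: "Bd \<sigma> m \<in> events" for \<sigma> m unfolding Bd_def by measurable
  show ?thesis
  proof (rule that[of K "\<lambda>n. Bd 1 (k n) \<union> Bd (-1) (k n)"])
    show "Bd 1 (k n) \<union> Bd (-1) (k n) \<in> events" for n using meas by auto
    have "(\<lambda>n. prob (Bd \<sigma> (k n))) \<longlonglongrightarrow> 0" if "\<sigma> = 1 \<or> \<sigma> = -1" for \<sigma>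
      unfolding Bd_def using filterlim_compose[OF gap_law[OF that e] klim] .
    then show "(\<lambda>n. prob (Bd 1 (k n) \<union> Bd (-1) (k n))) \<longlonglongrightarrow> 0"
      using meas by (intro measure_Un_tendsto_0) auto
    have "\<forall>\<^sub>F n in sequentially. e \<le> scale n" using scale_at_top by (simp add: filterlim_at_top)
    then show "\<forall>\<^sub>F n in sequentially. \<forall>w \<in> typical - (Bd 1 (k n) \<union> Bd (-1) (k n)). \<forall>\<gamma> i. lazy_walk n \<gamma> \<longrightarrow>
       walk_cost w \<gamma> n < t * scale n \<longrightarrow> i \<le> n \<longrightarrow>
       real_of_int \<bar>\<gamma> i\<bar> \<le> K * scale n"
    proof eventually_elim
      case (elim n)
      show ?case
      proof (intro ballI allI impI, rule ccontr)
        fix w \<gamma> i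
        assume w: "w \<in> typical - (Bd 1 (k n) \<union> Bd (-1) (k n))" and walk: "lazy_walk n \<gamma>"
          and cost: "walk_cost w \<gamma> n < t * scale n"
          and i: "i \<le> n" and far: "\<not> real_of_int \<bar>\<gamma> i\<bar> \<le> K * scale n"
        define \<sigma> :: int where "\<sigma> = (if 0 \<le> \<gamma> i then 1 else -1)"
        have \<sigma>: "\<sigma> = 1 \<or> \<sigma> = -1" "\<sigma> * \<gamma> i = \<bar>\<gamma> i\<bar>" by (auto simp: \<sigma>_def)
        have KN: "0 \<le> K * scale n" using K by simp
        have "int (k n) \<le> \<sigma> * \<gamma> i" unfolding \<sigma>(2) k_def using far KN by (simp add: floor_le_iff)
        from path_cost_ge_gaps[OF _ walk i this \<sigma>(1), of w] w
        have "(\<Sum>j=1..k n. c - \<bar>F (\<sigma> * int j) w\<bar>) < t * scale n" using cost by simp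
        moreover have "w \<notin> Bd \<sigma> (k n)" "w \<in> space P" using w \<sigma>(1) by (auto simp: typical_def)
        then have "e * real (k n) < (\<Sum>j=1..k n. c - \<bar>F (\<sigma> * int j) w\<bar>)" by (auto simp: Bd_def e_def)
        moreover have "e * (K * scale n - 1) \<le> e * real (k n)" unfolding k_def using e by (intro mult_left_mono) linarith+
        moreover have "e * (K * scale n - 1) = (t + 1) * scale n - e" using e by (simp add: K_def field_simps)
        ultimately show False using elim by (simp add: distrib_right)
      qed
    qed
  qed (rule K)
qed

text \<open>Supplies the hypothesis \<open>no_triple\<close> of the staying estimate at the
  threshold \<open>R * N / n\<close>, by a union bound over the window.\<close>

lemma no_triples:
  assumes "0 < R" "0 \<le> K"
  obtains Bad where "\<And>n. Bad n \<in> events" "(\<lambda>n. prob (Bad n)) \<longlonglongrightarrow> 0"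
    "\<And>n w x. w \<in> space P - Bad n \<Longrightarrow> real_of_int \<bar>x\<bar> \<le> K * scale n \<Longrightarrow>
       \<exists>y\<in>{x, x + 1, x + 2}. \<bar>F y w\<bar> \<le> c - R * (scale n / real n)"
proof -
  obtain C1 \<delta>1 where C1: "C1 > 0" "\<delta>1 > 0"
    "\<And>x s. 0 < s \<Longrightarrow> s < \<delta>1 \<Longrightarrow> prob {w \<in> space P. \<bar>F x w\<bar> > c - s} \<le> C1 * s powr (\<kappa> + 1)"
    by (rule F_tail_bound) auto
  define \<theta> where "\<theta> n = R * (scale n / real n)" for n
  define m where "m n = \<lfloor>K * scale n\<rfloor>" for n
  define A where "A n x = {w \<in> space P. \<bar>F x w\<bar> > c - \<theta> n \<and> \<bar>F (x + 1) w\<bar> > c - \<theta> n \<and> \<bar>F (x + 2) w\<bar> > c - \<theta> n}" for n x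
  have A [measurable]: "A n x \<in> events" for n x unfolding A_def by measurable
  show ?thesis
  proof (rule that[of "\<lambda>n. \<Union>x\<in>{- m n..m n}. A n x"])
    show "(\<Union>x\<in>{- m n..m n}. A n x) \<in> events" for n by auto
    show "(\<lambda>n. prob (\<Union>x\<in>{- m n..m n}. A n x)) \<longlonglongrightarrow> 0"
    proof (rule tendsto_sandwich[OF _ _ tendsto_const triple_error_tendsto[of R K C1]])
      have "\<theta> \<longlonglongrightarrow> 0" unfolding \<theta>_def[abs_def] using tendsto_mult_left[OF scale_ratio_tendsto, of R] by simp
      then have "\<forall>\<^sub>F n in sequentially. \<theta> n < \<delta>1" using C1(2) by (rule order_tendstoD)
      then show "\<forall>\<^sub>F n in sequentially. prob (\<Union>x\<in>{- m n..m n}. A n x) \<le>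
          (2 * (K * scale n) + 1) * (C1 * (R * (scale n / real n)) powr (\<kappa> + 1)) ^ 3"
        using eventually_gt_at_top[of 0]
      proof eventually_elim
        case (elim n)
        have \<theta>: "0 < \<theta> n" using elim assms by (simp add: \<theta>_def)
        let ?y = "C1 * (R * (scale n / real n)) powr (\<kappa> + 1)"
        have y: "prob (A n x) \<le> ?y ^ 3" for x
          unfolding A_def by (rule prob_triple_le) (use C1(3)[OF \<theta> elim(1)] in \<open>simp add: \<theta>_def\<close>)
        have m0: "0 \<le> m n" using assms by (simp add: m_def)
        have "prob (\<Union>x\<in>{- m n..m n}. A n x) \<le> (\<Sum>x\<in>{- m n..m n}. prob (A n x))"
          by (intro finite_measure_subadditive_finite) auto
        also have "\<dots> \<le> (\<Sum>x\<in>{- m n..m n}. ?y ^ 3)" by (intro sum_mono y)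
        also have "\<dots> = real_of_int (2 * m n + 1) * ?y ^ 3" using m0 by simp
        also have "\<dots> \<le> (2 * (K * scale n) + 1) * ?y ^ 3"
          using C1(1) by (intro mult_right_mono) (auto simp: m_def)
        finally show ?case .
      qed
    qed (use assms in auto)
    fix n w x assume w: "w \<in> space P - (\<Union>x\<in>{- m n..m n}. A n x)" and x: "real_of_int \<bar>x\<bar> \<le> K * scale n"
    have "\<bar>x\<bar> \<le> m n" using x by (simp add: m_def le_floor_iff)
    then have "x \<in> {- m n..m n}" by auto
    then have "w \<notin> A n x" using w by blast
    then show "\<exists>y\<in>{x, x + 1, x + 2}. \<bar>F y w\<bar> \<le> c - R * (scale n / real n)" using w by (auto simp: A_def \<theta>_def)
  qed
qed

section \<open>Cancellation of the signs\<close>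

lemma AE_B_bound: "AE w in P. \<bar>B i w\<bar> \<le> 1"
  using AE_B[of i] by eventually_elim auto

lemma expectation_B: "expectation (B i) = 0"
proof -
  have "expectation (B i) = expectation (\<lambda>w. indicator {w \<in> space P. B i w = 1} w - indicator {w \<in> space P. B i w = -1} w)"
    using AE_B[of i] by (intro integral_cong_AE) (auto simp: indicator_def)
  also have "\<dots> = prob {w \<in> space P. B i w = 1} - prob {w \<in> space P. B i w = -1}"
    by (subst Bochner_Integration.integral_diff) (auto simp: emeasure_eq_measure)
  finally show ?thesis by (simp add: B_plus B_minus)
qed

lemma uncorrelated_B:
  assumes "i \<noteq> j"
  shows "expectation (\<lambda>w. B i w * B j w) = expectation (B i) * expectation (B j)"
proof -
  have "indep_var borel (\<lambda>w. (\<lambda>\<omega>. \<omega> (Inr i)) (\<lambda>k. case_sum F B k w)) borel (\<lambda>w. (\<lambda>\<omega>. \<omega> (Inr j)) (\<lambda>k. case_sum F B k w))"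
    using assms by (intro indep_local_functions[of "{Inr i}" "{Inr j}"]) auto
  moreover have "integrable P (B i)" for i
    by (rule integrable_const_bound[of _ 1]) (use AE_B_bound in auto)
  ultimately show ?thesis by (intro indep_var_lebesgue_integral) simp_all
qed

lemma sum_B_law:
  assumes "\<epsilon> > 0"
  shows "(\<lambda>n. prob {w \<in> space P. \<epsilon> * real n \<le> \<bar>\<Sum>i=1..n. B (int i) w\<bar>}) \<longlonglongrightarrow> 0"
proof -
  have "(\<lambda>k. prob {w \<in> space P. \<epsilon> * real k \<le> \<bar>(\<Sum>j<k. B (int (Suc j)) w) - (\<Sum>j<k. expectation (B (int (Suc j))))\<bar>}) \<longlonglongrightarrow> 0"
    by (rule finite_range_weak_law_tendsto[where K = 1 and D = 0]) (use AE_B_bound assms in \<open>auto intro!: uncorrelated_B\<close>)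
  moreover have "(\<Sum>j<k. B (int (Suc j)) w) = (\<Sum>i=1..k. B (int i) w)" for k w
    by (rule sum.reindex_bij_witness[of _ "\<lambda>j. j - 1" Suc]) auto
  ultimately show ?thesis by (simp only: expectation_B sum.neutral_const diff_zero)
qed

text \<open>A block sum has mean modulus of order \<open>sqrt m\<close>, so all blocks together have
  mean of order \<open>n / sqrt m\<close>, and Markov's inequality applies. The block length is
  fixed independently of \<open>n\<close>, hence a bound by \<open>\<delta>\<close> uniform in
  \<open>n\<close> instead of a limit \<open>0\<close>.\<close>

lemma block_sums_bound:
  assumes "\<epsilon> > 0" "\<delta> > 0"
  obtains m :: nat where "1 \<le> m"
    "\<And>n. n > 0 \<Longrightarrow> prob {w \<in> space P. \<epsilon> * real n \<le> (\<Sum>k<n div m. \<bar>\<Sum>i=k*m+1..k*m+m. B (int i) w\<bar>)} \<le> \<delta>"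
proof -
  obtain r :: nat where r: "3 / (\<epsilon> * \<delta>) < real r" using reals_Archimedean2 by blast
  have r0: "0 < real r" using r assms by (metis divide_pos_pos less_trans mult_pos_pos zero_less_numeral)
  then have r1: "1 \<le> r" by simp
  \<comment> \<open>A square, so that \<open>sqrt m\<close> is the natural number
    \<open>r\<close>.\<close>
  define m where "m = r * r"
  let ?S = "\<lambda>k w. \<bar>\<Sum>i=k*m+1..k*m+m. B (int i) w\<bar>"
  have Sint: "integrable P (?S k)" and SE: "expectation (?S k) \<le> 3 * real r" for k
  proof -
    have intB: "integrable P (B i)" for i by (rule integrable_const_bound[of _ 1]) (use AE_B_bound in auto)
    show Si: "integrable P (?S k)" using intB by (intro integrable_abs Bochner_Integration.integrable_sum)
    let ?Y = "\<lambda>w. \<Sum>j<m. B (int (k * m + Suc j)) w"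
    have eq: "(\<Sum>i=k*m+1..k*m+m. B (int i) w) = ?Y w" for w
      by (rule sum.reindex_bij_witness[of _ "\<lambda>j. k * m + Suc j" "\<lambda>i. i - k * m - 1"]) auto
    have var: "variance ?Y \<le> real m * (2 * real 0 + 1) * (4 * 1\<^sup>2)"
      by (rule finite_range_weak_law(1)) (use AE_B_bound in \<open>auto intro!: uncorrelated_B\<close>)
    have "expectation ?Y = 0" using intB expectation_B by simp
    then have sq: "expectation (\<lambda>w. (?Y w)\<^sup>2) \<le> 4 * real m" using var by simp
    have sqi: "integrable P (\<lambda>w. (?Y w)\<^sup>2)"
    proof -
      have "integrable P (\<lambda>w. B i w * B j w)" for i j
      proof (rule integrable_const_bound[of _ 1])
        show "AE w in P. norm (B i w * B j w) \<le> 1" using AE_B[of i] AE_B[of j] by eventually_elim auto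
      qed auto
      then show ?thesis by (simp add: power2_eq_square sum_product)
    qed
    \<comment> \<open>In place of Cauchy-Schwarz:
      \<open>\<bar>Y\<bar> \<le> (Y\<^sup>2 / r + r) / 2\<close>. The second moment is at most
      \<open>4 * m\<close>, which gives \<open>5/2 * r\<close>.\<close>
    have "expectation (\<lambda>w. \<bar>?Y w\<bar>) \<le> expectation (\<lambda>w. ((?Y w)\<^sup>2 / real r + real r) / 2)"
    proof (rule integral_mono)
      fix w
      have "0 \<le> (\<bar>?Y w\<bar> - real r)\<^sup>2" by simp
      then have "2 * \<bar>?Y w\<bar> * real r \<le> (?Y w)\<^sup>2 + real r * real r" by (simp add: power2_diff power2_eq_square algebra_simps)
      then show "\<bar>?Y w\<bar> \<le> ((?Y w)\<^sup>2 / real r + real r) / 2" using r0 by (simp add: field_simps)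
    next
      show "integrable P (\<lambda>w. \<bar>?Y w\<bar>)" using Si unfolding eq .
      show "integrable P (\<lambda>w. ((?Y w)\<^sup>2 / real r + real r) / 2)" using sqi by simp
    qed
    also have "\<dots> = (expectation (\<lambda>w. (?Y w)\<^sup>2) / real r + real r) / 2" using sqi by (simp add: prob_space)
    also have "\<dots> \<le> (4 * real m / real r + real r) / 2" using sq r0 by (intro divide_right_mono add_right_mono) auto
    also have "\<dots> \<le> 3 * real r" using r0 by (simp add: m_def)
    finally show "expectation (?S k) \<le> 3 * real r" unfolding eq .
  qed
  show ?thesis
  proof (rule that[of m])
    show "1 \<le> m" using r1 by (simp add: m_def)
    fix n :: nat assume n: "n > 0"
    have int: "integrable P (\<lambda>w. \<Sum>k<n div m. ?S k w)" by (rule Bochner_Integration.integrable_sum) (rule Sint)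
    have "expectation (\<lambda>w. \<Sum>k<n div m. ?S k w) = (\<Sum>k<n div m. expectation (?S k))"
      by (rule Bochner_Integration.integral_sum) (rule Sint)
    also have "\<dots> \<le> (\<Sum>k<n div m. 3 * real r)" by (intro sum_mono SE)
    also have "\<dots> = real (n div m) * (3 * real r)" by simp
    also have "\<dots> \<le> real n / real m * (3 * real r)"
    proof (intro mult_right_mono)
      have "real (n div m * m) \<le> real n" by (simp only: of_nat_le_iff div_times_less_eq_dividend)
      then show "real (n div m) \<le> real n / real m" using r0 by (simp add: m_def pos_le_divide_eq)
    qed simp
    also have "\<dots> = 3 * real n / real r" using r0 by (simp add: m_def)
    finally have E: "expectation (\<lambda>w. \<Sum>k<n div m. ?S k w) \<le> 3 * real n / real r" .
    have "prob {w \<in> space P. \<epsilon> * real n \<le> (\<Sum>k<n div m. ?S k w)} \<le> expectation (\<lambda>w. \<Sum>k<n div m. ?S k w) / (\<epsilon> * real n)"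
      using int n assms by (intro integral_Markov_inequality_measure[where A = "{}"]) (auto intro!: sum_nonneg)
    also have "\<dots> \<le> (3 * real n / real r) / (\<epsilon> * real n)" using E assms n by (intro divide_right_mono) auto
    also have "\<dots> = 3 / (\<epsilon> * real r)" using n by simp
    also have "\<dots> \<le> \<delta>" using r r0 assms by (simp add: field_simps)
    finally show "prob {w \<in> space P. \<epsilon> * real n \<le> (\<Sum>k<n div m. ?S k w)} \<le> \<delta>" .
  qed
qed

end

section \<open>Optimal walks\<close>

locale optimal_walks = disorder P F B rho c q \<kappa>
  for P :: "'a measure" and F B rho c q \<kappa> +
  fixes gbar :: "nat \<Rightarrow> 'a \<Rightarrow> nat \<Rightarrow> int" and ell :: "nat \<Rightarrow> 'a \<Rightarrow> int" and Mc :: real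
  assumes gbar_walk: "\<And>n w. w \<in> space P \<Longrightarrow> lazy_walk n (gbar n w)"
    and gbar_min: "\<And>n w \<gamma>. w \<in> space P \<Longrightarrow> lazy_walk n \<gamma> \<Longrightarrow>
                      action B F n (gbar n w) w \<le> action B F n \<gamma> w"
    and ell_range: "\<And>n w. w \<in> space P \<Longrightarrow> ell n w \<in> gbar n w ` {0..n}"
    and ell_min: "\<And>n w x. w \<in> space P \<Longrightarrow> x \<in> gbar n w ` {0..n} \<Longrightarrow>
                      discrepancy c F (ell n w) w \<le> discrepancy c F x w"
    and Mc: "Mc > 1"
    and event_meas: "\<And>n. {w \<in> space P. real (first_hit (gbar n w) (ell n w)) < Mc * \<bar>real_of_int (ell n w)\<bar>} \<in> sets P"
    and early_hit: "(\<lambda>n. measure P {w \<in> space P.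
                        real (first_hit (gbar n w) (ell n w)) < Mc * \<bar>real_of_int (ell n w)\<bar>})
                      \<longlonglongrightarrow> 1"
begin

definition M :: nat where "M = nat \<lceil>Mc\<rceil>"

lemma M: "1 \<le> M" "Mc \<le> real M"
  using Mc unfolding M_def by linarith+

abbreviation min_cost :: "nat \<Rightarrow> 'a \<Rightarrow> real" where
  "min_cost n w \<equiv> c * real n + action B F n (gbar n w) w"

lemma action_cong:
  assumes "\<And>i. i \<le> n \<Longrightarrow> \<gamma> i = \<gamma>' i"
  shows "action B F n \<gamma> w = action B F n \<gamma>' w"
  unfolding action_def using assms by (intro sum.cong) auto

text \<open>\<open>gbar\<close> is an arbitrary selection of minimisers, but its cost is the minimum
  over a finite set of walks.\<close>

lemma min_cost_measurable [measurable]: "min_cost n \<in> borel_measurable P"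
proof -
  let ?W = "{\<gamma>. lazy_walk n \<gamma> \<and> (\<forall>i>n. \<gamma> i = 0)}"
  have eq: "action B F n (gbar n w) w = Min ((\<lambda>\<gamma>. action B F n \<gamma> w) ` ?W)" if w: "w \<in> space P" for w
  proof (rule Min_eqI[symmetric])
    show "finite ((\<lambda>\<gamma>. action B F n \<gamma> w) ` ?W)" using finite_lazy_walks by simp
    show "action B F n (gbar n w) w \<le> y" if "y \<in> (\<lambda>\<gamma>. action B F n \<gamma> w) ` ?W" for y
      using that gbar_min[OF w] by auto
    let ?g = "\<lambda>i. if i \<le> n then gbar n w i else 0"
    have "?g \<in> ?W" using lazy_walk_truncate[OF gbar_walk[OF w]] by auto
    moreover have "action B F n (gbar n w) w = action B F n ?g w" by (rule action_cong) auto
    ultimately show "action B F n (gbar n w) w \<in> (\<lambda>\<gamma>. action B F n \<gamma> w) ` ?W" by blast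
  qed
  have "(\<lambda>w. Min ((\<lambda>\<gamma>. action B F n \<gamma> w) ` ?W)) \<in> borel_measurable P"
    unfolding action_def by (intro borel_measurable_Min finite_lazy_walks) measurable
  then have "(\<lambda>w. action B F n (gbar n w) w) \<in> borel_measurable P"
    using measurable_cong[of P "\<lambda>w. action B F n (gbar n w) w" "\<lambda>w. Min ((\<lambda>\<gamma>. action B F n \<gamma> w) ` ?W)" borel] eq by simp
  then show ?thesis by measurable
qed

lemma min_cost_eq:
  "w \<in> typical \<Longrightarrow> min_cost n w = walk_cost w (gbar n w) n"
  by (simp add: path_cost_action)

lemma min_cost_le:
  assumes "w \<in> typical" "lazy_walk n \<gamma>"
  shows "min_cost n w \<le> walk_cost w \<gamma> n"
  using gbar_min[OF _ assms(2), of w] assms(1) by (simp add: path_cost_action typical_def)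

text \<open>The exponent in \<open>extreme_limit\<close> for travelling slope
  \<open>\<alpha>\<close>, staying slope \<open>\<beta>\<close> and level
  \<open>\<theta>\<close>.\<close>

definition rate :: "real \<Rightarrow> real \<Rightarrow> real \<Rightarrow> real \<Rightarrow> real" where
  "rate C \<alpha> \<beta> \<theta> = 2 * C * \<theta> powr (2 * \<kappa> + 3) / (\<alpha> * \<beta> powr (2 * \<kappa> + 2) * (2 * \<kappa> + 3))"

context
  fixes C :: real
  assumes asym: "discrepancy_tail C"
begin

text \<open>Each site \<open>x\<close> of the window yields a competitor: travel there, then
  oscillate on \<open>x\<close> and \<open>x + 1\<close>. If even the minimiser costs
  \<open>t * N\<close>, no competitor is cheaper, which forces the extremal event with slightly
  perturbed constants.\<close>

lemma min_cost_tail_upper: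
  assumes \<epsilon>: "0 < \<epsilon>" "\<epsilon> < t" and \<delta>: "0 < \<delta>"
  shows "\<forall>\<^sub>F n in sequentially. prob {w \<in> space P. t * scale n \<le> min_cost n w}
      < exp (- rate C (travel_const M + \<epsilon>) (1/2 + \<epsilon>) (t - \<epsilon>)) + \<delta>"
proof -
  let ?a = "travel_const M + \<epsilon>" and ?b = "1/2 + \<epsilon>"
  have a: "?a > 0" using travel_const_pos[OF M(1)] \<epsilon> by simp
  define K where "K = (t - \<epsilon>) / ?a"
  have K: "0 \<le> K" "t - \<epsilon> \<le> ?a * K" using a \<epsilon> by (auto simp: K_def)
  obtain Bad R where Bad: "\<And>n. Bad n \<in> sets P" "(\<lambda>n. prob (Bad n)) \<longlonglongrightarrow> 0"
    "\<forall>\<^sub>F n in sequentially. \<forall>w \<in> space P - Bad n. \<forall>x. real_of_int \<bar>x\<bar> \<le> K * scale n \<longrightarrow>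
        (\<exists>s \<gamma>. lazy_walk s \<gamma> \<and> \<gamma> s = x \<and> real s \<le> R * scale n \<and>
          walk_cost w \<gamma> s \<le> ?a * real_of_int \<bar>x\<bar> + \<epsilon> * scale n)"
    by (rule travel_upper[OF M(1) \<epsilon>(1) K(1) scale_at_top]) auto
  \<comment> \<open>Off this event the majority sign occurs at most
    \<open>(1/2 + \<epsilon>) * n\<close> times.\<close>
  define Bad' where "Bad' n = {w \<in> space P. 2 * \<epsilon> * real n \<le> \<bar>\<Sum>i=1..n. B (int i) w\<bar>}" for n
  have Bad': "\<And>n. Bad' n \<in> sets P" "(\<lambda>n. prob (Bad' n)) \<longlonglongrightarrow> 0"
    unfolding Bad'_def using sum_B_law[of "2 * \<epsilon>"] \<epsilon> by auto
  define V where "V n = {w \<in> space P. \<forall>x. real_of_int \<bar>x\<bar> \<le> K * scale n \<longrightarrow>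
       (t - \<epsilon>) * scale n \<le> ?a * real_of_int \<bar>x\<bar> + ?b * real n * discrepancy c F x w}" for n
  have Vm: "V n \<in> sets P" for n unfolding V_def by measurable
  have lim: "(\<lambda>n. prob (V n) + (prob (Bad n) + prob (Bad' n))) \<longlonglongrightarrow> exp (- rate C ?a ?b (t - \<epsilon>)) + (0 + 0)"
    unfolding V_def rate_def
    by (intro tendsto_add Bad(2) Bad'(2) extreme_limit[OF asym]) (use a \<epsilon> K in auto)
  have "(\<lambda>n. R * (scale n / real n)) \<longlonglongrightarrow> 0" using tendsto_mult_left[OF scale_ratio_tendsto, of R] by simp
  \<comment> \<open>The competitor arrives before time \<open>n\<close>, as its travelling time is
    of order \<open>N\<close>.\<close>
  then have "\<forall>\<^sub>F n in sequentially. R * (scale n / real n) < 1" by (rule order_tendstoD) simp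
  then have le: "\<forall>\<^sub>F n in sequentially. prob {w \<in> space P. t * scale n \<le> min_cost n w}
      \<le> prob (V n) + (prob (Bad n) + prob (Bad' n))"
    using Bad(3) eventually_gt_at_top[of 0]
  proof eventually_elim
    case (elim n)
    have n: "real n > 0" using elim by simp
    have sub: "w \<in> V n" if w: "w \<in> typical" "w \<notin> Bad n" "w \<notin> Bad' n" "t * scale n \<le> min_cost n w" for w
    proof -
      have wP: "w \<in> space P" using w by (simp add: typical_def)
      have S: "\<bar>\<Sum>i=1..n. B (int i) w\<bar> < 2 * \<epsilon> * real n" using w wP by (auto simp: Bad'_def)
      show ?thesis unfolding V_def
      proof (intro CollectI conjI allI impI wP)
        fix x assume x: "real_of_int \<bar>x\<bar> \<le> K * scale n"
        obtain s \<gamma> where s: "lazy_walk s \<gamma>" "\<gamma> s = x" "real s \<le> R * scale n"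
          "walk_cost w \<gamma> s \<le> ?a * real_of_int \<bar>x\<bar> + \<epsilon> * scale n"
          using elim(2) w wP x by blast
        have "R * scale n \<le> real n" using elim(1) n by (simp add: field_simps)
        then have sn: "s \<le> n" using s(3) by linarith
        have Fb: "\<And>y. \<bar>F y w\<bar> < c" "\<And>i. B (int i) w = 1 \<or> B (int i) w = -1" using w(1) by (auto simp: typical_def)
        obtain \<delta>' where \<delta>': "lazy_walk n \<delta>'"
          "(\<Sum>i=1..n. c + B (int i) w * F (\<delta>' i) w) \<le> (\<Sum>i=1..s. c + B (int i) w * F (\<gamma> i) w) +
            (2 * c - \<bar>F (x + 1) w - F x w\<bar>) * ((real n + \<bar>\<Sum>i=1..n. B (int i) w\<bar>) / 2)"
          by (rule stay_cost_upper[of "\<lambda>y. F y w" c "\<lambda>i. B (int i) w", OF Fb s(1,2) sn])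
        have d: "0 \<le> discrepancy c F x w" by (rule discrepancy_nonneg) (rule Fb)
        have "t * scale n \<le> walk_cost w \<delta>' n"
          using w(4) min_cost_le[OF w(1) \<delta>'(1)] by linarith
        also have "\<dots> \<le> walk_cost w \<gamma> s +
            discrepancy c F x w * ((real n + \<bar>\<Sum>i=1..n. B (int i) w\<bar>) / 2)"
          unfolding path_cost_typical[OF w(1)] discrepancy_def by (rule \<delta>'(2))
        also have "\<dots> \<le> (?a * real_of_int \<bar>x\<bar> + \<epsilon> * scale n) + discrepancy c F x w * (?b * real n)"
          using s(4) d S by (intro add_mono mult_left_mono) (auto simp: algebra_simps)
        finally show "(t - \<epsilon>) * scale n \<le> ?a * real_of_int \<bar>x\<bar> + ?b * real n * discrepancy c F x w"
          by (simp add: algebra_simps)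
      qed
    qed
    have "prob {w \<in> space P. t * scale n \<le> min_cost n w} \<le> prob (V n \<union> (Bad n \<union> Bad' n))"
    proof (rule finite_measure_mono_AE)
      show "AE w in P. w \<in> {w \<in> space P. t * scale n \<le> min_cost n w} \<longrightarrow> w \<in> V n \<union> (Bad n \<union> Bad' n)"
        using AE_typical by eventually_elim (use sub in blast)
    qed (use Vm Bad Bad' in auto)
    also have "\<dots> \<le> prob (V n) + prob (Bad n \<union> Bad' n)" using Vm Bad Bad' by (intro measure_Un_le) auto
    also have "\<dots> \<le> prob (V n) + (prob (Bad n) + prob (Bad' n))" using Bad Bad' by (intro add_left_mono measure_Un_le) auto
    finally show ?case .
  qed
  have "\<forall>\<^sub>F n in sequentially. prob (V n) + (prob (Bad n) + prob (Bad' n)) < exp (- rate C ?a ?b (t - \<epsilon>)) + \<delta>"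
    using lim by (rule order_tendstoD) (use \<delta> in simp)
  with le show ?thesis by eventually_elim linarith
qed

text \<open>If the minimiser costs less than \<open>t * N\<close>, the site \<open>ell n\<close>
  violates the extremal event. Up to the hitting time the walk pays for travelling to
  \<open>ell n\<close>, its duration being bounded by the assumption; afterwards every pair it uses
  has discrepancy at least that of \<open>ell n\<close>.\<close>

lemma min_cost_tail_lower:
  assumes t: "0 \<le> t" and \<epsilon>: "0 < \<epsilon>" "\<epsilon> < 1/2" and \<delta>: "0 < \<delta>"
  shows "\<forall>\<^sub>F n in sequentially. exp (- rate C (travel_const M) (1/2 - \<epsilon>) (t + \<epsilon>)) - \<delta>
      < prob {w \<in> space P. t * scale n \<le> min_cost n w}"
proof -
  let ?a = "travel_const M" and ?b = "1/2 - \<epsilon>"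
  have a: "?a > 0" by (rule travel_const_pos[OF M(1)])
  obtain Bad1 K0 where K0: "K0 > 0" and Bad1: "\<And>n. Bad1 n \<in> events" "(\<lambda>n. prob (Bad1 n)) \<longlonglongrightarrow> 0"
    "\<forall>\<^sub>F n in sequentially. \<forall>w \<in> typical - Bad1 n. \<forall>\<gamma> i. lazy_walk n \<gamma> \<longrightarrow>
       walk_cost w \<gamma> n < t * scale n \<longrightarrow> i \<le> n \<longrightarrow>
       real_of_int \<bar>\<gamma> i\<bar> \<le> K0 * scale n"
    by (rule range_bound[OF t]) auto
  \<comment> \<open>Large enough for the range of cheap walks and for the window required by
    \<open>extreme_limit\<close>.\<close>
  define K where "K = max K0 ((t + \<epsilon>) / ?a)"
  have K: "0 \<le> K" "K0 \<le> K" "t + \<epsilon> \<le> ?a * K"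
  proof -
    show "0 \<le> K" "K0 \<le> K" using K0 by (auto simp: K_def)
    have "(t + \<epsilon>) / ?a \<le> K" by (simp add: K_def)
    then show "t + \<epsilon> \<le> ?a * K" using a by (simp add: field_simps)
  qed
  \<comment> \<open>Three losses of at most \<open>e * n\<close> steps each, from sign fluctuations,
    from blocks with an expensive step, and from travelling and incomplete blocks, total
    \<open>2 * \<epsilon> * n\<close>; the factor \<open>D / 2\<close> then leaves
    \<open>(1/2 - \<epsilon>) * n * D\<close>.\<close>
  define e where "e = 2 * \<epsilon> / 3"
  have e: "e > 0" using \<epsilon> by (simp add: e_def)
  obtain m :: nat where m: "1 \<le> m" "\<And>n. n > 0 \<Longrightarrow> prob {w \<in> space P. e * real n \<le> (\<Sum>k<n div m. \<bar>\<Sum>i=k*m+1..k*m+m. B (int i) w\<bar>)} \<le> \<delta> / 2"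
    using block_sums_bound[OF e, of "\<delta> / 2"] \<delta> by auto
  \<comment> \<open>With threshold \<open>R * N / n\<close> and total cost \<open>t * N\<close>, the
    spoiled blocks hold at most \<open>m * t * n / R\<close> steps, which this \<open>R\<close>
    keeps below \<open>e * n\<close>.\<close>
  define R where "R = real m * t / e + 1"
  have R: "R > 0" using e t by (simp add: R_def add_nonneg_pos)
  have mR: "real m * (t / R) \<le> e"
  proof -
    have "real m * t \<le> e * R" using e by (simp add: R_def distrib_left)
    then show ?thesis using R by (simp add: field_simps)
  qed
  obtain Bad2 where Bad2: "\<And>n. Bad2 n \<in> events" "(\<lambda>n. prob (Bad2 n)) \<longlonglongrightarrow> 0"
    "\<And>n w x. w \<in> space P - Bad2 n \<Longrightarrow> real_of_int \<bar>x\<bar> \<le> K * scale n \<Longrightarrow>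
       \<exists>y\<in>{x, x + 1, x + 2}. \<bar>F y w\<bar> \<le> c - R * (scale n / real n)"
    by (rule no_triples[OF R K(1)]) auto
  obtain Bad3 where Bad3: "\<And>n. Bad3 n \<in> events" "(\<lambda>n. prob (Bad3 n)) \<longlonglongrightarrow> 0"
    "\<forall>\<^sub>F n in sequentially. \<forall>w \<in> space P - Bad3 n. \<forall>s \<gamma>. lazy_walk s \<gamma> \<longrightarrow>
        int s \<le> int M * (\<bar>\<gamma> s\<bar> + 1) \<longrightarrow> real_of_int \<bar>\<gamma> s\<bar> \<le> K * scale n \<longrightarrow>
        ?a * real_of_int \<bar>\<gamma> s\<bar> - \<epsilon>/2 * scale n \<le> walk_cost w \<gamma> s"
    by (rule travel_lower[OF M(1) _ K(1) scale_at_top, of "\<epsilon>/2"]) (use \<epsilon> in auto)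
  \<comment> \<open>Unlike the other exceptional events, this one is only kept below
    \<open>\<delta> / 2\<close>, through the choice of \<open>m\<close>.\<close>
  define Bad4 where "Bad4 n = {w \<in> space P. e * real n \<le> (\<Sum>k<n div m. \<bar>\<Sum>i=k*m+1..k*m+m. B (int i) w\<bar>)}" for n
  have Bad4: "Bad4 n \<in> events" for n unfolding Bad4_def by measurable
  define Hit where "Hit n = {w \<in> space P. real (first_hit (gbar n w) (ell n w)) < Mc * \<bar>real_of_int (ell n w)\<bar>}" for n
  have Hit: "Hit n \<in> events" for n unfolding Hit_def by (rule event_meas)
  have Bad5: "(\<lambda>n. prob (space P - Hit n)) \<longlonglongrightarrow> 0"
  proof -
    have "(\<lambda>n. 1 - prob (Hit n)) \<longlonglongrightarrow> 1 - 1" using early_hit unfolding Hit_def by (intro tendsto_intros)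
    then show ?thesis by (simp add: prob_compl[OF Hit])
  qed
  define V where "V n = {w \<in> space P. \<forall>x. real_of_int \<bar>x\<bar> \<le> K * scale n \<longrightarrow>
       (t + \<epsilon>) * scale n \<le> ?a * real_of_int \<bar>x\<bar> + ?b * real n * discrepancy c F x w}" for n
  have Vm: "V n \<in> events" for n unfolding V_def by measurable
  define bad where "bad n = prob (Bad1 n) + prob (Bad2 n) + prob (Bad3 n) + prob (space P - Hit n)" for n
  have "(\<lambda>n. prob (V n) - bad n) \<longlonglongrightarrow> exp (- rate C ?a ?b (t + \<epsilon>)) - (0 + 0 + 0 + 0)"
    unfolding V_def rate_def bad_def
    by (intro tendsto_add tendsto_diff Bad1(2) Bad2(2) Bad3(2) Bad5 extreme_limit[OF asym]) (use a \<epsilon> t K in auto)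
  then have lim: "\<forall>\<^sub>F n in sequentially. exp (- rate C ?a ?b (t + \<epsilon>)) - \<delta> / 2 < prob (V n) - bad n"
    by (rule order_tendstoD) (use \<delta> in simp)
  have ratio: "(\<lambda>n. k * (scale n / real n)) \<longlonglongrightarrow> 0" for k using tendsto_mult_left[OF scale_ratio_tendsto, of k] by simp
  have "(\<lambda>n. 2 * real m * (1 / real n) + real M * K * (scale n / real n)) \<longlonglongrightarrow> 2 * real m * 0 + 0"
    by (intro tendsto_add tendsto_mult_left ratio lim_1_over_n)
  then have ev1: "\<forall>\<^sub>F n in sequentially. 2 * real m * (1 / real n) + real M * K * (scale n / real n) < e"
    by (rule order_tendstoD) (use e in simp)
  have ev2: "\<forall>\<^sub>F n in sequentially. R * (scale n / real n) < c" using ratio c by (rule order_tendstoD)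
  \<comment> \<open>Covers the additive \<open>?a\<close> that is lost when the walk first hits
    \<open>l + 1\<close> instead of \<open>l\<close>.\<close>
  have ev3: "\<forall>\<^sub>F n in sequentially. 2 * ?a / \<epsilon> \<le> scale n" using scale_at_top by (simp add: filterlim_at_top)
  show ?thesis
    using lim Bad1(3) Bad3(3) ev1 ev2 ev3 eventually_gt_at_top[of 0]
  proof eventually_elim
    case (elim n)
    have n: "real n > 0" "scale n > 0" using elim(7) by auto
    have sub: "t * scale n \<le> min_cost n w"
      if w: "w \<in> typical" "w \<in> V n" "w \<notin> Bad1 n" "w \<notin> Bad2 n" "w \<notin> Bad3 n" "w \<notin> Bad4 n" "w \<in> Hit n" for w
    proof (rule ccontr)
      assume "\<not> ?thesis"
      then have cost: "walk_cost w (gbar n w) n < t * scale n"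
        by (simp add: min_cost_eq[OF w(1)])
      have wP: "w \<in> space P" using w by (simp add: typical_def)
      have Fb: "\<And>y. \<bar>F y w\<bar> < c" "\<And>i. B (int i) w = 1 \<or> B (int i) w = -1" using w(1) by (auto simp: typical_def)
      define \<gamma> where "\<gamma> = gbar n w"
      define l where "l = ell n w"
      define \<tau> where "\<tau> = first_hit \<gamma> l"
      have walk: "lazy_walk n \<gamma>" unfolding \<gamma>_def by (rule gbar_walk[OF wP])
      have rng: "real_of_int \<bar>\<gamma> i\<bar> \<le> K * scale n" if "i \<le> n" for i
      proof -
        have "real_of_int \<bar>\<gamma> i\<bar> \<le> K0 * scale n" using elim(2) w walk cost that unfolding \<gamma>_def by blast
        also have "\<dots> \<le> K * scale n" using K(2) by (intro mult_right_mono) auto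
        finally show ?thesis .
      qed
      obtain i0 where i0: "i0 \<le> n" "\<gamma> i0 = l" using ell_range[OF wP, of n] by (auto simp: \<gamma>_def l_def)
      have hit: "\<gamma> \<tau> \<in> {l, l + 1}" unfolding \<tau>_def first_hit_def by (rule LeastI[of _ i0]) (simp add: i0)
      have \<tau>n: "\<tau> \<le> n"
      proof -
        have "\<tau> \<le> i0" unfolding \<tau>_def first_hit_def by (rule Least_le) (simp add: i0)
        then show ?thesis using i0 by simp
      qed
      have lK: "real_of_int \<bar>l\<bar> \<le> K * scale n" using rng[OF i0(1)] i0(2) by simp
      have "real \<tau> < Mc * real_of_int \<bar>l\<bar>" using w(7) by (simp add: Hit_def \<tau>_def \<gamma>_def l_def)
      also have "\<dots> \<le> real M * real_of_int \<bar>l\<bar>" using M(2) by (intro mult_right_mono) auto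
      finally have \<tau>M: "real \<tau> < real M * real_of_int \<bar>l\<bar>" .
      have ll: "\<bar>l\<bar> \<le> \<bar>\<gamma> \<tau>\<bar> + 1" using hit by auto
      have "int \<tau> \<le> int M * \<bar>l\<bar>"
      proof -
        have "real_of_int (int \<tau>) < real_of_int (int M * \<bar>l\<bar>)" using \<tau>M by simp
        then show ?thesis by (simp only: of_int_less_iff)
      qed
      also have "\<dots> \<le> int M * (\<bar>\<gamma> \<tau>\<bar> + 1)" using ll by (intro mult_left_mono) auto
      finally have travel: "?a * real_of_int \<bar>\<gamma> \<tau>\<bar> - \<epsilon>/2 * scale n \<le> walk_cost w \<gamma> \<tau>"
        using elim(3) w wP lazy_walk_mono[OF walk \<tau>n] rng[OF \<tau>n] by blast
      define D where "D = discrepancy c F l w"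
      have D0: "0 \<le> D" unfolding D_def by (rule discrepancy_nonneg) (rule Fb)
      let ?S = "\<Sum>k<n div m. \<bar>\<Sum>i=k*m+1..k*m+m. B (int i) w\<bar>"
      have "D / 2 * (real n - 2 * real m - real \<tau> - real m * (t * scale n / (R * (scale n / real n))) - ?S)
         \<le> (\<Sum>i=\<tau>+1..n. c + B (int i) w * F (\<gamma> i) w)"
      proof (rule stay_cost_lower[OF Fb walk])
        fix x assume "{x, x + 1, x + 2} \<subseteq> \<gamma> ` {0..n}"
        then obtain i where "i \<le> n" "x = \<gamma> i" by auto
        then have "real_of_int \<bar>x\<bar> \<le> K * scale n" using rng by simp
        then show "\<exists>y\<in>{x, x + 1, x + 2}. \<bar>F y w\<bar> \<le> c - R * (scale n / real n)"
          using Bad2(3)[of w n x] w wP by blast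
      next
        fix x assume "x \<in> \<gamma> ` {0..n}"
        then show "D \<le> 2 * c - \<bar>F (x + 1) w - F x w\<bar>"
          using ell_min[OF wP, of x n] by (simp add: D_def l_def \<gamma>_def discrepancy_def)
      next
        show "(\<Sum>i=1..n. c + B (int i) w * F (\<gamma> i) w) \<le> t * scale n"
          using cost unfolding path_cost_typical[OF w(1)] \<gamma>_def by simp
      qed (use D0 R n elim(5) m(1) in auto)
      moreover have "?b * real n * D \<le> D / 2 * (real n - 2 * real m - real \<tau> - real m * (t * scale n / (R * (scale n / real n))) - ?S)"
      proof -
        have "real m * (t * scale n / (R * (scale n / real n))) = real m * (t / R) * real n" using n R by (simp add: field_simps)
        also have "\<dots> \<le> e * real n" using mR n by (intro mult_right_mono) auto
        finally have 1: "real m * (t * scale n / (R * (scale n / real n))) \<le> e * real n" .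
        have 2: "?S \<le> e * real n" using w(6) wP by (auto simp: Bad4_def)
        have "real \<tau> \<le> real M * (K * scale n)" using \<tau>M mult_left_mono[OF lK, of "real M"] by linarith
        moreover have "2 * real m + real M * (K * scale n) \<le> e * real n"
        proof -
          have "(2 * real m * (1 / real n) + real M * K * (scale n / real n)) * real n \<le> e * real n"
            using elim(4) n by (intro mult_right_mono) auto
          moreover have "(2 * real m * (1 / real n) + real M * K * (scale n / real n)) * real n = 2 * real m + real M * (K * scale n)"
            using n by (simp add: distrib_right)
          ultimately show ?thesis by simp
        qed
        ultimately have 3: "2 * real m + real \<tau> \<le> e * real n" by linarith
        have "3 * (e * real n) = 2 * \<epsilon> * real n" by (simp add: e_def)
        then have "real n - 2 * \<epsilon> * real n \<le> real n - 2 * real m - real \<tau> - real m * (t * scale n / (R * (scale n / real n))) - ?S"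
          using 1 2 3 by linarith
        then have "D / 2 * (real n - 2 * \<epsilon> * real n) \<le> D / 2 * (real n - 2 * real m - real \<tau> - real m * (t * scale n / (R * (scale n / real n))) - ?S)"
          using D0 by (intro mult_left_mono) auto
        moreover have "D / 2 * (real n - 2 * \<epsilon> * real n) = ?b * real n * D" by (simp add: algebra_simps)
        ultimately show ?thesis by linarith
      qed
      moreover have "walk_cost w \<gamma> n =
         walk_cost w \<gamma> \<tau> + (\<Sum>i=\<tau>+1..n. c + B (int i) w * F (\<gamma> i) w)"
      proof -
        have un: "{1..n} = {1..\<tau>} \<union> {\<tau>+1..n}" using \<tau>n by auto
        show ?thesis unfolding path_cost_typical[OF w(1)] un by (rule sum.union_disjoint) auto
      qed
      moreover have "?a * real_of_int \<bar>l\<bar> \<le> ?a * real_of_int \<bar>\<gamma> \<tau>\<bar> + ?a"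
      proof -
        have "?a * real_of_int \<bar>l\<bar> \<le> ?a * real_of_int (\<bar>\<gamma> \<tau>\<bar> + 1)" using ll a by (intro mult_left_mono) (simp_all only: of_int_le_iff less_imp_le)
        then show ?thesis by (simp add: distrib_left)
      qed
      moreover have "?a \<le> \<epsilon>/2 * scale n" using elim(6) \<epsilon> by (simp add: field_simps)
      moreover have "walk_cost w \<gamma> n < t * scale n" using cost by (simp add: \<gamma>_def)
      ultimately have "?a * real_of_int \<bar>l\<bar> + ?b * real n * D < t * scale n + \<epsilon>/2 * scale n + \<epsilon>/2 * scale n"
        using travel by linarith
      also have "\<dots> = (t + \<epsilon>) * scale n" by (simp add: algebra_simps)
      finally have "\<not> (t + \<epsilon>) * scale n \<le> ?a * real_of_int \<bar>l\<bar> + ?b * real n * discrepancy c F l w" by (simp add: D_def)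
      then show False using w(2) lK unfolding V_def by blast
    qed
    let ?E = "{w \<in> space P. t * scale n \<le> min_cost n w}"
    have "prob (V n) \<le> prob (?E \<union> (Bad1 n \<union> (Bad2 n \<union> (Bad3 n \<union> ((space P - Hit n) \<union> Bad4 n)))))"
    proof (rule finite_measure_mono_AE)
      show "AE w in P. w \<in> V n \<longrightarrow> w \<in> ?E \<union> (Bad1 n \<union> (Bad2 n \<union> (Bad3 n \<union> ((space P - Hit n) \<union> Bad4 n))))"
        using AE_typical
      proof eventually_elim
        case (elim w)
        moreover have "w \<in> space P" using elim by (simp add: typical_def)
        ultimately show ?case using sub[of w] by blast
      qed
    qed (use Bad1 Bad2 Bad3 Bad4 Hit in auto)
    also have "\<dots> \<le> prob ?E + (prob (Bad1 n) + (prob (Bad2 n) + (prob (Bad3 n) + (prob (space P - Hit n) + prob (Bad4 n)))))"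
      by (intro order_trans[OF measure_Un_le] add_left_mono) (use Bad1 Bad2 Bad3 Bad4 Hit in auto)
    finally have "prob (V n) \<le> prob ?E + bad n + prob (Bad4 n)" by (simp add: bad_def)
    moreover have "prob (Bad4 n) \<le> \<delta> / 2" unfolding Bad4_def by (rule m(2)[OF elim(7)])
    ultimately show ?case using elim(1) by linarith
  qed
qed

text \<open>Both one-sided bounds are used with \<open>\<delta> = \<epsilon>\<close> for small
  \<open>\<epsilon>\<close>, and \<open>rate\<close> is continuous in the perturbed
  constants.\<close>

lemma min_cost_tail:
  assumes "0 \<le> t"
  shows "(\<lambda>n. prob {w \<in> space P. t * scale n \<le> min_cost n w}) \<longlonglongrightarrow> exp (- rate C (travel_const M) (1/2) t)"
proof (rule order_tendstoI)
  have k: "2 * \<kappa> + 3 > 0" "2 * \<kappa> + 2 > 0" using \<kappa> by auto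
  have a: "travel_const M > 0" by (rule travel_const_pos[OF M(1)])
  let ?L = "exp (- rate C (travel_const M) (1/2) t)"
  have small: "\<forall>\<^sub>F e in at_right (0::real). 0 < e \<and> e < r" if "0 < r" for r :: real
    using that by (auto simp: eventually_at_right[of 0 1] intro!: exI[of _ r])
  {
    fix y assume y: "y < ?L"
    have p1: "((\<lambda>e. (t + e) powr (2 * \<kappa> + 3)) \<longlongrightarrow> (t + 0) powr (2 * \<kappa> + 3)) (at_right 0)"
    \<comment> \<open>\<open>t = 0\<close> is allowed here, so continuity of the power is needed at
      base \<open>0\<close>, along nonnegative bases.\<close>
    proof (rule tendsto_powr2[OF tendsto_add[OF tendsto_const tendsto_ident_at] tendsto_const])
      show "\<forall>\<^sub>F e in at_right 0. 0 \<le> t + e" using small[OF zero_less_one] by eventually_elim (use assms in auto)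
    qed (rule k)
    have p2: "((\<lambda>e. (1/2 - e) powr (2 * \<kappa> + 2)) \<longlongrightarrow> (1/2 - 0) powr (2 * \<kappa> + 2)) (at_right 0)"
      by (rule tendsto_powr[OF tendsto_diff[OF tendsto_const tendsto_ident_at] tendsto_const]) simp
    have nz: "travel_const M * (1/2 - 0) powr (2 * \<kappa> + 2) * (2 * \<kappa> + 3) \<noteq> 0" using a k by simp
    have "((\<lambda>e. exp (- rate C (travel_const M) (1/2 - e) (t + e)) - e) \<longlongrightarrow> exp (- rate C (travel_const M) (1/2 - 0) (t + 0)) - 0) (at_right 0)"
      unfolding rate_def
      by (rule tendsto_diff[OF tendsto_exp[OF tendsto_minus[OF tendsto_divide[OF tendsto_mult[OF tendsto_const p1]
          tendsto_mult[OF tendsto_mult[OF tendsto_const p2] tendsto_const] nz]]] tendsto_ident_at])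
    then have "\<forall>\<^sub>F e in at_right 0. y < exp (- rate C (travel_const M) (1/2 - e) (t + e)) - e"
      by (rule order_tendstoD) (use y in simp)
    moreover have "\<forall>\<^sub>F e in at_right (0::real). 0 < e \<and> e < 1/2" by (rule small) simp
    ultimately have "\<forall>\<^sub>F e in at_right (0::real). y < exp (- rate C (travel_const M) (1/2 - e) (t + e)) - e \<and> 0 < e \<and> e < 1/2"
      by eventually_elim auto
    then obtain e where e: "y < exp (- rate C (travel_const M) (1/2 - e) (t + e)) - e" "0 < e" "e < 1/2"
      using eventually_happens'[OF trivial_limit_at_right_real] by force
    from min_cost_tail_lower[OF assms e(2,3,2)]
    show "\<forall>\<^sub>F n in sequentially. y < prob {w \<in> space P. t * scale n \<le> min_cost n w}"
      by eventually_elim (use e in linarith)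
  }
  fix y assume y: "?L < y"
  show "\<forall>\<^sub>F n in sequentially. prob {w \<in> space P. t * scale n \<le> min_cost n w} < y"
  \<comment> \<open>The upper estimate needs \<open>\<epsilon> < t\<close>. At \<open>t = 0\<close>
    the limit is \<open>exp 0 = 1\<close>, an upper bound for any probability.\<close>
  proof (cases "t = 0")
    case True
    then have "1 < y" using y by (simp add: rate_def)
    then show ?thesis by (intro always_eventually allI) (rule le_less_trans[OF prob_le_1])
  next
    case False
    then have t: "0 < t" using assms by simp
    have "((\<lambda>e. exp (- rate C (travel_const M + e) (1/2 + e) (t - e)) + e) \<longlongrightarrow> exp (- rate C (travel_const M + 0) (1/2 + 0) (t - 0)) + 0) (at_right 0)"
    proof -
      have p1: "((\<lambda>e. (t - e) powr (2 * \<kappa> + 3)) \<longlongrightarrow> (t - 0) powr (2 * \<kappa> + 3)) (at_right 0)"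
        by (rule tendsto_powr[OF tendsto_diff[OF tendsto_const tendsto_ident_at] tendsto_const]) (use t in simp)
      have p2: "((\<lambda>e. (1/2 + e) powr (2 * \<kappa> + 2)) \<longlongrightarrow> (1/2 + 0) powr (2 * \<kappa> + 2)) (at_right 0)"
        by (rule tendsto_powr[OF tendsto_add[OF tendsto_const tendsto_ident_at] tendsto_const]) simp
      have nz: "(travel_const M + 0) * (1/2 + 0) powr (2 * \<kappa> + 2) * (2 * \<kappa> + 3) \<noteq> 0" using a k by simp
      show ?thesis
        unfolding rate_def
        by (rule tendsto_add[OF tendsto_exp[OF tendsto_minus[OF tendsto_divide[OF tendsto_mult[OF tendsto_const p1]
            tendsto_mult[OF tendsto_mult[OF tendsto_add[OF tendsto_const tendsto_ident_at] p2] tendsto_const] nz]]] tendsto_ident_at])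
    qed
    then have "\<forall>\<^sub>F e in at_right 0. exp (- rate C (travel_const M + e) (1/2 + e) (t - e)) + e < y"
      by (rule order_tendstoD) (use y in simp)
    moreover have "\<forall>\<^sub>F e in at_right (0::real). 0 < e \<and> e < t" by (rule small) (rule t)
    ultimately have "\<forall>\<^sub>F e in at_right (0::real). exp (- rate C (travel_const M + e) (1/2 + e) (t - e)) + e < y \<and> 0 < e \<and> e < t"
      by eventually_elim auto
    then obtain e where e: "exp (- rate C (travel_const M + e) (1/2 + e) (t - e)) + e < y" "0 < e" "e < t"
      using eventually_happens'[OF trivial_limit_at_right_real] by force
    from min_cost_tail_upper[OF e(2,3,2)] show ?thesis by eventually_elim (use e in linarith)
  qed
qed

end

lemma min_cost_limit:
  "\<exists>h>0. \<forall>t\<ge>0. (\<lambda>n. prob {w \<in> space P. min_cost n w / (h * scale n) \<ge> t}) \<longlonglongrightarrow> exp (- (t powr (2 * \<kappa> + 3)))"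
proof -
  obtain C where C: "C > 0" "discrepancy_tail C"
    by (rule discrepancy_asymptotics) auto
  let ?r = "rate C (travel_const M) (1/2) 1"
  have k: "2 * \<kappa> + 3 > 0" using \<kappa> by auto
  have r: "?r > 0" unfolding rate_def using C(1) k travel_const_pos[OF M(1)] by simp
  have scale_rate: "rate C (travel_const M) (1/2) \<theta> = ?r * \<theta> powr (2 * \<kappa> + 3)" for \<theta>
    by (simp add: rate_def)
  \<comment> \<open>\<open>rate\<close> is homogeneous of degree \<open>2 * \<kappa> + 3\<close> in
    the level, and \<open>h\<close> is the level at which it equals \<open>1\<close>.\<close>
  define h where "h = (1 / ?r) powr (1 / (2 * \<kappa> + 3))"
  have h: "h > 0" using r by (simp add: h_def)
  have hr: "h powr (2 * \<kappa> + 3) = 1 / ?r" using r k by (simp add: h_def powr_powr)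
  show ?thesis
  proof (intro exI[of _ h] conjI h allI impI)
    fix t :: real assume t: "0 \<le> t"
    have "rate C (travel_const M) (1/2) (h * t) = t powr (2 * \<kappa> + 3)"
      using r unfolding scale_rate[of "h * t"] powr_mult hr by simp
    then have lim: "(\<lambda>n. prob {w \<in> space P. h * t * scale n \<le> min_cost n w}) \<longlonglongrightarrow> exp (- (t powr (2 * \<kappa> + 3)))"
      using min_cost_tail[OF C(2), of "h * t"] h t by simp
    show "(\<lambda>n. prob {w \<in> space P. min_cost n w / (h * scale n) \<ge> t}) \<longlonglongrightarrow> exp (- (t powr (2 * \<kappa> + 3)))"
    proof (rule Lim_transform_eventually[OF lim])
      show "\<forall>\<^sub>F n in sequentially. prob {w \<in> space P. h * t * scale n \<le> min_cost n w} = prob {w \<in> space P. min_cost n w / (h * scale n) \<ge> t}"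
        using eventually_gt_at_top[of 0]
      proof eventually_elim
        case (elim n)
        have pos: "0 < h * scale n" using h elim by simp
        have "t \<le> z / (h * scale n) \<longleftrightarrow> h * t * scale n \<le> z" for z
          using pos_le_divide_eq[OF pos, of t z] by (simp add: mult_ac)
        then show ?case by (simp only:)
      qed
    qed
  qed
qed

end

theorem theorem2p6:
  fixes P :: "'a measure"
    and F B :: "int \<Rightarrow> 'a \<Rightarrow> real"
    and rho :: "real \<Rightarrow> real"
    and c q \<kappa> Mc :: real
    and gbar :: "nat \<Rightarrow> 'a \<Rightarrow> nat \<Rightarrow> int"
    and ell :: "nat \<Rightarrow> 'a \<Rightarrow> int"
  assumes P: "prob_space P"
    and c: "c > 0" and q: "q > 0" and \<kappa>: "\<kappa> > -1"
    and indep: "prob_space.indep_vars P (\<lambda>_. borel)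
                  (\<lambda>k. case k of Inl x \<Rightarrow> F x | Inr i \<Rightarrow> B i) (UNIV :: (int + int) set)"
    and F_distr: "\<And>x. distributed P lborel (F x) (\<lambda>y. ennreal (rho y))"
    and B_meas: "\<And>i. B i \<in> borel_measurable P"
    and B_plus: "\<And>i. measure P {w \<in> space P. B i w = 1} = 1/2"
    and B_minus: "\<And>i. measure P {w \<in> space P. B i w = -1} = 1/2"
    and rho_even: "\<And>y. rho (-y) = rho y"
    and rho_cont: "continuous_on {-c<..<c} rho"
    and rho_pos: "\<And>y. -c < y \<Longrightarrow> y < c \<Longrightarrow> rho y > 0"
    and rho_zero: "\<And>y. \<bar>y\<bar> \<ge> c \<Longrightarrow> rho y = 0"
    and rho_edge: "((\<lambda>y. rho y / \<bar>c - y\<bar> powr \<kappa>) \<longlongrightarrow> q) (at_left c)"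
    and gbar_walk: "\<And>n w. w \<in> space P \<Longrightarrow> lazy_walk n (gbar n w)"
    and gbar_min: "\<And>n w \<gamma>. w \<in> space P \<Longrightarrow> lazy_walk n \<gamma> \<Longrightarrow>
                      action B F n (gbar n w) w \<le> action B F n \<gamma> w"
    and ell_range: "\<And>n w. w \<in> space P \<Longrightarrow> ell n w \<in> gbar n w ` {0..n}"
    and ell_min: "\<And>n w x. w \<in> space P \<Longrightarrow> x \<in> gbar n w ` {0..n} \<Longrightarrow>
                      discrepancy c F (ell n w) w \<le> discrepancy c F x w"
    and Mc: "Mc > 1"
    and event_meas: "\<And>n. {w \<in> space P. real (first_hit (gbar n w) (ell n w)) < Mc * \<bar>real_of_int (ell n w)\<bar>} \<in> sets P"
    and assumption: "(\<lambda>n. measure P {w \<in> space P.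
                        real (first_hit (gbar n w) (ell n w)) < Mc * \<bar>real_of_int (ell n w)\<bar>})
                      \<longlonglongrightarrow> 1"
  shows "\<exists>h>0. \<forall>t\<ge>0. (\<lambda>n. measure P {w \<in> space P.
            (c * real n + action B F n (gbar n w) w) / (h * real n powr ((2*\<kappa>+2)/(2*\<kappa>+3))) \<ge> t})
          \<longlonglongrightarrow> exp (- (t powr (2*\<kappa>+3)))"
proof -
  interpret prob_space P by (rule P)
  interpret optimal_walks P F B rho c q \<kappa> gbar ell Mc
    by unfold_locales (fact c q \<kappa> indep F_distr B_plus B_minus rho_even rho_pos rho_zero rho_edge
        gbar_walk gbar_min ell_range ell_min Mc event_meas assumption)+
  show ?thesis by (rule min_cost_limit)
qed

end
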